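(* Let $m\ge2$, $n\ge1$ and let $\boldsymbol\alpha$ be a nonsingular real $m\times n$ matrix. Then the set $\mathcal T\!\mathbf{ad}(\boldsymbol\alpha)$ of badly $\boldsymbol\alpha$-approximable vectors has zero measure on every nondegenerate analytic submanifold of $\mathbb R^m$. Equivalently, for every $c>0$, with $\psi(q)=cq^{-n/m}$, the set $\mathcal T_\psi(\boldsymbol\alpha)$ has full measure on every nondegenerate analytic submanifold of $\mathbb R^m$.
   Context: $\|\cdot\|$ is the Euclidean norm. An $m\times n$ matrix $\boldsymbol\alpha$ is singular if for every $\epsilon>0$ there is $Q_\epsilon\ge1$ such that for all $Q\ge Q_\epsilon$ there exists $(\mathbf p,\mathbf q)\in\mathbb Z^m\times\mathbb Z^n$ with $\|\boldsymbol\alpha\mathbf q+\mathbf p\|\le\epsilon Q^{-n/m}$ and $0<\|\mathbf q\|\le Q$; nonsingular means not singular. $\mathcal T_\psi(\boldsymbol\alpha)$ is the set of $\boldsymbol\beta\in\mathbb R^m$ for which there are infinitely many $(\mathbf p,\mathbf q)\in\mathbb Z^m\times(\mathbb Z^n\setminus\{\mathbf 0\})$ with $\|\boldsymbol\alpha\mathbf q+\boldsymbol\beta+\mathbf p\|\le\psi(\|\mathbf q\|)$. A vector $\boldsymbol\beta$ is badly $\boldsymbol\alpha$-approximable if $\boldsymbol\beta\notin\mathcal T_{\psi}(\boldsymbol\alpha)$ for some $\psi$ of the form $\psi(q)=cq^{-n/m}$, $c>0$; $\mathcal T\!\mathbf{ad}(\boldsymbol\alpha)$ is the set of such $\boldsymbol\beta$.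 A manifold $\mathcal M\subset\mathbb R^m$ with local parametrization $\mathbf f$ is nondegenerate at $\mathbf f(\mathbf x)$ if for some $k$, $\mathbf f$ is $C^k$ and its partial derivatives at $\mathbf x$ of orders $1,\dots,k$ span $\mathbb R^m$; it is nondegenerate if nondegenerate at almost every point. Measure on a manifold is the induced Lebesgue measure. *)

theory Defs
  imports "HOL-Analysis.Analysis"
begin

section \<open>Inhomogeneous Diophantine approximation\<close>

definition int_vectors :: "(real ^ 'k) set" where
  "int_vectors = {v. \<forall>i. v $ i \<in> \<int>}"

text \<open>A matrix of type \<open>real ^ 'n ^ 'm\<close> has \<open>m = CARD('m)\<close> rows and \<open>n = CARD('n)\<close> columns.\<close>

definition singular_matrix :: "real ^ 'n ^ 'm \<Rightarrow> bool" where
  "singular_matrix \<alpha> \<longleftrightarrow>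
     (\<forall>\<epsilon>>0. \<exists>Q\<^sub>0\<ge>1. \<forall>Q\<ge>Q\<^sub>0. \<exists>p\<in>int_vectors. \<exists>q\<in>int_vectors.
        norm (\<alpha> *v q + p) \<le> \<epsilon> * Q powr (- (real CARD('n) / real CARD('m))) \<and>
        0 < norm q \<and> norm q \<le> Q)"

definition T_approx :: "(real \<Rightarrow> real) \<Rightarrow> real ^ 'n ^ 'm \<Rightarrow> (real ^ 'm) set" where
  "T_approx \<psi> \<alpha> =
     {\<beta>. infinite {(p, q). p \<in> int_vectors \<and> q \<in> int_vectors - {0} \<and>
                          norm (\<alpha> *v q + \<beta> + p) \<le> \<psi> (norm q)}}"

definition Tad :: "real ^ 'n ^ 'm \<Rightarrow> (real ^ 'm) set" where
  "Tad \<alpha> =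
     {\<beta>. \<exists>c>0. \<beta> \<notin> T_approx (\<lambda>q. c * q powr (- (real CARD('n) / real CARD('m)))) \<alpha>}"

section \<open>Differentiability classes\<close>

definition partial_deriv :: "'d \<Rightarrow> (real ^ 'd \<Rightarrow> real ^ 'm) \<Rightarrow> real ^ 'd \<Rightarrow> real ^ 'm" where
  "partial_deriv i f x = vector_derivative (\<lambda>t. f (x + t *\<^sub>R axis i 1)) (at 0)"

primrec iterated_partial ::
    "'d list \<Rightarrow> (real ^ 'd \<Rightarrow> real ^ 'm) \<Rightarrow> real ^ 'd \<Rightarrow> real ^ 'm" where
  "iterated_partial [] f = f"
| "iterated_partial (i # is) f = partial_deriv i (iterated_partial is f)"

text \<open>\<open>C_on k f U\<close>: on the open set \<open>U\<close>, all partial derivatives of \<open>f\<close> of order at most \<open>k\<close>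
  exist and are continuous.\<close>

primrec C_on :: "nat \<Rightarrow> (real ^ 'd \<Rightarrow> real ^ 'm) \<Rightarrow> (real ^ 'd) set \<Rightarrow> bool" where
  "C_on 0 f U \<longleftrightarrow> continuous_on U f"
| "C_on (Suc k) f U \<longleftrightarrow> continuous_on U f \<and>
     (\<forall>i. (\<forall>x\<in>U. (\<lambda>t. f (x + t *\<^sub>R axis i 1)) differentiable (at (0::real))) \<and>
          C_on k (partial_deriv i f) U)"

text \<open>Local expansion as a power series in several variables; the exponents are
  multi-indices \<open>k :: 'd \<Rightarrow> nat\<close>.\<close>

definition real_analytic_on :: "(real ^ 'd \<Rightarrow> real ^ 'm) \<Rightarrow> (real ^ 'd) set \<Rightarrow> bool" where
  "real_analytic_on f U \<longleftrightarrow>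
     (\<forall>a\<in>U. \<exists>r>0. \<exists>c :: ('d \<Rightarrow> nat) \<Rightarrow> real ^ 'm. \<forall>x\<in>ball a r.
        ((\<lambda>k. (\<Prod>i\<in>UNIV. (x $ i - a $ i) ^ k i) *\<^sub>R c k) has_sum f x) UNIV)"

section \<open>Analytic submanifolds and their induced Lebesgue measure\<close>

definition local_param ::
    "(real ^ 'm) set \<Rightarrow> (real ^ 'd) set \<Rightarrow> (real ^ 'd \<Rightarrow> real ^ 'm) \<Rightarrow> bool" where
  "local_param M U f \<longleftrightarrow>
     open U \<and> real_analytic_on f U \<and>
     (\<forall>x\<in>U. inj (frechet_derivative f (at x))) \<and>
     openin (top_of_set M) (f ` U) \<and> (\<exists>g. homeomorphism U (f ` U) f g)"

text \<open>The dimension of the submanifold is \<open>CARD('d)\<close>; it is passed as a type argument, since it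
  cannot be read off from the type of \<open>M\<close>.\<close>

definition analytic_submanifold :: "'d::finite itself \<Rightarrow> (real ^ 'm) set \<Rightarrow> bool" where
  "analytic_submanifold _ M \<longleftrightarrow>
     (\<forall>y\<in>M. \<exists>(U :: (real ^ 'd) set) f. local_param M U f \<and> y \<in> f ` U)"

text \<open>The Riemannian volume density of the metric induced from the Euclidean one,
  \<open>sqrt (det (J\<^sup>T J))\<close> with \<open>J\<close> the Jacobian matrix.\<close>

definition volume_density :: "(real ^ 'd \<Rightarrow> real ^ 'm) \<Rightarrow> real ^ 'd \<Rightarrow> real" where
  "volume_density f x =
     (let J = matrix (frechet_derivative f (at x)) in sqrt (det (transpose J ** J)))"

definition manifold_measurable :: "'d::finite itself \<Rightarrow> (real ^ 'm) set \<Rightarrow> (real ^ 'm) set \<Rightarrow> bool" where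
  "manifold_measurable _ M A \<longleftrightarrow> A \<subseteq> M \<and>
     (\<forall>(U :: (real ^ 'd) set) f. local_param M U f \<longrightarrow> U \<inter> f -` A \<in> sets lebesgue)"

text \<open>The measure of a measurable \<open>A \<subseteq> M\<close>: a piece \<open>f ` B\<close> inside one coordinate patch has measure
  equal to the integral of the volume density over \<open>B\<close>, and \<open>A\<close> is exhausted by finite disjoint
  unions of such pieces. On non-measurable sets the value is only an inner measure, so null sets
  are required to be measurable; as Lebesgue measure in the charts is complete, this excludes
  no null set.\<close>

definition manifold_volume ::
    "'d::finite itself \<Rightarrow> (real ^ 'm) set \<Rightarrow> (real ^ 'm) set \<Rightarrow> ennreal" where
  "manifold_volume _ M A =
     Sup {(\<Sum>i<k. \<integral>\<^sup>+x\<in>B i. ennreal (volume_density (f i) x) \<partial>lebesgue)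
          | (k :: nat) (U :: nat \<Rightarrow> (real ^ 'd) set) f B.
            (\<forall>i<k. local_param M (U i) (f i) \<and> B i \<in> sets lebesgue \<and>
                   B i \<subseteq> U i \<and> f i ` B i \<subseteq> A) \<and>
            disjoint_family_on (\<lambda>i. f i ` B i) {..<k}}"

definition zero_measure_on :: "'d::finite itself \<Rightarrow> (real ^ 'm) set \<Rightarrow> (real ^ 'm) set \<Rightarrow> bool" where
  "zero_measure_on D M A \<longleftrightarrow>
     manifold_measurable D M (M \<inter> A) \<and> manifold_volume D M (M \<inter> A) = 0"

definition full_measure_on :: "'d::finite itself \<Rightarrow> (real ^ 'm) set \<Rightarrow> (real ^ 'm) set \<Rightarrow> bool" where
  "full_measure_on D M A \<longleftrightarrow> zero_measure_on D M (M - A)"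

section \<open>Nondegeneracy\<close>

definition nondegenerate_at :: "'d::finite itself \<Rightarrow> (real ^ 'm) set \<Rightarrow> real ^ 'm \<Rightarrow> bool" where
  "nondegenerate_at _ M y \<longleftrightarrow>
     (\<exists>(U :: (real ^ 'd) set) f x. local_param M U f \<and> x \<in> U \<and> f x = y \<and>
        (\<exists>k. C_on k f U \<and>
             span {iterated_partial is f x | is. 1 \<le> length is \<and> length is \<le> k} = UNIV))"

definition nondegenerate :: "'d::finite itself \<Rightarrow> (real ^ 'm) set \<Rightarrow> bool" where
  "nondegenerate D M \<longleftrightarrow> full_measure_on D M {y. nondegenerate_at D M y}"

end

theory Submission
  imports Defs
begin

text \<open>Let \<open>Q\<close> be a scale at which the points \<open>\<alpha> q + p\<close> with \<open>0 < norm q \<le> Q\<close> stay at distance at least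
  \<open>\<epsilon> Q\<^sup>-\<^sup>n\<^sup>/\<^sup>m\<close> from \<open>0\<close>; by nonsingularity there are arbitrarily large such \<open>Q\<close>. With an even trigonometric
  kernel \<open>\<Phi>\<close> that has nonnegative coefficients and is concentrated on a neighbourhood of the integers
  of width comparable to \<open>Q\<^sup>-\<^sup>n\<^sup>/\<^sup>m\<close>, the function
  \<open>F y = L\<^sup>-\<^sup>n (\<Sum>u v. \<Prod>i. \<Phi> (y\<^sub>i + (\<alpha> (u - v))\<^sub>i))\<close>, where \<open>u\<close> and \<open>v\<close> run over the cube \<open>[0, L)\<^sup>n\<close> and
  \<open>L\<close> is comparable to \<open>Q\<close>, is tiny unless \<open>y\<close> is close to some \<open>- (\<alpha> q + p)\<close>. It is positive definite, so its
  coefficients are nonnegative with sum \<open>F 0\<close>, and \<open>F 0\<close> is bounded because of the gap. The constant coefficient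
  is bounded below, while every other fixed coefficient tends to \<open>0\<close> as \<open>Q\<close> grows. The
  Fourier transform of a measure on a nondegenerate analytic manifold tends to \<open>0\<close> at infinity, so
  the average of \<open>F\<close> over any subset of positive measure stays away from \<open>0\<close>, and hence every such subset
  contains approximable points.\<close>

section \<open>Trigonometric kernels concentrated near the integers\<close>

text \<open>The exponent n/m makes the mean of F independent of the scale: each of the m kernel
  factors has mean at least a constant times \<open>Q powr (- (n / m))\<close>, and dividing the
  \<open>L ^ (2 * n)\<close> pairs by \<open>L ^ n\<close> leaves about \<open>Q ^ n\<close>, so the
  powers of \<open>Q\<close> cancel. The obstacle is that the number of frequencies grows with
  \<open>Q\<close>, so estimates made frequency by frequency cannot be added up. Positivity removes
  it: the coefficients have total mass at most 2, hence all frequencies outside a fixed cube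
  together contribute at most twice the supremum of the Fourier transform there. Therefore decay
  without any rate is enough, and shifts by half a period provide it with continuous first
  derivatives only. Nondegeneracy and analyticity enter this decay through a single fact: for every
  nonzero v, the critical points of v \<bullet> f in a chart f form a null set.\<close>

lemma has_integral_cos_int_period:
  fixes k :: int
  shows "((\<lambda>t. cos (s + 2 * pi * real_of_int k * t)) has_integral (if k = 0 then cos s else 0)) {0..1}"
proof (cases "k = 0")
  case True
  then show ?thesis
    using has_integral_const_real[of "cos s" 0 1] by simp
next
  case False
  define F where "F t = sin (s + 2 * pi * real_of_int k * t) / (2 * pi * real_of_int k)" for t
  have "((\<lambda>t. cos (s + 2 * pi * real_of_int k * t)) has_integral (F 1 - F 0)) {0..1}"
  proof (rule fundamental_theorem_of_calculus)
    fix x :: real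
    have "(F has_real_derivative cos (s + 2 * pi * real_of_int k * x)) (at x within {0..1})"
      unfolding F_def using False by (auto intro!: derivative_eq_intros)
    then show "(F has_vector_derivative cos (s + 2 * pi * real_of_int k * x)) (at x within {0..1})"
      by (simp add: has_real_derivative_iff_has_vector_derivative)
  qed simp
  moreover have "F 1 = F 0"
    using sin_cos_eq_iff[of "s + 2 * pi * real_of_int k" s]
    by (auto simp: F_def sin_add mult.assoc)
  ultimately show ?thesis using False by simp
qed

lemma has_integral_cos_mult_cos:
  fixes a b :: nat
  shows "((\<lambda>t. cos (2 * pi * real a * (x + t)) * cos (2 * pi * real b * t)) has_integral
          (if a = b then if a = 0 then 1 else cos (2 * pi * real a * x) / 2 else 0)) {0..1}"
proof -
  let ?s = "2 * pi * real a * x"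
  have eq: "cos (2 * pi * real a * (x + t)) * cos (2 * pi * real b * t) =
      (cos (?s + 2 * pi * real_of_int (int a - int b) * t)
       + cos (?s + 2 * pi * real_of_int (int a + int b) * t)) / 2" for t
  proof -
    have "2 * pi * real a * (x + t) - 2 * pi * real b * t = ?s + 2 * pi * real_of_int (int a - int b) * t"
      "2 * pi * real a * (x + t) + 2 * pi * real b * t = ?s + 2 * pi * real_of_int (int a + int b) * t"
      by (simp_all add: algebra_simps)
    then show ?thesis by (simp only: cos_times_cos)
  qed
  have "((\<lambda>t. (cos (?s + 2 * pi * real_of_int (int a - int b) * t)
       + cos (?s + 2 * pi * real_of_int (int a + int b) * t)) / 2) has_integral
      ((if int a - int b = 0 then cos ?s else 0) + (if int a + int b = 0 then cos ?s else 0)) / 2) {0..1}"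
    by (intro has_integral_divide has_integral_add has_integral_cos_int_period)
  moreover have "((if int a - int b = 0 then cos ?s else 0) + (if int a + int b = 0 then cos ?s else 0)) / 2
     = (if a = b then if a = 0 then 1 else cos (2 * pi * real a * x) / 2 else 0)"
    by auto
  ultimately show ?thesis unfolding eq by simp
qed

text \<open>Cosines alone: for an even function the correlation integral below is its convolution
  square, whose Fourier coefficients are squares. This is the source of positive
  definiteness.\<close>

definition cos_poly :: "(nat \<Rightarrow> real) \<Rightarrow> nat \<Rightarrow> real \<Rightarrow> real" where
  "cos_poly g N x = (\<Sum>a\<le>N. g a * cos (2 * pi * real a * x))"

text \<open>Padding with zeros brings two polynomials to a common degree, and later lets a
  coefficient above the degree be read off as 0.\<close>

lemma cos_poly_extend:
  assumes "N \<le> M"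
  shows "cos_poly (\<lambda>a. if a \<le> N then g a else 0) M = cos_poly g N"
proof
  fix x
  have "(\<Sum>a\<le>M. (if a \<le> N then g a else 0) * cos (2 * pi * real a * x))
      = (\<Sum>a\<le>N. (if a \<le> N then g a else 0) * cos (2 * pi * real a * x))"
    using assms by (intro sum.mono_neutral_right) auto
  also have "\<dots> = (\<Sum>a\<le>N. g a * cos (2 * pi * real a * x))"
    by (intro sum.cong) auto
  finally show "cos_poly (\<lambda>a. if a \<le> N then g a else 0) M x = cos_poly g N x"
    by (simp add: cos_poly_def)
qed

lemma cos_poly_add:
  "\<exists>k K. cos_poly k K = (\<lambda>x. cos_poly g N x + cos_poly h M x)"
proof -
  let ?K = "max N M"
  have "cos_poly (\<lambda>a. (if a \<le> N then g a else 0) + (if a \<le> M then h a else 0)) ?K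
      = (\<lambda>x. cos_poly (\<lambda>a. if a \<le> N then g a else 0) ?K x + cos_poly (\<lambda>a. if a \<le> M then h a else 0) ?K x)"
    unfolding cos_poly_def by (intro ext) (simp only: sum.distrib distrib_right)
  then show ?thesis
    using cos_poly_extend[of N ?K g] cos_poly_extend[of M ?K h] by (intro exI) simp
qed

lemma cos_poly_scale: "cos_poly (\<lambda>a. r * g a) N = (\<lambda>x. r * cos_poly g N x)"
  by (simp add: cos_poly_def fun_eq_iff sum_distrib_left mult.assoc)

lemma cos_poly_basis: "cos_poly (\<lambda>b. if b = a then 1 else 0) a = (\<lambda>x. cos (2 * pi * real a * x))"
proof
  fix x
  have "(\<Sum>b\<le>a. (if b = a then 1 else 0) * cos (2 * pi * real b * x))
      = (\<Sum>b\<le>a. if b = a then cos (2 * pi * real b * x) else 0)"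
    by (intro sum.cong) auto
  then show "cos_poly (\<lambda>b. if b = a then 1 else 0) a x = cos (2 * pi * real a * x)"
    by (simp add: cos_poly_def)
qed

lemma cos_poly_sum:
  assumes "finite A" "\<And>a. a \<in> A \<Longrightarrow> \<exists>k K. cos_poly k K = F a"
  shows "\<exists>k K. cos_poly k K = (\<lambda>x. \<Sum>a\<in>A. r a * F a x)"
  using assms
proof (induction A rule: finite_induct)
  case empty
  have "cos_poly (\<lambda>_. 0) 0 = (\<lambda>x. 0)" by (simp add: cos_poly_def fun_eq_iff)
  then show ?case by auto
next
  case (insert b A)
  obtain k K where k: "cos_poly k K = F b" using insert.prems by blast
  obtain l L where l: "cos_poly l L = (\<lambda>x. \<Sum>a\<in>A. r a * F a x)" using insert by blast
  show ?case
    using cos_poly_add[of "\<lambda>a. r b * k a" K l L] insert.hyps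
    by (simp add: cos_poly_scale k l)
qed

lemma cos_poly_mult_cos: "\<exists>k K. cos_poly k K = (\<lambda>x. cos_poly g N x * cos (2 * pi * x))"
proof -
  have basis: "\<exists>k K. cos_poly k K = (\<lambda>x. cos (2 * pi * real a * x) * cos (2 * pi * x))" for a
  proof (cases a)
    case 0
    then show ?thesis using cos_poly_basis[of 1] by (intro exI) auto
  next
    case (Suc b)
    have eq: "cos (2 * pi * real a * x) * cos (2 * pi * x) =
       (1/2) * cos (2 * pi * real b * x) + (1/2) * cos (2 * pi * real (Suc a) * x)" for x
      by (simp add: cos_times_cos Suc algebra_simps)
    show ?thesis unfolding eq
      using cos_poly_add[of "\<lambda>c. (1/2) * (if c = b then 1 else 0)" b
          "\<lambda>c. (1/2) * (if c = Suc a then 1 else 0)" "Suc a"]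
      by (simp only: cos_poly_scale cos_poly_basis)
  qed
  have "(\<lambda>x. cos_poly g N x * cos (2 * pi * x)) =
      (\<lambda>x. \<Sum>a\<le>N. g a * (cos (2 * pi * real a * x) * cos (2 * pi * x)))"
    by (simp add: cos_poly_def sum_distrib_right mult.assoc)
  then show ?thesis
    using cos_poly_sum[of "{..N}" "\<lambda>a x. cos (2 * pi * real a * x) * cos (2 * pi * x)" g] basis
    by simp
qed

lemma cos_poly_power: "\<exists>k K. cos_poly k K = (\<lambda>x. cos (2 * pi * x) ^ n)"
proof (induction n)
  case 0
  then show ?case using cos_poly_basis[of 0] by (intro exI) auto
next
  case (Suc n)
  then obtain k K where "cos_poly k K = (\<lambda>x. cos (2 * pi * x) ^ n)" by blast
  then show ?case using cos_poly_mult_cos[of k K] by (simp add: mult.commute)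
qed

text \<open>Polynomials in cos (2 pi x) are even trigonometric polynomials, so Stone-Weierstrass on
  [-1, 1] applies. Approximating \<open>g + \<tau>/2\<close> within \<open>\<tau>/2\<close> makes
  the error one-sided and keeps the approximant above \<open>g\<close>.\<close>

lemma cos_poly_approximation:
  fixes g :: "real \<Rightarrow> real"
  assumes "continuous_on {-1..1} g" "\<tau> > 0"
  obtains k K where "\<And>x. g (cos (2 * pi * x)) \<le> cos_poly k K x"
    "\<And>x. cos_poly k K x \<le> g (cos (2 * pi * x)) + \<tau>"
proof -
  have "continuous_on {-1..1} (\<lambda>s. g s + \<tau>/2)" using assms by (intro continuous_intros)
  then obtain p where p: "real_polynomial_function p"
      "\<And>s. s \<in> {-1..1} \<Longrightarrow> \<bar>(g s + \<tau>/2) - p s\<bar> < \<tau>/2"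
    using Stone_Weierstrass_real_polynomial_function[of "{-1..1::real}" "\<lambda>s. g s + \<tau>/2" "\<tau>/2"] assms
    by auto
  obtain a n where pe: "p = (\<lambda>x. \<Sum>i\<le>n. a i * x^i)"
    using p(1) real_polynomial_function_iff_sum by blast
  obtain k K where k: "cos_poly k K = (\<lambda>x. \<Sum>i\<le>n. a i * cos (2 * pi * x)^i)"
    using cos_poly_sum[of "{..n}" "\<lambda>i x. cos (2 * pi * x)^i" a] cos_poly_power by auto
  have "\<bar>(g (cos (2 * pi * x)) + \<tau>/2) - cos_poly k K x\<bar> < \<tau>/2" for x
    using p(2)[of "cos (2 * pi * x)"] by (simp add: k pe)
  then show thesis by (intro that[of k K]) (smt (verit) field_sum_of_halves)+
qed

text \<open>Orthogonality over one period removes all mixed terms; every remaining frequency keeps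
  the square of its coefficient, whatever the shift \<open>x\<close>.\<close>

lemma cos_poly_autocorrelation:
  "((\<lambda>t. cos_poly g N (x + t) * cos_poly g N t) has_integral
      (g 0 ^ 2 + (\<Sum>a=1..N. g a ^ 2 / 2 * cos (2 * pi * real a * x)))) {0..1}"
proof -
  have eq: "cos_poly g N (x + t) * cos_poly g N t =
      (\<Sum>a\<le>N. \<Sum>b\<le>N. (g a * g b) * (cos (2 * pi * real a * (x + t)) * cos (2 * pi * real b * t)))" for t
    unfolding cos_poly_def sum_product by (intro sum.cong refl) (simp only: mult_ac)
  have "((\<lambda>t. cos_poly g N (x + t) * cos_poly g N t) has_integral
      (\<Sum>a\<le>N. \<Sum>b\<le>N. (g a * g b) *
         (if a = b then if a = 0 then 1 else cos (2 * pi * real a * x) / 2 else 0))) {0..1}"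
    unfolding eq
    by (intro has_integral_sum finite_atMost has_integral_mult_right has_integral_cos_mult_cos)
  moreover have "(\<Sum>a\<le>N. \<Sum>b\<le>N. (g a * g b) *
         (if a = b then if a = 0 then 1 else cos (2 * pi * real a * x) / 2 else 0))
      = (\<Sum>a\<le>N. g a ^ 2 * (if a = 0 then 1 else cos (2 * pi * real a * x) / 2))"
  proof (rule sum.cong)
    fix a assume a: "a \<in> {..N}"
    have "(\<Sum>b\<le>N. (g a * g b) * (if a = b then if a = 0 then 1 else cos (2 * pi * real a * x) / 2 else 0))
      = (\<Sum>b\<le>N. if a = b then (g a * g b) * (if a = 0 then 1 else cos (2 * pi * real a * x) / 2) else 0)"
      by (intro sum.cong) auto
    then show "(\<Sum>b\<le>N. (g a * g b) * (if a = b then if a = 0 then 1 else cos (2 * pi * real a * x) / 2 else 0))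
        = g a ^ 2 * (if a = 0 then 1 else cos (2 * pi * real a * x) / 2)"
      using a by (simp add: power2_eq_square)
  qed simp
  moreover have "\<dots> = g 0 ^ 2 + (\<Sum>a=1..N. g a ^ 2 / 2 * cos (2 * pi * real a * x))"
    by (simp add: sum.atMost_shift atMost_atLeast0 sum.atLeast_Suc_atMost[of 0 N])
  ultimately show ?thesis by simp
qed

lemma cos_poly_coefficient:
  assumes "a \<le> N"
  shows "((\<lambda>t. cos_poly g N t * cos (2 * pi * real a * t)) has_integral
      (if a = 0 then g 0 else g a / 2)) {0..1}"
proof -
  have eq: "cos_poly g N t * cos (2 * pi * real a * t) =
      (\<Sum>b\<le>N. g b * (cos (2 * pi * real b * (0 + t)) * cos (2 * pi * real a * t)))" for t
    by (simp add: cos_poly_def sum_distrib_right mult.assoc)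
  have "((\<lambda>t. cos_poly g N t * cos (2 * pi * real a * t)) has_integral
      (\<Sum>b\<le>N. g b * (if b = a then if b = 0 then 1 else cos (2 * pi * real b * 0) / 2 else 0))) {0..1}"
    unfolding eq by (intro has_integral_sum finite_atMost has_integral_mult_right has_integral_cos_mult_cos)
  moreover have "(\<Sum>b\<le>N. g b * (if b = a then if b = 0 then 1 else cos (2 * pi * real b * 0) / 2 else 0))
     = (\<Sum>b\<le>N. if b = a then (if a = 0 then g 0 else g a / 2) else 0)"
    by (intro sum.cong) auto
  ultimately show ?thesis using assms by simp
qed

lemma sum_symmetric_int_interval:
  fixes g :: "int \<Rightarrow> 'a::comm_monoid_add"
  shows "(\<Sum>a\<in>{- int N..int N}. g a) = g 0 + (\<Sum>a=1..N. g (int a) + g (- int a))"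
proof (induction N)
  case (Suc N)
  have "{- int (Suc N)..int (Suc N)} = insert (int (Suc N)) (insert (- int (Suc N)) {- int N..int N})"
    by auto
  then show ?case using Suc by (simp add: add_ac)
qed simp

lemma near_int_if_cos_gt:
  assumes "cos (2 * pi * x) > cos (2 * pi * \<eta>)" "0 < \<eta>" "\<eta> \<le> 1/2"
  obtains j :: int where "\<bar>x - of_int j\<bar> < \<eta>"
proof
  let ?r = "x - of_int (round x)"
  have "cos (2 * pi * x) = cos (2 * pi * ?r + 2 * pi * of_int (round x))"
    by (simp add: algebra_simps)
  also have "\<dots> = cos (2 * pi * ?r)"
    using cos_int_2pin[of "round x"] sin_int_2pin[of "round x"] by (simp add: cos_add)
  also have "\<dots> = cos \<bar>2 * pi * ?r\<bar>" by (simp only: cos_abs_real)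
  also have "\<dots> = cos (2 * pi * \<bar>?r\<bar>)" by (simp add: abs_mult)
  finally have gt: "cos (2 * pi * \<bar>?r\<bar>) > cos (2 * pi * \<eta>)" using assms(1) by simp
  have r: "\<bar>?r\<bar> \<le> 1/2" using of_int_round_abs_le[of x] by (simp add: abs_minus_commute)
  show "\<bar>?r\<bar> < \<eta>"
  proof (rule ccontr)
    assume "\<not> \<bar>?r\<bar> < \<eta>"
    then have "cos (2 * pi * \<bar>?r\<bar>) \<le> cos (2 * pi * \<eta>)"
      using r assms by (intro cos_monotone_0_pi_le) (auto simp: mult_le_cancel_left_pos)
    then show False using gt by simp
  qed
qed

text \<open>Within a sixth of a period of a maximum the cosine is at least cos (pi/3) = 1/2; this is
  the origin of the bound 1/6.\<close>

lemma cos_int_frequency_ge_half: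
  fixes a j :: int
  assumes "\<bar>x - of_int j\<bar> < \<eta>" "real_of_int \<bar>a\<bar> * \<eta> \<le> 1/6"
  shows "cos (2 * pi * real_of_int a * x) \<ge> 1/2"
proof -
  let ?r = "x - of_int j"
  have "cos (2 * pi * real_of_int a * x) = cos (2 * pi * (of_int a * ?r) + 2 * pi * of_int (a * j))"
    by (simp add: algebra_simps)
  also have "\<dots> = cos (2 * pi * (of_int a * ?r))"
    using cos_int_2pin[of "a * j"] sin_int_2pin[of "a * j"] unfolding cos_add by simp
  also have "\<dots> = cos \<bar>2 * pi * (of_int a * ?r)\<bar>" by simp
  also have "\<dots> \<ge> cos (pi / 3)"
  proof (rule cos_monotone_0_pi_le)
    have "\<bar>of_int a * ?r\<bar> \<le> of_int \<bar>a\<bar> * \<eta>"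
      using assms(1) by (simp add: abs_mult mult_left_mono)
    then have "\<bar>of_int a * ?r\<bar> \<le> 1/6" using assms(2) by linarith
    then have "2 * pi * \<bar>of_int a * ?r\<bar> \<le> 2 * pi * (1/6)" by (intro mult_left_mono) auto
    then show "\<bar>2 * pi * (of_int a * ?r)\<bar> \<le> pi / 3" by (simp add: abs_mult)
  qed auto
  finally show ?thesis by (simp add: cos_60)
qed

text \<open>The kernel is the autocorrelation of an even polynomial \<open>?P\<close>, divided by
  its value at 0, where \<open>?P\<close> lies above a bump \<open>b\<close> supported within
  \<open>\<eta>\<close> of the integers and exceeds it by at most \<open>e\<close>. Squared
  coefficients are nonnegative, and the one at frequency 0 is the largest because \<open>?P\<close>
  is nonnegative. The correlation is small once the bump and its translate are disjoint, that is,
  beyond distance \<open>2 * \<eta>\<close>. The mean \<open>c 0\<close> is the squared mean of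
  \<open>?P\<close> over its mean square, hence at least of order \<open>\<eta>\<close>.\<close>

lemma concentrated_kernel:
  fixes \<eta> \<tau> :: real
  assumes \<eta>: "0 < \<eta>" "\<eta> \<le> 1/8" and \<tau>: "0 < \<tau>"
  obtains c :: "int \<Rightarrow> real" and N :: nat where
    "\<And>a. c a \<ge> 0" "\<And>a. c a \<le> c 0" "c 0 \<ge> \<eta> / 16"
    "\<And>a. real_of_int \<bar>a\<bar> * \<eta> \<le> 1/6 \<Longrightarrow> c a \<ge> c 0 / 16"
    "\<And>a. a \<notin> {- int N..int N} \<Longrightarrow> c a = 0"
    "(\<Sum>a\<in>{- int N..int N}. c a) = 1"
    "\<And>x. (\<And>j::int. \<bar>x - of_int j\<bar> \<ge> 2 * \<eta>) \<Longrightarrow>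
        norm (\<Sum>a\<in>{- int N..int N}. of_real (c a) * cis (2 * pi * (of_int a * x))) \<le> \<tau>"
proof -
  define s0 where "s0 = cos (2 * pi * \<eta>)"
  define b0 where "b0 = 1 - s0"
  define g where "g s = max 0 (s - s0)" for s :: real
  define b where "b x = g (cos (2 * pi * x))" for x
  have "0 < 2 * pi * \<eta>" "2 * pi * \<eta> \<le> 2 * pi * (1/8)" using \<eta> by (simp_all add: mult_left_mono)
  then have "s0 < 1" and s0: "s0 \<ge> 0"
    using cos_monotone_0_pi[of 0 "2 * pi * \<eta>"] cos_ge_zero[of "2 * pi * \<eta>"] pi_gt_zero
    unfolding s0_def by auto
  then have b0: "0 < b0" "b0 \<le> 1" unfolding b0_def by auto
  \<comment> \<open>In this order, the three bounds serve \<open>?P \<le> 2 * b0\<close>, the loss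
    \<open>3 / 2 * e\<close> against \<open>k 0\<close> at low frequencies, and the smallness of
    \<open>2 * e / D\<close> against \<open>\<tau>\<close>.\<close>
  define e where "e = Min {b0, \<eta> * b0 / 48, \<tau> * (\<eta> * b0 / 4)^2 / 3}"
  have e: "0 < e" "e \<le> b0" "e \<le> \<eta> * b0 / 48" "e \<le> \<tau> * (\<eta> * b0 / 4)^2 / 3"
    unfolding e_def using \<eta> b0 \<tau> by (auto simp: Min_le_iff)
  have "continuous_on {-1..1} g" unfolding g_def by (intro continuous_intros)
  then obtain k N where kN: "\<And>x. b x \<le> cos_poly k N x" "\<And>x. cos_poly k N x \<le> b x + e"
    using cos_poly_approximation[of g e] e(1) unfolding b_def by blast
  let ?P = "cos_poly k N"
  have b_bounds: "0 \<le> b x" "b x \<le> b0" for x by (auto simp: b_def g_def b0_def \<open>s0 < 1\<close> less_imp_le)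
  have b_near: "\<exists>j::int. \<bar>x - of_int j\<bar> < \<eta>" if "b x \<noteq> 0" for x
  proof -
    have "cos (2 * pi * x) > cos (2 * pi * \<eta>)" using that by (auto simp: b_def g_def s0_def max_def split: if_splits)
    then show ?thesis using near_int_if_cos_gt[of \<eta> x] \<eta> by auto
  qed

  have P0: "0 \<le> ?P x" and P1: "?P x \<le> 2 * b0" for x
    using kN[of x] b_bounds[of x] e by auto
  have intP: "(?P has_integral k 0) {0..1}"
    using cos_poly_coefficient[of 0 N k] by simp
  define D where "D = k 0 ^ 2 + (\<Sum>a=1..N. k a ^ 2 / 2)"
  have intPP: "((\<lambda>t. ?P t * ?P t) has_integral D) {0..1}"
    using cos_poly_autocorrelation[of k N 0] by (simp add: D_def)
  \<comment> \<open>On \<open>{0..\<eta>/2}\<close> the bump is at least half its height: with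
    \<open>C = cos (pi * \<eta>)\<close> it is at least
    \<open>C - s0 = (1 - C) * (1 + 2 * C)\<close>, while
    \<open>b0 / 2 = (1 - C) * (1 + C)\<close>.\<close>
  have k0: "k 0 \<ge> \<eta> * b0 / 4"
  proof -
    have "?P x \<ge> b0 / 2" if "x \<in> {0..\<eta>/2}" for x
    proof -
      have "cos (2 * pi * x) \<ge> cos (pi * \<eta>)"
        using that \<eta> mult_left_mono[of "2 * x" \<eta> pi] mult_left_mono[of \<eta> 1 pi]
        by (intro cos_monotone_0_pi_le) (auto simp: algebra_simps)
      moreover have "s0 = 2 * (cos (pi * \<eta>))^2 - 1"
        using cos_double_cos[of "pi * \<eta>"] by (simp add: s0_def mult.assoc)
      moreover have "0 \<le> cos (pi * \<eta>)" "cos (pi * \<eta>) \<le> 1"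
        using \<eta> mult_left_mono[of \<eta> "1/2" pi] by (auto intro!: cos_ge_zero intro: order.trans[of _ 0])
      ultimately have "cos (2 * pi * x) - s0 \<ge> b0 / 2"
        unfolding b0_def using mult_left_mono[of "cos (pi * \<eta>)" 1 "cos (pi * \<eta>)"]
        by (simp add: power2_eq_square field_simps)
      then show ?thesis using kN(1)[of x] by (simp add: b_def g_def)
    qed
    then have "(\<eta>/2) * (b0/2) \<le> integral {0..\<eta>/2} ?P"
      using has_integral_le[of "\<lambda>_. b0/2" "(\<eta>/2) * (b0/2)" "{0..\<eta>/2}" ?P "integral {0..\<eta>/2} ?P"]
        has_integral_const_real[of "b0/2" 0 "\<eta>/2"] \<eta>
        integrable_on_subinterval[of ?P "{0..1}" 0 "\<eta>/2"] intP
      by (auto simp: integrable_integral has_integral_integrable)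
    also have "\<dots> \<le> integral {0..1} ?P"
      using \<eta> intP P0 by (intro integral_subset_le) (auto intro: integrable_on_subinterval)
    also have "\<dots> = k 0" using intP by (rule integral_unique)
    finally show ?thesis by simp
  qed
  have k0_pos: "k 0 > 0" using k0 \<eta> b0 by (smt (verit) divide_pos_pos mult_pos_pos)
  have D_ge: "D \<ge> k 0 ^ 2" unfolding D_def by (simp add: sum_nonneg)
  then have D_pos: "D > 0" using k0_pos by (smt (verit) zero_less_power)
  have D_le: "D \<le> 2 * b0 * k 0"
    using has_integral_le[OF intPP has_integral_mult_right[OF intP, of "2 * b0"]] P0 P1
    by (simp add: mult_right_mono)
  \<comment> \<open>For positive \<open>j\<close>, \<open>k j / 2\<close> is the coefficient of both
    exponentials of frequency \<open>j\<close> and \<open>- j\<close> in \<open>?P\<close>, so these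
    are its squared exponential coefficients. Division by the mean square \<open>D\<close> makes
    them sum to 1.\<close>
  define c where "c a = (if a = 0 then k 0 ^ 2 else if a \<in> {- int N..int N} then (k (nat \<bar>a\<bar>) / 2)^2 else 0) / D" for a :: int
  have half: "((\<lambda>t. ?P t * cos (2 * pi * real (nat \<bar>a\<bar>) * t)) has_integral k (nat \<bar>a\<bar>) / 2) {0..1}"
    if "a \<noteq> 0" "a \<in> {- int N..int N}" for a
    using that cos_poly_coefficient[of "nat \<bar>a\<bar>" N k] by auto
  have abs_half: "\<bar>k (nat \<bar>a\<bar>) / 2\<bar> \<le> k 0" if "a \<noteq> 0" "a \<in> {- int N..int N}" for a
  proof -
    have "\<bar>?P t * cos s\<bar> \<le> ?P t" for t s
      using P0[of t] by (simp add: abs_mult mult_left_le)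
    then have "k (nat \<bar>a\<bar>) / 2 \<le> k 0" "- k 0 \<le> k (nat \<bar>a\<bar>) / 2"
      using has_integral_le[OF half[OF that] intP]
        has_integral_le[OF has_integral_neg[OF intP] half[OF that]]
      by (auto simp: abs_le_iff) (smt (verit))
    then show ?thesis by linarith
  qed
  show thesis
  proof (rule that[of c N])
    show "c a \<ge> 0" for a using D_pos by (simp add: c_def)
    show "c a \<le> c 0" for a
    proof (cases "a \<noteq> 0 \<and> a \<in> {- int N..int N}")
      case True
      then have "(k (nat \<bar>a\<bar>) / 2)^2 \<le> k 0 ^ 2"
        using abs_half[of a] by (metis abs_ge_zero power2_abs power_mono)
      then show ?thesis using True D_pos by (simp add: c_def divide_right_mono)
    qed (use D_pos in \<open>auto simp: c_def\<close>)
    have "\<eta> * b0 * k 0 \<le> 4 * k 0 * k 0" using k0 k0_pos by simp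
    moreover have "\<eta> * D \<le> 2 * (\<eta> * b0 * k 0)"
      using mult_left_mono[OF D_le, of \<eta>] \<eta> by (simp add: mult_ac)
    ultimately have "\<eta> * D \<le> 8 * k 0 ^ 2" by (simp add: power2_eq_square)
    then have "\<eta> * D \<le> 16 * k 0 ^ 2" using zero_le_power2[of "k 0"] by linarith
    then show "c 0 \<ge> \<eta> / 16"
      using D_pos by (simp add: c_def field_simps)
    show "c a = 0" if "a \<notin> {- int N..int N}" for a using that by (auto simp: c_def)
    have csum: "(\<Sum>a\<in>{- int N..int N}. of_real (c a) * cis (2 * pi * (of_int a * x))) =
        of_real ((k 0 ^ 2 + (\<Sum>a=1..N. k a ^ 2 / 2 * cos (2 * pi * real a * x))) / D)" for x
    proof -
      have "(\<Sum>a\<in>{- int N..int N}. of_real (c a) * cis (2 * pi * (of_int a * x))) =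
          of_real (k 0 ^ 2 / D) + (\<Sum>a=1..N. of_real (k a ^ 2 / 2 * cos (2 * pi * real a * x) / D))"
        unfolding sum_symmetric_int_interval
      proof (intro arg_cong2[where f = "(+)"] sum.cong refl)
        fix a assume "a \<in> {1..N}"
        then have "c (int a) = (k a / 2)^2 / D" "c (- int a) = (k a / 2)^2 / D" by (auto simp: c_def)
        then show "of_real (c (int a)) * cis (2 * pi * (of_int (int a) * x)) +
            of_real (c (- int a)) * cis (2 * pi * (of_int (- int a) * x)) =
            of_real (k a ^ 2 / 2 * cos (2 * pi * real a * x) / D)"
          by (simp add: complex_eq_iff power2_eq_square mult.assoc)
      qed (simp add: c_def)
      also have "\<dots> = of_real ((k 0 ^ 2 + (\<Sum>a=1..N. k a ^ 2 / 2 * cos (2 * pi * real a * x))) / D)"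
        by (simp add: add_divide_distrib sum_divide_distrib)
      finally show ?thesis .
    qed
    have "complex_of_real (\<Sum>a\<in>{- int N..int N}. c a) = of_real (D / D)"
      using csum[of 0] by (simp add: D_def)
    then show "(\<Sum>a\<in>{- int N..int N}. c a) = 1"
      using D_pos by (simp only: of_real_eq_iff) simp
    show "c a \<ge> c 0 / 16" if a: "real_of_int \<bar>a\<bar> * \<eta> \<le> 1/6" for a
    proof (cases "a = 0")
      case False
      have low: "((\<lambda>t. ?P t * cos (2 * pi * real (nat \<bar>a\<bar>) * t)) has_integral I) {0..1} \<Longrightarrow> I \<ge> k 0 / 4" for I
      proof -
        assume I: "((\<lambda>t. ?P t * cos (2 * pi * real (nat \<bar>a\<bar>) * t)) has_integral I) {0..1}"
        \<comment> \<open>\<open>b\<close> vanishes wherever the cosine could drop below 1/2.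
          Replacing \<open>b\<close> by \<open>?P\<close> costs \<open>e\<close> on one side and
          \<open>e / 2\<close> on the other.\<close>
        have pw: "?P t / 2 - 3 / 2 * e \<le> ?P t * cos (2 * pi * real (nat \<bar>a\<bar>) * t)" for t
        proof -
          let ?C = "cos (2 * pi * real (nat \<bar>a\<bar>) * t)"
          have bC: "b t * ?C \<ge> b t / 2"
          proof (cases "b t = 0")
            case False
            then obtain j where "\<bar>t - of_int j\<bar> < \<eta>" using b_near by blast
            then have "?C \<ge> 1/2"
              using cos_int_frequency_ge_half[of t j \<eta> "\<bar>a\<bar>"] a by simp
            then show ?thesis using b_bounds(1)[of t] mult_left_mono[of "1/2" ?C "b t"] by simp
          qed simp
          have "\<bar>(?P t - b t) * ?C\<bar> \<le> e * 1"
            unfolding abs_mult using kN[of t] e by (intro mult_mono) auto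
          then have "(?P t - b t) * ?C \<ge> - e" by linarith
          then have "?P t * ?C \<ge> b t * ?C - e" by (simp add: algebra_simps)
          then show ?thesis using bC kN(2)[of t] by linarith
        qed
        have "k 0 / 2 - 3 / 2 * e \<le> I"
          using has_integral_le[OF has_integral_diff[OF has_integral_divide[OF intP, of 2]
              has_integral_const_real[of "3 / 2 * e" 0 1]] I] pw by simp
        then show "I \<ge> k 0 / 4" using e(3) k0 k0_pos by linarith
      qed
      \<comment> \<open>The degree is automatically large enough: a low frequency beyond
        \<open>N\<close> would have coefficient integral 0, against the lower bound
        \<open>k 0 / 4\<close>.\<close>
      have inN: "a \<in> {- int N..int N}"
      proof (rule ccontr)
        assume "a \<notin> {- int N..int N}"
        then have gt: "nat \<bar>a\<bar> > N" by auto
        have "((\<lambda>t. ?P t * cos (2 * pi * real (nat \<bar>a\<bar>) * t)) has_integral 0) {0..1}"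
        proof -
          have "cos_poly k N = cos_poly (\<lambda>i. if i \<le> N then k i else 0) (nat \<bar>a\<bar>)"
            using cos_poly_extend[of N "nat \<bar>a\<bar>" k] gt by simp
          then show ?thesis
            using cos_poly_coefficient[of "nat \<bar>a\<bar>" "nat \<bar>a\<bar>" "\<lambda>i. if i \<le> N then k i else 0"] gt False
            by (simp split: if_splits)
        qed
        then show False using low k0_pos by fastforce
      qed
      then have "k (nat \<bar>a\<bar>) / 2 \<ge> k 0 / 4" using low half[OF False inN] by blast
      then have "(k (nat \<bar>a\<bar>) / 2)^2 \<ge> (k 0 / 4)^2" using k0_pos by (intro power_mono) auto
      then show ?thesis using False inN D_pos by (simp add: c_def power2_eq_square field_simps)
    next
      case True
      have "c 0 \<ge> 0" using D_pos by (simp add: c_def)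
      then show ?thesis using True by simp
    qed
    show "norm (\<Sum>a\<in>{- int N..int N}. of_real (c a) * cis (2 * pi * (of_int a * x))) \<le> \<tau>"
      if far: "\<And>j::int. \<bar>x - of_int j\<bar> \<ge> 2 * \<eta>" for x
    proof -
      let ?I = "k 0 ^ 2 + (\<Sum>a=1..N. k a ^ 2 / 2 * cos (2 * pi * real a * x))"
      note I = cos_poly_autocorrelation[of k N x]
      have pw: "?P (x + t) * ?P t \<le> 2 * e" for t
      proof -
        \<comment> \<open>Two support points of \<open>b\<close>, near integers \<open>i\<close> and
          \<open>j\<close>, that differ by \<open>x\<close> would put \<open>x\<close> within
          \<open>2 * \<eta>\<close> of \<open>i - j\<close>.\<close>
        have "b (x + t) = 0 \<or> b t = 0"
        proof (rule ccontr)
          assume "\<not> (b (x + t) = 0 \<or> b t = 0)"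
          then obtain i j where "\<bar>(x + t) - of_int i\<bar> < \<eta>" "\<bar>t - of_int j\<bar> < \<eta>" using b_near by meson
          then have "\<bar>x - of_int (i - j)\<bar> < 2 * \<eta>" by simp
          then show False using far[of "i - j"] by linarith
        qed
        moreover have "?P (x + t) * ?P t \<le> (b (x + t) + e) * (b t + e)"
          using kN P0 b_bounds e by (intro mult_mono) (auto intro: add_nonneg_nonneg)
        moreover have "e * b (x + t) \<le> e * 1" "e * b t \<le> e * 1" "e * e \<le> e * 1"
          using e b0 order.trans[OF b_bounds(2) b0(2)] by (simp_all add: mult_le_cancel_left_pos)
        ultimately show ?thesis by (auto simp: algebra_simps)
      qed
      have "?I \<le> 2 * e" using has_integral_le[OF I has_integral_const_real[of "2 * e" 0 1]] pw by simp
      moreover have "?I \<ge> 0" using has_integral_nonneg[OF I] P0 by simp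
      ultimately have "\<bar>?I / D\<bar> \<le> 2 * e / D" using D_pos by (simp add: divide_right_mono)
      also have "\<dots> \<le> \<tau>"
      proof -
        have "(\<eta> * b0 / 4)^2 \<le> D" using D_ge power_mono[OF k0, of 2] \<eta> b0 by auto
        then have "\<tau> * (\<eta> * b0 / 4)^2 \<le> \<tau> * D" using \<tau> by simp
        then have "2 * e \<le> \<tau> * D" using e(1,4) by linarith
        then show ?thesis using D_pos by (simp add: field_simps)
      qed
      finally show ?thesis unfolding csum norm_of_real .
    qed
  qed
qed

section \<open>A positive definite counting function\<close>

definition int_inner :: "('m::finite \<Rightarrow> int) \<Rightarrow> real ^ 'm \<Rightarrow> real" where
  "int_inner a y = (\<Sum>i\<in>UNIV. of_int (a i) * y $ i)"

text \<open>Functions in a \<open>PiE\<close> set rather than vectors: \<open>prod_sum_PiE\<close>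
  then turns a product of one-dimensional sums into a sum over the cube.\<close>

definition nat_cube :: "nat \<Rightarrow> ('n::finite \<Rightarrow> nat) set" where
  "nat_cube L = PiE UNIV (\<lambda>_. {..<L})"

definition int_cube :: "nat \<Rightarrow> ('m::finite \<Rightarrow> int) set" where
  "int_cube N = PiE UNIV (\<lambda>_. {- int N..int N})"

definition nat_vec :: "('n::finite \<Rightarrow> nat) \<Rightarrow> real ^ 'n" where
  "nat_vec u = (\<chi> j. real (u j))"

definition exp_sum :: "real ^ 'n ^ 'm \<Rightarrow> nat \<Rightarrow> ('m::finite \<Rightarrow> int) \<Rightarrow> complex" where
  "exp_sum \<alpha> L a = (\<Sum>u\<in>nat_cube L. cis (2 * pi * int_inner a (\<alpha> *v nat_vec u)))"

definition trig_kernel :: "(int \<Rightarrow> real) \<Rightarrow> nat \<Rightarrow> real \<Rightarrow> complex" where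
  "trig_kernel c N x = (\<Sum>a\<in>{- int N..int N}. of_real (c a) * cis (2 * pi * (of_int a * x)))"

text \<open>The Fourier coefficients of the counting function; the squared exponential sum over the
  size of the cube is a weight of Fejer type.\<close>

definition counting_coeff ::
    "(int \<Rightarrow> real) \<Rightarrow> real ^ 'n ^ 'm \<Rightarrow> nat \<Rightarrow> ('m::finite \<Rightarrow> int) \<Rightarrow> real" where
  "counting_coeff c \<alpha> L a = (\<Prod>i\<in>UNIV. c (a i)) * (norm (exp_sum \<alpha> L a))\<^sup>2 / real L ^ CARD('n)"

lemma finite_nat_cube [simp]: "finite (nat_cube L)"
  and card_nat_cube: "card (nat_cube L :: ('n::finite \<Rightarrow> nat) set) = L ^ CARD('n)"
  by (simp_all add: nat_cube_def finite_PiE card_PiE)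

lemma finite_int_cube [simp]: "finite (int_cube N)"
  by (simp add: int_cube_def finite_PiE)

lemma mem_int_cube: "a \<in> int_cube N \<longleftrightarrow> (\<forall>i. \<bar>a i\<bar> \<le> int N)"
  by (auto simp: int_cube_def PiE_iff abs_le_iff minus_le_iff)

lemma int_inner_add: "int_inner a (x + y) = int_inner a x + int_inner a y"
  by (simp add: int_inner_def sum.distrib distrib_left)

lemma int_inner_diff: "int_inner a (x - y) = int_inner a x - int_inner a y"
  by (simp add: int_inner_def sum_subtractf right_diff_distrib)

lemma cis_sum: "finite A \<Longrightarrow> cis (\<Sum>i\<in>A. f i) = (\<Prod>i\<in>A. cis (f i))"
  by (induction A rule: finite_induct) (auto simp: cis_mult[symmetric])

lemma prod_trig_kernel:
  "(\<Prod>i\<in>UNIV. trig_kernel c N (y $ i)) =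
     (\<Sum>a\<in>int_cube N. of_real (\<Prod>i\<in>UNIV. c (a i)) * cis (2 * pi * int_inner a y))"
  for y :: "real ^ 'm"
proof -
  have "(\<Prod>i\<in>UNIV. trig_kernel c N (y $ i)) =
     (\<Sum>a\<in>int_cube N. \<Prod>i\<in>UNIV. of_real (c (a i)) * cis (2 * pi * (of_int (a i) * y $ i)))"
    unfolding trig_kernel_def int_cube_def by (intro prod_sum_PiE) auto
  also have "\<dots> = (\<Sum>a\<in>int_cube N. of_real (\<Prod>i\<in>UNIV. c (a i)) * cis (2 * pi * int_inner a y))"
    by (intro sum.cong refl) (simp add: prod.distrib int_inner_def sum_distrib_left cis_sum)
  finally show ?thesis .
qed

text \<open>For a fixed frequency the double sum over \<open>u\<close> and \<open>v\<close> factors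
  into \<open>exp_sum\<close> times its conjugate. This square makes the coefficients nonnegative as
  soon as \<open>c\<close> is.\<close>

lemma counting_function_expansion:
  fixes \<alpha> :: "real ^ 'n ^ 'm"
  shows "(\<Sum>u\<in>nat_cube L. \<Sum>v\<in>nat_cube L.
            \<Prod>i\<in>UNIV. trig_kernel c N ((y + \<alpha> *v (nat_vec u - nat_vec v)) $ i)) / of_nat L ^ CARD('n)
       = (\<Sum>a\<in>int_cube N. of_real (counting_coeff c \<alpha> L a) * cis (2 * pi * int_inner a y))"
proof -
  let ?e = "\<lambda>a u. cis (2 * pi * int_inner a (\<alpha> *v nat_vec u))"
  let ?c = "\<lambda>a. complex_of_real (\<Prod>i\<in>UNIV. c (a i))"
  have "(\<Prod>i\<in>UNIV. trig_kernel c N ((y + \<alpha> *v (nat_vec u - nat_vec v)) $ i)) =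
      (\<Sum>a\<in>int_cube N. ?c a * cis (2 * pi * int_inner a y) * (?e a u * cnj (?e a v)))" for u v
    unfolding prod_trig_kernel
    by (intro sum.cong refl)
      (simp add: int_inner_add int_inner_diff matrix_vector_mult_diff_distrib cis_cnj cis_mult
        right_diff_distrib distrib_left mult.assoc)
  then have "(\<Sum>u\<in>nat_cube L. \<Sum>v\<in>nat_cube L.
      \<Prod>i\<in>UNIV. trig_kernel c N ((y + \<alpha> *v (nat_vec u - nat_vec v)) $ i)) =
      (\<Sum>u\<in>nat_cube L. \<Sum>v\<in>nat_cube L. \<Sum>a\<in>int_cube N.
         ?c a * cis (2 * pi * int_inner a y) * (?e a u * cnj (?e a v)))"
    by simp
  also have "\<dots> = (\<Sum>u\<in>nat_cube L. \<Sum>a\<in>int_cube N. \<Sum>v\<in>nat_cube L.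
         ?c a * cis (2 * pi * int_inner a y) * (?e a u * cnj (?e a v)))"
    by (intro sum.cong refl sum.swap)
  also have "\<dots> = (\<Sum>a\<in>int_cube N. \<Sum>u\<in>nat_cube L. \<Sum>v\<in>nat_cube L.
         ?c a * cis (2 * pi * int_inner a y) * (?e a u * cnj (?e a v)))"
    by (rule sum.swap)
  also have "\<dots> = (\<Sum>a\<in>int_cube N. ?c a * cis (2 * pi * int_inner a y) *
      (exp_sum \<alpha> L a * cnj (exp_sum \<alpha> L a)))"
    unfolding exp_sum_def cnj_sum sum_product by (simp only: sum_distrib_left)
  also have "\<dots> / of_nat L ^ CARD('n) =
      (\<Sum>a\<in>int_cube N. of_real (counting_coeff c \<alpha> L a) * cis (2 * pi * int_inner a y))"
    unfolding sum_divide_distrib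
    by (intro sum.cong refl)
      (simp add: counting_coeff_def complex_norm_square[symmetric] del: of_real_prod)
  finally show ?thesis .
qed

lemma norm_trig_kernel_le:
  assumes "\<And>a. c a \<ge> 0" "(\<Sum>a\<in>{- int N..int N}. c a) = 1"
  shows "norm (trig_kernel c N x) \<le> 1"
proof -
  have "norm (trig_kernel c N x) \<le> (\<Sum>a\<in>{- int N..int N}. norm (of_real (c a) * cis (2 * pi * (of_int a * x))))"
    unfolding trig_kernel_def by (rule norm_sum)
  also have "\<dots> = 1" using assms by (simp add: norm_mult)
  finally show ?thesis .
qed

text \<open>A single coordinate far from the integers suffices, since the other factors have modulus
  at most 1. If every coordinate were within \<open>2 * \<eta>\<close> of an integer, the l1 bound
  on the norm would contradict \<open>noint\<close>.\<close>

lemma norm_prod_trig_kernel_le: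
  fixes y :: "real ^ 'm"
  assumes "\<And>a. c a \<ge> 0" "(\<Sum>a\<in>{- int N..int N}. c a) = 1"
    and far: "\<And>x. (\<And>j::int. \<bar>x - of_int j\<bar> \<ge> 2 * \<eta>) \<Longrightarrow> norm (trig_kernel c N x) \<le> \<tau>"
    and noint: "\<And>p. p \<in> int_vectors \<Longrightarrow> norm (y + p) \<ge> 2 * \<eta> * real CARD('m)"
  shows "norm (\<Prod>i\<in>UNIV. trig_kernel c N (y $ i)) \<le> \<tau>"
proof -
  have "\<exists>i. \<forall>j::int. \<bar>y $ i - of_int j\<bar> \<ge> 2 * \<eta>"
  proof (rule ccontr)
    assume "\<not> ?thesis"
    then obtain j :: "'m \<Rightarrow> int" where j: "\<And>i. \<bar>y $ i - of_int (j i)\<bar> < 2 * \<eta>"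
      by (metis not_le)
    define p :: "real ^ 'm" where "p = (\<chi> i. - of_int (j i))"
    have "norm (y + p) \<le> (\<Sum>i\<in>UNIV. \<bar>(y + p) $ i\<bar>)" by (rule norm_le_l1_cart)
    also have "\<dots> < (\<Sum>i\<in>(UNIV::'m set). 2 * \<eta>)"
      using j by (intro sum_strict_mono) (auto simp: p_def)
    also have "\<dots> = 2 * \<eta> * real CARD('m)" by simp
    finally show False using noint[of p] by (auto simp: p_def int_vectors_def)
  qed
  then obtain i where i: "\<And>j::int. \<bar>y $ i - of_int j\<bar> \<ge> 2 * \<eta>" by blast
  have "norm (\<Prod>i\<in>UNIV. trig_kernel c N (y $ i)) =
      norm (trig_kernel c N (y $ i)) * (\<Prod>k\<in>UNIV - {i}. norm (trig_kernel c N (y $ k)))"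
    by (simp add: norm_mult prod_norm prod.remove[of UNIV i])
  also have "\<dots> \<le> \<tau> * 1"
    using far[OF i] norm_trig_kernel_le[of c N, OF assms(1,2)]
    by (intro mult_mono prod_le_1) (auto intro: prod_nonneg order.trans[OF norm_ge_zero])
  finally show ?thesis by simp
qed

lemma norm_prod_trig_kernel_le_1:
  fixes y :: "real ^ 'm"
  assumes "\<And>a. c a \<ge> 0" "(\<Sum>a\<in>{- int N..int N}. c a) = 1"
  shows "norm (\<Prod>i\<in>UNIV. trig_kernel c N (y $ i)) \<le> 1"
  unfolding prod_norm[symmetric] using norm_trig_kernel_le[of c N, OF assms] by (intro prod_le_1) auto

lemma nat_vec_diff_int: "nat_vec u - nat_vec v \<in> int_vectors"
  by (simp add: nat_vec_def int_vectors_def)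

lemma nat_vec_diff_eq_0: "nat_vec u - nat_vec v = 0 \<longleftrightarrow> u = v"
  by (auto simp: nat_vec_def vec_eq_iff)

lemma norm_nat_vec_diff_le:
  fixes u v :: "'n::finite \<Rightarrow> nat"
  assumes "u \<in> nat_cube L" "v \<in> nat_cube L"
  shows "norm (nat_vec u - nat_vec v) \<le> real CARD('n) * real L"
proof -
  have "norm (nat_vec u - nat_vec v) \<le> (\<Sum>j\<in>UNIV. \<bar>(nat_vec u - nat_vec v) $ j\<bar>)"
    by (rule norm_le_l1_cart)
  also have "\<dots> \<le> (\<Sum>j\<in>(UNIV::'n set). real L)"
  proof (rule sum_mono)
    fix j :: 'n
    have "u j < L" "v j < L" using assms by (auto simp: nat_cube_def PiE_iff)
    then show "\<bar>(nat_vec u - nat_vec v) $ j\<bar> \<le> real L" by (auto simp: nat_vec_def)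
  qed
  finally show ?thesis by simp
qed

lemma counting_coeff_nonneg: "(\<And>a. c a \<ge> 0) \<Longrightarrow> counting_coeff c \<alpha> L a \<ge> 0"
  by (simp add: counting_coeff_def prod_nonneg)

lemma exp_sum_resonant:
  fixes \<alpha> :: "real ^ 'n ^ 'm"
  assumes "\<And>j. (\<Sum>i\<in>UNIV. of_int (a i) * \<alpha> $ i $ j) \<in> \<int>"
  shows "exp_sum \<alpha> L a = of_nat L ^ CARD('n)"
proof -
  have "int_inner a (\<alpha> *v nat_vec u) \<in> \<int>" for u
  proof -
    have "int_inner a (\<alpha> *v nat_vec u) = (\<Sum>i\<in>UNIV. \<Sum>j\<in>UNIV. of_int (a i) * \<alpha> $ i $ j * real (u j))"
      by (simp add: int_inner_def matrix_vector_mult_def nat_vec_def sum_distrib_left mult.assoc)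
    also have "\<dots> = (\<Sum>j\<in>UNIV. (\<Sum>i\<in>UNIV. of_int (a i) * \<alpha> $ i $ j) * real (u j))"
      by (subst sum.swap) (simp add: sum_distrib_right)
    also have "\<dots> \<in> \<int>" by (rule Ints_sum, rule Ints_mult[OF assms Ints_of_nat])
    finally show ?thesis .
  qed
  then have "cis (2 * pi * int_inner a (\<alpha> *v nat_vec u)) = 1" for u
    by (intro cis_multiple_2pi)
  then show ?thesis by (simp add: exp_sum_def card_nat_cube)
qed

text \<open>The phase is additive in the coordinates of \<open>u\<close>, so the sum over the cube
  splits into geometric sums, one for each column of \<open>\<alpha>\<close>.\<close>

lemma exp_sum_factorization:
  fixes \<alpha> :: "real ^ 'n ^ 'm"
  shows "exp_sum \<alpha> L a =
    (\<Prod>j\<in>UNIV. \<Sum>t<L. cis (2 * pi * (\<Sum>i\<in>UNIV. of_int (a i) * \<alpha> $ i $ j)) ^ t)"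
proof -
  have "int_inner a (\<alpha> *v nat_vec u) = (\<Sum>j\<in>UNIV. real (u j) * (\<Sum>i\<in>UNIV. of_int (a i) * \<alpha> $ i $ j))" for u
  proof -
    have "int_inner a (\<alpha> *v nat_vec u) = (\<Sum>i\<in>UNIV. \<Sum>j\<in>UNIV. real (u j) * (of_int (a i) * \<alpha> $ i $ j))"
      by (simp add: int_inner_def matrix_vector_mult_def nat_vec_def sum_distrib_left mult_ac)
    then show ?thesis by (subst (asm) sum.swap) (simp add: sum_distrib_left)
  qed
  then have "cis (2 * pi * int_inner a (\<alpha> *v nat_vec u)) =
      (\<Prod>j\<in>UNIV. cis (2 * pi * (\<Sum>i\<in>UNIV. of_int (a i) * \<alpha> $ i $ j)) ^ u j)" for u
  proof -
    have "cis (2 * pi * int_inner a (\<alpha> *v nat_vec u)) =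
        (\<Prod>j\<in>UNIV. cis (real (u j) * (2 * pi * (\<Sum>i\<in>UNIV. of_int (a i) * \<alpha> $ i $ j))))"
      unfolding \<open>int_inner a (\<alpha> *v nat_vec u) = _\<close>
      by (subst cis_sum[symmetric], simp, rule arg_cong[of _ _ cis], subst sum_distrib_left)
        (intro sum.cong refl mult.left_commute)
    also have "\<dots> = (\<Prod>j\<in>UNIV. cis (2 * pi * (\<Sum>i\<in>UNIV. of_int (a i) * \<alpha> $ i $ j)) ^ u j)"
      by (intro prod.cong refl Complex.DeMoivre[symmetric])
    finally show ?thesis .
  qed
  then show ?thesis
    unfolding exp_sum_def nat_cube_def by (subst prod_sum_PiE) auto
qed

text \<open>The geometric sum of the nonresonant column is bounded independently of
  \<open>L\<close>; the other columns are estimated trivially. One saved factor \<open>L\<close>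
  already makes the counting coefficient tend to 0.\<close>

lemma exp_sum_nonresonant:
  fixes \<alpha> :: "real ^ 'n ^ 'm"
  assumes "(\<Sum>i\<in>UNIV. of_int (a i) * \<alpha> $ i $ j) \<notin> \<int>"
  obtains K where "\<And>L. L > 0 \<Longrightarrow> norm (exp_sum \<alpha> L a) \<le> K * real L ^ CARD('n) / real L"
proof
  let ?\<theta> = "\<lambda>j. \<Sum>i\<in>UNIV. of_int (a i) * \<alpha> $ i $ j"
  define z where "z = cis (2 * pi * ?\<theta> j)"
  have z: "z \<noteq> 1"
  proof
    assume "z = 1"
    then have "cos (2 * pi * ?\<theta> j) = 1" by (simp add: z_def complex_eq_iff)
    then obtain k :: int where "2 * pi * ?\<theta> j = of_int k * 2 * pi" using cos_one_2pi_int by auto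
    then have "?\<theta> j = of_int k" by simp
    then show False using assms by simp
  qed
  fix L :: nat assume L: "L > 0"
  have n1: "norm (\<Sum>t<L. z ^ t) \<le> 2 / norm (1 - z)"
  proof -
    have "norm (1 - z ^ L) \<le> norm (1::complex) + norm (z ^ L)" by (rule norm_triangle_ineq4)
    also have "\<dots> = 2" by (simp add: norm_power z_def)
    finally have "norm (1 - z ^ L) \<le> 2" .
    moreover have "(\<Sum>t<L. z ^ t) = (1 - z ^ L) / (1 - z)" using z by (simp add: sum_gp_strict)
    ultimately show ?thesis by (simp add: norm_divide divide_right_mono)
  qed
  have n2: "norm (\<Sum>t<L. cis (2 * pi * ?\<theta> k) ^ t) \<le> real L" for k
  proof -
    have "norm (\<Sum>t<L. cis (2 * pi * ?\<theta> k) ^ t) \<le> (\<Sum>t<L. norm (cis (2 * pi * ?\<theta> k) ^ t))" by (rule norm_sum)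
    also have "\<dots> = real L" by (simp add: norm_power)
    finally show ?thesis .
  qed
  have "norm (exp_sum \<alpha> L a) = norm (\<Sum>t<L. z ^ t) * (\<Prod>k\<in>UNIV - {j}. norm (\<Sum>t<L. cis (2 * pi * ?\<theta> k) ^ t))"
    unfolding exp_sum_factorization prod_norm norm_mult[symmetric] z_def
    by (simp add: prod.remove[of UNIV j])
  also have "\<dots> \<le> 2 / norm (1 - z) * (\<Prod>k\<in>UNIV - {j}. real L)"
    using n1 n2 by (intro mult_mono prod_mono) (auto intro: prod_nonneg)
  also have "(\<Prod>k\<in>UNIV - {j}. real L) = real L ^ CARD('n) / real L"
    using L by (simp add: card_Diff_singleton power_diff)
  finally show "norm (exp_sum \<alpha> L a) \<le> 2 / norm (1 - z) * real L ^ CARD('n) / real L" by simp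
qed

lemma counting_coeff_0: "counting_coeff c \<alpha> L (\<lambda>_. 0) = c 0 ^ CARD('m) * real L ^ CARD('n)"
  for \<alpha> :: "real ^ 'n ^ 'm"
  using exp_sum_resonant[of "\<lambda>_. 0" \<alpha> L]
  by (cases "L = 0") (simp_all add: counting_coeff_def norm_power power2_eq_square)

section \<open>Nonsingular scales, nonresonance and equidistribution\<close>

definition nonsingular_at :: "real ^ 'n ^ 'm \<Rightarrow> real \<Rightarrow> real \<Rightarrow> bool" where
  "nonsingular_at \<alpha> \<epsilon> Q \<longleftrightarrow> (\<forall>p\<in>int_vectors. \<forall>q\<in>int_vectors. q \<noteq> 0 \<and> norm q \<le> Q \<longrightarrow>
      norm (\<alpha> *v q + p) > \<epsilon> * Q powr (- (real CARD('n) / real CARD('m))))"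

definition approximable_at :: "real ^ 'n ^ 'm \<Rightarrow> real \<Rightarrow> real \<Rightarrow> real ^ 'm \<Rightarrow> bool" where
  "approximable_at \<alpha> c Q y \<longleftrightarrow> (\<exists>p\<in>int_vectors. \<exists>q\<in>int_vectors. norm q \<le> Q \<and>
      norm (\<alpha> *v q + y + p) < c * Q powr (- (real CARD('n) / real CARD('m))))"

lemma not_singular_obtains:
  assumes "\<not> singular_matrix \<alpha>"
  obtains \<epsilon> where "\<epsilon> > 0" "\<And>Q\<^sub>0. \<exists>Q\<ge>Q\<^sub>0. nonsingular_at \<alpha> \<epsilon> Q"
proof -
  obtain \<epsilon> where \<epsilon>: "\<epsilon> > 0" and *: "\<And>Q\<^sub>0. Q\<^sub>0 \<ge> 1 \<Longrightarrow> \<exists>Q\<ge>Q\<^sub>0. nonsingular_at \<alpha> \<epsilon> Q"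
    using assms unfolding singular_matrix_def nonsingular_at_def by (force simp: not_le)
  have "\<exists>Q\<ge>Q\<^sub>0. nonsingular_at \<alpha> \<epsilon> Q" for Q\<^sub>0
    using *[of "max 1 Q\<^sub>0"] by force
  with \<epsilon> show thesis by (rule that)
qed

text \<open>With side \<open>L\<close> the differences of cube points have norm at most
  \<open>Q\<close>, so both the gap at 0 and the failure of approximability at \<open>y\<close>
  apply to them. The width is chosen so that \<open>2 * \<eta> * m\<close> is below both radii, the
  one from \<open>c\<close> and the one from \<open>\<epsilon>\<close>. In the constant coefficient
  the powers of \<open>Q\<close> cancel, leaving \<open>e / (128 * m)\<close> from
  \<open>\<eta> / 16\<close> and \<open>2 * n\<close> from rounding \<open>L\<close>. The total mass
  is the value at 0: the diagonal contributes at most 1 and the rest at most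
  \<open>\<delta>\<close>.\<close>

lemma counting_function_exists:
  fixes \<alpha> :: "real ^ 'n ^ 'm"
  defines "m \<equiv> real CARD('m)" and "n \<equiv> real CARD('n)"
  assumes \<epsilon>: "\<epsilon> > 0" and c: "c > 0" and Q: "Q \<ge> 1" "Q \<ge> n"
    and nons: "nonsingular_at \<alpha> \<epsilon> Q" and \<delta>: "0 < \<delta>" "\<delta> \<le> 1"
  defines "e \<equiv> min 1 (min c \<epsilon>)" and "L \<equiv> nat \<lfloor>Q / n\<rfloor>"
  defines "\<eta> \<equiv> e * Q powr (- (n / m)) / (8 * m)"
  obtains k N where
    "\<And>a. k a \<ge> 0" "\<And>a. k a \<le> k 0"
    "\<And>a. real_of_int \<bar>a\<bar> * \<eta> \<le> 1/6 \<Longrightarrow> k a \<ge> k 0 / 16"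
    "\<And>a. a \<notin> {- int N..int N} \<Longrightarrow> k a = 0"
    "counting_coeff k \<alpha> L (\<lambda>_. 0) \<ge> (e / (128 * m)) ^ CARD('m) / (2 * n) ^ CARD('n)"
    "(\<Sum>a\<in>int_cube N. counting_coeff k \<alpha> L a) \<le> 2"
    "\<And>y. \<not> approximable_at \<alpha> c Q y \<Longrightarrow>
       norm (\<Sum>a\<in>int_cube N. of_real (counting_coeff k \<alpha> L a) * cis (2 * pi * int_inner a y)) \<le> \<delta>"
proof -
  have mn: "m \<ge> 1" "n \<ge> 1" by (simp_all add: m_def n_def Suc_le_eq)
  let ?Qp = "Q powr (- (n / m))"
  have Qp: "0 < ?Qp" "?Qp \<le> 1" using Q mn by (auto intro: powr_le_one_le simp: powr_minus_divide ge_one_powr_ge_zero)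
  have e: "0 < e" "e \<le> 1" "e \<le> c" "e \<le> \<epsilon>" using \<epsilon> c by (auto simp: e_def)
  have \<eta>: "0 < \<eta>" "\<eta> \<le> 1/8"
  proof -
    show "0 < \<eta>" using e Qp mn by (simp add: \<eta>_def)
    have "e * ?Qp \<le> 1 * 1" using e Qp by (intro mult_mono) auto
    then show "\<eta> \<le> 1/8" using mn by (simp add: \<eta>_def field_simps)
  qed
  have L_bounds: "Q / (2 * n) \<le> real L" "n * real L \<le> Q" "L > 0"
  proof -
    have Qn: "Q / n \<ge> 1" using Q mn by simp
    then have L: "real L = of_int \<lfloor>Q / n\<rfloor>" by (simp add: L_def)
    have "\<lfloor>Q / n\<rfloor> \<ge> 1" using Qn by simp
    then show "L > 0" by (simp add: L_def)
    have "real L \<le> Q / n" unfolding L by linarith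
    then show "n * real L \<le> Q" using mn by (simp add: field_simps)
    have "real L > Q / n - 1" "real L \<ge> 1" using \<open>\<lfloor>Q / n\<rfloor> \<ge> 1\<close> unfolding L by linarith+
    then have "2 * real L \<ge> Q / n" by linarith
    then show "Q / (2 * n) \<le> real L" by simp
  qed
  \<comment> \<open>The sum has \<open>L ^ (2 * n)\<close> terms and is divided only by
    \<open>L ^ n\<close>, so each negligible product has to be this small.\<close>
  define \<tau> where "\<tau> = \<delta> / real L ^ CARD('n)"
  have \<tau>: "0 < \<tau>" using \<delta> L_bounds by (simp add: \<tau>_def)
  obtain k N where k: "\<And>a. k a \<ge> 0" "\<And>a. k a \<le> k 0" "k 0 \<ge> \<eta> / 16"
    "\<And>a. real_of_int \<bar>a\<bar> * \<eta> \<le> 1/6 \<Longrightarrow> k a \<ge> k 0 / 16"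
    "\<And>a. a \<notin> {- int N..int N} \<Longrightarrow> k a = 0"
    "(\<Sum>a\<in>{- int N..int N}. k a) = 1"
    "\<And>x. (\<And>j::int. \<bar>x - of_int j\<bar> \<ge> 2 * \<eta>) \<Longrightarrow> norm (trig_kernel k N x) \<le> \<tau>"
    using concentrated_kernel[OF \<eta> \<tau>] unfolding trig_kernel_def by blast
  let ?f = "\<lambda>y. (\<Sum>a\<in>int_cube N. of_real (counting_coeff k \<alpha> L a) * cis (2 * pi * int_inner a y))"
  let ?P = "\<lambda>y u v. \<Prod>i\<in>UNIV. trig_kernel k N ((y + \<alpha> *v (nat_vec u - nat_vec v)) $ i)"
  have \<eta>e: "2 * \<eta> * real CARD('m) \<le> e * ?Qp"
    using e Qp mn by (simp add: \<eta>_def m_def)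
  have small: "norm (?P y u v) \<le> \<tau>"
    if "\<And>p. p \<in> int_vectors \<Longrightarrow> norm (\<alpha> *v (nat_vec u - nat_vec v) + y + p) \<ge> e * ?Qp" for y u v
    using that \<eta>e
    by (intro norm_prod_trig_kernel_le[OF k(1) k(6) k(7)]) (force simp: add.commute)+
  have norm_q: "norm (nat_vec u - nat_vec v :: real ^ 'n) \<le> Q" if "u \<in> nat_cube L" "v \<in> nat_cube L"
    for u v :: "'n \<Rightarrow> nat"
    using norm_nat_vec_diff_le[OF that] L_bounds(2) by (simp add: n_def)
  show thesis
  proof (rule that[of k N])
    show "counting_coeff k \<alpha> L (\<lambda>_. 0) \<ge> (e / (128 * m)) ^ CARD('m) / (2 * n) ^ CARD('n)"
    proof -
      have Qm: "?Qp ^ CARD('m) * Q ^ CARD('n) = 1"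
      proof -
        have "?Qp ^ CARD('m) = Q powr (- n)"
          using Q mn by (simp add: powr_realpow[symmetric] powr_powr m_def)
        moreover have "Q ^ CARD('n) = Q powr n" using Q by (simp add: n_def powr_realpow)
        ultimately show ?thesis using Q by (simp add: powr_add[symmetric])
      qed
      have "(e / (128 * m)) ^ CARD('m) / (2 * n) ^ CARD('n)
          = (e / (128 * m)) ^ CARD('m) / (2 * n) ^ CARD('n) * (?Qp ^ CARD('m) * Q ^ CARD('n))"
        unfolding Qm by simp
      also have "\<dots> = (\<eta> / 16) ^ CARD('m) * (Q / (2 * n)) ^ CARD('n)"
        by (simp add: \<eta>_def power_divide power_mult_distrib)
      also have "\<dots> \<le> k 0 ^ CARD('m) * real L ^ CARD('n)"
        using k(3) L_bounds \<eta> Q mn k(1) by (intro mult_mono power_mono) auto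
      finally show ?thesis by (simp add: counting_coeff_0)
    qed
    show "(\<Sum>a\<in>int_cube N. counting_coeff k \<alpha> L a) \<le> 2"
    proof -
      have "norm (?P 0 u v) \<le> (if u = v then 1 else 0) + \<tau>"
        if "u \<in> nat_cube L" "v \<in> nat_cube L" for u v :: "'n \<Rightarrow> nat"
      proof (cases "u = v")
        case True
        then show ?thesis using norm_prod_trig_kernel_le_1[OF k(1) k(6), of "0 + \<alpha> *v (nat_vec u - nat_vec v)"] \<tau> by simp
      next
        case False
        have "norm (\<alpha> *v (nat_vec u - nat_vec v) + 0 + p) \<ge> e * ?Qp" if p: "p \<in> int_vectors" for p
        proof -
          have "norm (\<alpha> *v (nat_vec u - nat_vec v) + p) > \<epsilon> * ?Qp"
            using nons[unfolded nonsingular_at_def, rule_format, OF p nat_vec_diff_int[of u v]]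
              nat_vec_diff_eq_0[of u v] False norm_q[OF \<open>u \<in> _\<close> \<open>v \<in> _\<close>]
            unfolding n_def m_def by blast
          moreover have "e * ?Qp \<le> \<epsilon> * ?Qp" using e Qp by simp
          ultimately show ?thesis by simp
        qed
        then show ?thesis using small[of u v 0] False by simp
      qed
      then have "norm (\<Sum>u\<in>nat_cube L. \<Sum>v\<in>nat_cube L. ?P 0 u v) \<le>
          (\<Sum>u\<in>(nat_cube L :: ('n \<Rightarrow> nat) set). \<Sum>v\<in>nat_cube L. (if u = v then 1 else 0) + \<tau>)"
        by (intro sum_norm_le) auto
      also have "\<dots> = real L ^ CARD('n) + real L ^ CARD('n) * real L ^ CARD('n) * \<tau>"
        by (simp add: sum.distrib card_nat_cube algebra_simps)
      also have "\<dots> \<le> 2 * real L ^ CARD('n)" using \<delta> L_bounds by (simp add: \<tau>_def)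
      finally have "norm ((\<Sum>u\<in>nat_cube L. \<Sum>v\<in>nat_cube L. ?P 0 u v) / of_nat L ^ CARD('n)) \<le> 2"
        using L_bounds by (simp add: norm_divide norm_power field_simps)
      then have "norm (?f 0) \<le> 2" unfolding counting_function_expansion .
      moreover have "?f 0 = of_real (\<Sum>a\<in>int_cube N. counting_coeff k \<alpha> L a)"
        by (simp add: int_inner_def)
      ultimately show ?thesis by (simp only: norm_of_real)
    qed
    show "norm (?f y) \<le> \<delta>" if y: "\<not> approximable_at \<alpha> c Q y" for y
    proof -
      have "norm (?P y u v) \<le> \<tau>" if "u \<in> nat_cube L" "v \<in> nat_cube L" for u v :: "'n \<Rightarrow> nat"
      proof (rule small)
        fix p :: "real ^ 'm" assume p: "p \<in> int_vectors"
        have "norm (\<alpha> *v (nat_vec u - nat_vec v) + y + p) \<ge> c * ?Qp"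
          using y p nat_vec_diff_int[of u v] norm_q[OF that] by (auto simp: approximable_at_def not_less n_def m_def)
        moreover have "e * ?Qp \<le> c * ?Qp" using e Qp by simp
        ultimately show "norm (\<alpha> *v (nat_vec u - nat_vec v) + y + p) \<ge> e * ?Qp" by linarith
      qed
      then have "norm (\<Sum>u\<in>nat_cube L. \<Sum>v\<in>nat_cube L. ?P y u v) \<le>
          (\<Sum>u\<in>(nat_cube L :: ('n \<Rightarrow> nat) set). \<Sum>v\<in>(nat_cube L :: ('n \<Rightarrow> nat) set). \<tau>)"
        by (intro sum_norm_le) auto
      also have "\<dots> = real L ^ CARD('n) * \<delta>"
        using L_bounds by (simp add: card_nat_cube \<tau>_def)
      finally have "norm ((\<Sum>u\<in>nat_cube L. \<Sum>v\<in>nat_cube L. ?P y u v) / of_nat L ^ CARD('n)) \<le> \<delta>"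
        using L_bounds by (simp add: norm_divide norm_power field_simps)
      then show ?thesis unfolding counting_function_expansion .
    qed
  qed (use k in auto)
qed

text \<open>If \<open>a\<close> were resonant, all small multiples of \<open>a\<close> would carry a fixed proportion of the
  total mass of the coefficients, which is bounded.\<close>

lemma nonsingular_nonresonant:
  fixes \<alpha> :: "real ^ 'n ^ 'm"
  assumes "\<not> singular_matrix \<alpha>" "a \<noteq> (\<lambda>_. 0)"
  obtains j where "(\<Sum>i\<in>UNIV. of_int (a i) * \<alpha> $ i $ j) \<notin> \<int>"
proof (rule ccontr)
  assume "\<not> thesis"
  then have res: "(\<Sum>i\<in>UNIV. of_int (a i) * \<alpha> $ i $ j) \<in> \<int>" for j using that by blast
  let ?m = "real CARD('m)" and ?n = "real CARD('n)"
  obtain \<epsilon> where \<epsilon>: "\<epsilon> > 0" "\<And>Q\<^sub>0. \<exists>Q\<ge>Q\<^sub>0. nonsingular_at \<alpha> \<epsilon> Q"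
    using not_singular_obtains[OF assms(1)] by blast
  \<comment> \<open>The value of \<open>min 1 (min c \<epsilon>)\<close> at \<open>c = 1\<close>:
    only the coefficients are used below, so \<open>c\<close> and \<open>\<delta>\<close> are set to
    1.\<close>
  let ?e = "min 1 (min 1 \<epsilon>)"
  define \<kappa> where "\<kappa> = (?e / (128 * ?m)) ^ CARD('m) / (2 * ?n) ^ CARD('n)"
  have \<kappa>: "\<kappa> > 0" using \<epsilon> by (simp add: \<kappa>_def)
  \<comment> \<open>This many multiples of \<open>a\<close>, each with coefficient at least
    \<open>\<kappa> / 16 ^ CARD('m)\<close>, exceed the total mass 2.\<close>
  obtain J :: nat where J: "real J * (\<kappa> / 16 ^ CARD('m)) > 2"
    using reals_Archimedean3[of "\<kappa> / 16 ^ CARD('m)"] \<kappa> by auto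
  \<comment> \<open>Bounds every coordinate of the first \<open>J\<close> multiples. For large
    \<open>Q\<close> they fall into the low frequency range, where kernel coefficients are
    comparable to \<open>k 0\<close>.\<close>
  define s where "s = real J * real_of_int (\<Sum>i\<in>UNIV. \<bar>a i\<bar>)"
  have "((\<lambda>Q. s * (?e * Q powr (- (?n / ?m)) / (8 * ?m))) \<longlongrightarrow> s * (?e * 0 / (8 * ?m))) at_top"
    by (intro tendsto_intros tendsto_neg_powr filterlim_ident) auto
  then have "\<forall>\<^sub>F Q in at_top. s * (?e * Q powr (- (?n / ?m)) / (8 * ?m)) < 1/6"
    by (rule order_tendstoD) simp
  then obtain Q1 where Q1: "\<And>Q. Q \<ge> Q1 \<Longrightarrow> s * (?e * Q powr (- (?n / ?m)) / (8 * ?m)) < 1/6"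
    by (auto simp: eventually_at_top_linorder)
  obtain Q where Q: "Q \<ge> max Q1 ?n" "nonsingular_at \<alpha> \<epsilon> Q" using \<epsilon>(2) by blast
  have n1: "?n \<ge> 1" by (simp add: Suc_le_eq)
  then have Qn: "Q \<ge> 1" "Q \<ge> ?n" using Q(1) by linarith+
  obtain k N where k: "\<And>a. k a \<ge> 0" "\<And>a. k a \<le> k 0"
    "\<And>a. real_of_int \<bar>a\<bar> * (?e * Q powr (- (?n / ?m)) / (8 * ?m)) \<le> 1/6 \<Longrightarrow> k a \<ge> k 0 / 16"
    "\<And>a. a \<notin> {- int N..int N} \<Longrightarrow> k a = 0"
    "counting_coeff k \<alpha> (nat \<lfloor>Q / ?n\<rfloor>) (\<lambda>_. 0) \<ge> \<kappa>"
    "(\<Sum>a\<in>int_cube N. counting_coeff k \<alpha> (nat \<lfloor>Q / ?n\<rfloor>) a) \<le> 2"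
    by (rule counting_function_exists[where \<alpha>=\<alpha> and c=1 and \<delta>=1,
        OF \<epsilon>(1) zero_less_one Qn(1,2) Q(2) zero_less_one order.refl, folded \<kappa>_def])
      (rule that; assumption)
  define L where "L = nat \<lfloor>Q / ?n\<rfloor>"
  note k = k[folded L_def]
  have k0: "k 0 > 0"
  proof -
    have "k 0 \<noteq> 0" using k(5) \<kappa> by (auto simp: counting_coeff_0 zero_power)
    then show ?thesis using k(1)[of 0] by simp
  qed
  let ?t = "\<lambda>(t::nat) i. int t * a i"
  obtain i0 where i0: "a i0 \<noteq> 0" using assms(2) by auto
  have inj: "inj_on ?t {1..J}"
  proof (rule inj_onI)
    fix t t' assume "?t t = ?t t'"
    then have "int t * a i0 = int t' * a i0" by meson
    then show "t = t'" using i0 by simp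
  qed
  have lower: "counting_coeff k \<alpha> L (?t t) \<ge> \<kappa> / 16 ^ CARD('m)" and mem: "?t t \<in> int_cube N"
    if t: "t \<in> {1..J}" for t
  proof -
    have kt: "k (?t t i) \<ge> k 0 / 16" for i
    proof (rule k(3))
      have "\<bar>a i\<bar> \<le> (\<Sum>i\<in>UNIV. \<bar>a i\<bar>)" by (intro member_le_sum) auto
      then have "\<bar>?t t i\<bar> \<le> int J * (\<Sum>i\<in>UNIV. \<bar>a i\<bar>)"
        using t by (auto simp: abs_mult intro!: mult_mono)
      then have "real_of_int \<bar>?t t i\<bar> \<le> s" unfolding s_def
        by (metis of_int_le_iff of_int_mult of_int_of_nat_eq)
      then have "real_of_int \<bar>?t t i\<bar> * (?e * Q powr (- (?n / ?m)) / (8 * ?m))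
          \<le> s * (?e * Q powr (- (?n / ?m)) / (8 * ?m))"
        using \<epsilon> by (intro mult_right_mono) auto
      then show "real_of_int \<bar>?t t i\<bar> * (?e * Q powr (- (?n / ?m)) / (8 * ?m)) \<le> 1/6"
        using Q1[of Q] Q by linarith
    qed
    \<comment> \<open>Nonvanishing kernel coefficients already place the multiple inside the
      frequency cube.\<close>
    have "k (?t t i) \<noteq> 0" for i using kt[of i] k0 by auto
    then show "?t t \<in> int_cube N" using k(4) by (fastforce simp: int_cube_def PiE_iff)
    have rest: "(\<Sum>i\<in>UNIV. of_int (?t t i) * \<alpha> $ i $ j) \<in> \<int>" for j
    proof -
      have "(\<Sum>i\<in>UNIV. of_int (?t t i) * \<alpha> $ i $ j) = of_nat t * (\<Sum>i\<in>UNIV. of_int (a i) * \<alpha> $ i $ j)"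
        by (simp add: sum_distrib_left mult.assoc)
      then show ?thesis using res by (simp add: Ints_mult)
    qed
    have "\<kappa> / 16 ^ CARD('m) \<le> (k 0 ^ CARD('m) * real L ^ CARD('n)) / 16 ^ CARD('m)"
      using k(5) by (intro divide_right_mono) (auto simp: counting_coeff_0)
    also have "\<dots> = (\<Prod>i\<in>(UNIV::'m set). k 0 / 16) * real L ^ CARD('n)" by (simp add: power_divide)
    also have "\<dots> \<le> (\<Prod>i\<in>UNIV. k (?t t i)) * real L ^ CARD('n)"
      using kt k0 by (intro mult_right_mono prod_mono) auto
    also have "\<dots> = counting_coeff k \<alpha> L (?t t)"
      unfolding counting_coeff_def exp_sum_resonant[OF rest]
      by (cases "L = 0") (simp_all add: norm_power power2_eq_square)
    finally show "counting_coeff k \<alpha> L (?t t) \<ge> \<kappa> / 16 ^ CARD('m)" .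
  qed
  have "real J * (\<kappa> / 16 ^ CARD('m)) = (\<Sum>t\<in>{1..J}. \<kappa> / 16 ^ CARD('m))" by simp
  also have "\<dots> \<le> (\<Sum>t\<in>{1..J}. counting_coeff k \<alpha> L (?t t))" using lower by (intro sum_mono)
  also have "\<dots> = (\<Sum>b\<in>?t ` {1..J}. counting_coeff k \<alpha> L b)" by (subst sum.reindex[OF inj]) (simp add: o_def)
  also have "\<dots> \<le> (\<Sum>a\<in>int_cube N. counting_coeff k \<alpha> L a)"
    using mem k(1) by (intro sum_mono2 counting_coeff_nonneg) auto
  finally show False using J k(6) by linarith
qed

text \<open>The order of choices matters: \<open>R\<close> will be a threshold of Fourier decay that
  depends on \<open>\<kappa>\<close>, so \<open>\<kappa>\<close> has to be fixed before
  \<open>R\<close>, \<open>\<delta>\<close> and \<open>Q\<^sub>0\<close>.\<close>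

definition equidistributed_counting ::
    "real ^ 'n ^ 'm \<Rightarrow> real \<Rightarrow> real \<Rightarrow> nat \<Rightarrow> real \<Rightarrow> real \<Rightarrow> bool" where
  "equidistributed_counting \<alpha> c \<kappa> R \<delta> Q\<^sub>0 \<longleftrightarrow>
     (\<exists>Q N C. Q \<ge> Q\<^sub>0 \<and> (\<forall>a. C a \<ge> 0) \<and> C (\<lambda>_. 0) \<ge> \<kappa> \<and>
       (\<Sum>a\<in>int_cube N. C a) \<le> 2 \<and>
       (\<forall>a\<in>int_cube R. a \<noteq> (\<lambda>_. 0) \<longrightarrow> C a \<le> \<delta>) \<and>
       (\<forall>y. \<not> approximable_at \<alpha> c Q y \<longrightarrow>
          norm (\<Sum>a\<in>int_cube N. complex_of_real (C a) * cis (2 * pi * int_inner a y)) \<le> \<delta>))"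

text \<open>A nonresonant coefficient is at most \<open>(K a / L)^2\<close> times the constant one,
  because kernel coefficients are at most \<open>k 0\<close> and the exponential sum saves a factor
  \<open>L\<close>. A fixed cube has finitely many frequencies, so one constant \<open>K1\<close>
  serves them all.\<close>

lemma equidistributed_counting_functions:
  fixes \<alpha> :: "real ^ 'n ^ 'm"
  assumes "\<not> singular_matrix \<alpha>" "c > 0"
  obtains \<kappa> where "\<kappa> > 0"
    "\<And>R \<delta> Q\<^sub>0. 0 < \<delta> \<Longrightarrow> \<delta> \<le> 1 \<Longrightarrow> equidistributed_counting \<alpha> c \<kappa> R \<delta> Q\<^sub>0"
proof -
  let ?m = "real CARD('m)" and ?n = "real CARD('n)"
  have n1: "?n \<ge> 1" by (simp add: Suc_le_eq)
  obtain \<epsilon> where \<epsilon>: "\<epsilon> > 0" "\<And>Q\<^sub>0. \<exists>Q\<ge>Q\<^sub>0. nonsingular_at \<alpha> \<epsilon> Q"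
    using not_singular_obtains[OF assms(1)] by blast
  define \<kappa> where "\<kappa> = (min 1 (min c \<epsilon>) / (128 * ?m)) ^ CARD('m) / (2 * ?n) ^ CARD('n)"
  have \<kappa>: "\<kappa> > 0" using \<epsilon> assms(2) by (simp add: \<kappa>_def)
  have "\<exists>K. \<forall>L>0. norm (exp_sum \<alpha> L a) \<le> K * real L ^ CARD('n) / real L" if a: "a \<noteq> (\<lambda>_. 0)" for a
  proof -
    obtain j where j: "(\<Sum>i\<in>UNIV. of_int (a i) * \<alpha> $ i $ j) \<notin> \<int>"
      by (rule nonsingular_nonresonant[OF assms(1) a])
    obtain K where "\<And>L. L > 0 \<Longrightarrow> norm (exp_sum \<alpha> L a) \<le> K * real L ^ CARD('n) / real L"
      using exp_sum_nonresonant[OF j] by metis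
    then show ?thesis by blast
  qed
  then obtain K where K: "norm (exp_sum \<alpha> L a) \<le> K a * real L ^ CARD('n) / real L"
    if "a \<noteq> (\<lambda>_. 0)" "L > 0" for a L
    by metis
  show thesis
  proof (rule that[OF \<kappa>])
    fix R :: nat and \<delta> Q\<^sub>0 :: real assume \<delta>: "0 < \<delta>" "\<delta> \<le> 1"
    define K1 where "K1 = (\<Sum>a\<in>int_cube R. \<bar>K a\<bar>)"
    have K1: "\<bar>K a\<bar> \<le> K1" if "a \<in> int_cube R" for a
      unfolding K1_def using that by (intro member_le_sum) auto
    have K1_nonneg: "K1 \<ge> 0" unfolding K1_def by (intro sum_nonneg) auto
    \<comment> \<open>The constant coefficient is at most 2 and
      \<open>(K1 / L)^2 \<le> K1^2 / L\<close> for \<open>L \<ge> 1\<close>, so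
      \<open>L \<ge> 2 * K1^2 / \<delta>\<close> suffices; the added 1 guarantees
      \<open>L \<ge> 1\<close>.\<close>
    obtain l :: nat where l: "real l \<ge> 2 * K1^2 / \<delta> + 1" using real_arch_simple by blast
    obtain Q where Q: "Q \<ge> Max {Q\<^sub>0, ?n, ?n * real l}" "nonsingular_at \<alpha> \<epsilon> Q" using \<epsilon>(2) by blast
    then have Q': "Q \<ge> Q\<^sub>0" "Q \<ge> ?n" "Q \<ge> ?n * real l" by auto
    then have Q1: "Q \<ge> 1" using n1 by linarith
    define L where "L = nat \<lfloor>Q / ?n\<rfloor>"
    obtain k N where k: "\<And>a. k a \<ge> 0" "\<And>a. k a \<le> k 0"
      "\<And>a. a \<notin> {- int N..int N} \<Longrightarrow> k a = 0"
      "counting_coeff k \<alpha> L (\<lambda>_. 0) \<ge> \<kappa>"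
      "(\<Sum>a\<in>int_cube N. counting_coeff k \<alpha> L a) \<le> 2"
      "\<And>y. \<not> approximable_at \<alpha> c Q y \<Longrightarrow>
         norm (\<Sum>a\<in>int_cube N. of_real (counting_coeff k \<alpha> L a) * cis (2 * pi * int_inner a y)) \<le> \<delta>"
      by (rule counting_function_exists[where \<alpha>=\<alpha>, OF \<epsilon>(1) assms(2) Q1 Q'(2) Q(2) \<delta>,
          folded \<kappa>_def L_def]) (rule that; assumption)
    have L: "real L \<ge> real l"
    proof -
      have "Q / ?n \<ge> real l" using Q'(3) n1 by (simp add: field_simps)
      then have "int l \<le> \<lfloor>Q / ?n\<rfloor>" by (simp add: le_floor_iff)
      then show ?thesis unfolding L_def by linarith
    qed
    have "real l \<ge> 1" using l \<delta> K1_nonneg by (smt (verit) divide_nonneg_pos zero_le_power2)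
    then have L1: "real L \<ge> 1" using L by linarith
    show "equidistributed_counting \<alpha> c \<kappa> R \<delta> Q\<^sub>0"
      unfolding equidistributed_counting_def
    proof (intro exI conjI allI ballI impI)
      fix a :: "'m \<Rightarrow> int" assume a: "a \<in> int_cube R" "a \<noteq> (\<lambda>_. 0)"
      have total: "counting_coeff k \<alpha> L (\<lambda>_. 0) \<le> 2"
      proof -
        have "counting_coeff k \<alpha> L (\<lambda>_. 0) \<le> (\<Sum>a\<in>int_cube N. counting_coeff k \<alpha> L a)"
          using k(1) by (intro member_le_sum counting_coeff_nonneg) (auto simp: mem_int_cube)
        then show ?thesis using k(5) by linarith
      qed
      have "norm (exp_sum \<alpha> L a) \<le> K1 * real L ^ CARD('n) / real L"
      proof -
        have "K a * (real L ^ CARD('n) / real L) \<le> K1 * (real L ^ CARD('n) / real L)"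
          using K1[OF a(1)] by (intro mult_right_mono) auto
        then show ?thesis using K[OF a(2), of L] L1 by simp
      qed
      then have "(norm (exp_sum \<alpha> L a))^2 \<le> (K1 * real L ^ CARD('n) / real L)^2"
        by (intro power_mono) auto
      then have "counting_coeff k \<alpha> L a \<le> k 0 ^ CARD('m) * (K1 * real L ^ CARD('n) / real L)^2 / real L ^ CARD('n)"
        unfolding counting_coeff_def
        using prod_mono[of UNIV "\<lambda>i. k (a i)" "\<lambda>_. k 0"] k(1,2)
        by (intro divide_right_mono mult_mono) (auto intro: prod_nonneg)
      also have "\<dots> = counting_coeff k \<alpha> L (\<lambda>_. 0) * (K1 / real L)^2"
        using L1 by (simp add: counting_coeff_0 power2_eq_square field_simps)
      also have "\<dots> \<le> 2 * (K1 / real L)^2" using total by (intro mult_right_mono) auto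
      also have "\<dots> \<le> 2 * K1^2 / real L"
      proof -
        have "(K1 / real L)^2 \<le> K1^2 / real L"
          using L1 mult_left_mono[of 1 "real L" "K1^2"] by (simp add: power2_eq_square field_simps)
        then show ?thesis by simp
      qed
      also have "\<dots> \<le> \<delta>"
      proof -
        have "2 * K1^2 / \<delta> \<le> real L" using l L by linarith
        then show ?thesis using \<delta> L1 by (simp add: field_simps)
      qed
      finally show "counting_coeff k \<alpha> L a \<le> \<delta>" .
    qed (use k Q' counting_coeff_nonneg[of k, OF k(1)] in auto)
  qed
qed

section \<open>Decay of oscillatory integrals without critical points\<close>

lemma norm_cis_minus_1_le: "norm (cis t - 1) \<le> \<bar>t\<bar>"
proof -
  have "(norm (cis t - 1))\<^sup>2 = (cos t - 1)\<^sup>2 + (sin t)\<^sup>2"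
    by (simp add: cmod_power2)
  also have "\<dots> = 2 - 2 * cos t"
    using sin_cos_squared_add[of t] by (simp add: power2_eq_square algebra_simps)
  also have "\<dots> = (2 * sin (t/2))\<^sup>2"
    using cos_double_sin[of "t/2"] by (simp add: power2_eq_square)
  also have "\<dots> \<le> t\<^sup>2"
    unfolding abs_le_square_iff[symmetric] using abs_sin_x_le_abs_x[of "t/2"] by (simp add: abs_mult)
  finally show ?thesis by (simp add: abs_le_square_iff[symmetric])
qed

lemma set_integral_bounded:
  fixes E :: "'a::euclidean_space \<Rightarrow> complex"
  assumes Z: "Z \<in> sets borel" "emeasure lborel Z < \<infinity>" and E: "continuous_on Z E"
    and B: "\<And>x. x \<in> Z \<Longrightarrow> norm (E x) \<le> B"
  shows "set_integrable lborel Z E" "norm (LINT x:Z|lborel. E x) \<le> B * measure lborel Z"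
proof -
  have meas: "(\<lambda>x. indicat_real Z x *\<^sub>R E x) \<in> borel_measurable lborel"
    using borel_measurable_continuous_on_indicator[OF Z(1) E] by simp
  have int: "integrable lborel (\<lambda>x. B * indicat_real Z x)"
    using Z by (intro integrable_mult_right integrable_real_indicator) auto
  have le: "norm (indicat_real Z x *\<^sub>R E x) \<le> B * indicat_real Z x" for x
    using B by (auto simp: indicator_def)
  show "set_integrable lborel Z E" unfolding set_integrable_def
    using int meas le by (intro Bochner_Integration.integrable_bound[OF int]) (auto intro: order.trans[OF _ abs_ge_self])
  have "norm (LINT x:Z|lborel. E x) \<le> (LINT x|lborel. B * indicat_real Z x)"
    unfolding set_lebesgue_integral_def
    using int meas le by (intro Bochner_Integration.integral_norm_bound_integral Bochner_Integration.integrable_bound[OF int])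
      (auto intro: order.trans[OF _ abs_ge_self])
  also have "\<dots> = B * measure lborel Z" using Z by simp
  finally show "norm (LINT x:Z|lborel. E x) \<le> B * measure lborel Z" .
qed

lemma set_integral_translation:
  fixes E :: "'a::euclidean_space \<Rightarrow> complex"
  assumes "(+) h ` K \<in> sets borel" "continuous_on ((+) h ` K) E"
  shows "(LINT x:K|lborel. E (h + x)) = (LINT x:(+) h ` K|lborel. E x)"
proof -
  have meas: "(\<lambda>x. indicat_real ((+) h ` K) x *\<^sub>R E x) \<in> borel_measurable borel"
    by (rule borel_measurable_continuous_on_indicator[OF assms])
  have ind: "indicat_real ((+) h ` K) (h + x) = indicat_real K x" for x
    by (auto simp: indicator_def)
  have "(LINT x:(+) h ` K|lborel. E x) = (LINT x|distr lborel borel ((+) h). indicat_real ((+) h ` K) x *\<^sub>R E x)"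
    by (simp add: lborel_distr_plus set_lebesgue_integral_def)
  also have "\<dots> = (LINT x|lborel. indicat_real ((+) h ` K) (h + x) *\<^sub>R E (h + x))"
    using meas by (intro integral_distr) auto
  finally show ?thesis by (simp add: ind set_lebesgue_integral_def)
qed

text \<open>An open set with little excess over \<open>K\<close> contains a uniform neighbourhood of
  the compact set \<open>K\<close>, hence all its small translates.\<close>

lemma compact_translation_diff_small:
  fixes K :: "'a::euclidean_space set"
  assumes "compact K"
  shows "((\<lambda>h. measure lebesgue ((+) h ` K - K)) \<longlongrightarrow> 0) (nhds 0)"
proof (rule tendstoI)
  fix e :: real assume e: "e > 0"
  have K: "K \<in> lmeasurable" using assms by (rule lmeasurable_compact)
  obtain V where V: "open V" "K \<subseteq> V" "V - K \<in> lmeasurable" "emeasure lebesgue (V - K) < ennreal e"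
    using sets_lebesgue_outer_open[of K e] K e by (auto simp: fmeasurable_def)
  have mV: "measure lebesgue (V - K) < e"
    using V(3,4) by (simp add: emeasure_eq_measure2 ennreal_less_iff)
  obtain d where d: "d > 0" "(\<Union>x\<in>K. ball x d) \<subseteq> V"
    using compact_subset_open_imp_ball_epsilon_subset[OF assms V(1,2)] by auto
  have "dist (measure lebesgue ((+) h ` K - K)) 0 < e" if "dist h 0 < d" for h
  proof -
    have "(+) h ` K - K \<subseteq> V - K"
      using d(2) that by (force simp: dist_norm)
    moreover have "(+) h ` K - K \<in> sets lebesgue"
      using K measurable_translation[OF K, of h] by (auto simp: fmeasurable_def)
    ultimately have "measure lebesgue ((+) h ` K - K) \<le> measure lebesgue (V - K)"
      using V(3) by (intro measure_mono_fmeasurable)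
    then show ?thesis using mV by simp
  qed
  then show "\<forall>\<^sub>F h in nhds 0. dist (measure lebesgue ((+) h ` K - K)) 0 < e"
    unfolding eventually_nhds_metric using d(1) by auto
qed

text \<open>A shift by half a period along a direction with nonvanishing derivative changes the sign
  of the integrand approximately, while it hardly changes a compact domain of integration.\<close>

lemma oscillatory_integral_shift:
  fixes E :: "'a::euclidean_space \<Rightarrow> complex"
  assumes K: "compact K" and E: "continuous_on K E" "continuous_on ((+) h ` K) E"
    and E1: "\<And>x. norm (E x) \<le> 1"
    and shift: "\<And>x. x \<in> K \<Longrightarrow> norm (E x + E (h + x)) \<le> 2 * \<tau>"
  shows "norm (LINT x:K|lborel. E x) \<le> \<tau> * measure lebesgue K +
     measure lebesgue ((+) h ` K - K) + measure lebesgue ((+) (- h) ` K - K)"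
proof -
  let ?H = "(+) h ` K"
  have H: "compact ?H" using K by (rule compact_translation)
  have fin: "emeasure lborel K < \<infinity>" "emeasure lborel ?H < \<infinity>"
    by - (rule emeasure_compact_finite[OF K], rule emeasure_compact_finite[OF H])
  have borel: "K \<in> sets borel" "?H \<in> sets borel" using K H by (simp_all add: borel_compact)
  have cont: "continuous_on K (\<lambda>x. E (h + x))"
    using continuous_on_compose[of K "(+) h" E] E(2) by (simp add: o_def continuous_intros)
  note iK = set_integral_bounded(1)[OF borel(1) fin(1) E(1) E1]
  note iH = set_integral_bounded(1)[OF borel(2) fin(2) E(2) E1]
  note iKh = set_integral_bounded(1)[OF borel(1) fin(1) cont E1]
  let ?I = "\<lambda>S. LINT x:S|lborel. E x"
  have split: "?I K = ?I (K - ?H) + ?I (K \<inter> ?H)" "?I ?H = ?I (?H - K) + ?I (K \<inter> ?H)"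
  proof -
    have "?I ((K - ?H) \<union> (K \<inter> ?H)) = ?I (K - ?H) + ?I (K \<inter> ?H)"
      using borel by (intro set_integral_Un set_integrable_subset[OF iK]) auto
    moreover have "(K - ?H) \<union> (K \<inter> ?H) = K" by blast
    ultimately show "?I K = ?I (K - ?H) + ?I (K \<inter> ?H)" by simp
    have "?I ((?H - K) \<union> (K \<inter> ?H)) = ?I (?H - K) + ?I (K \<inter> ?H)"
      using borel by (intro set_integral_Un set_integrable_subset[OF iH]) auto
    moreover have "(?H - K) \<union> (K \<inter> ?H) = ?H" by blast
    ultimately show "?I ?H = ?I (?H - K) + ?I (K \<inter> ?H)" by simp
  qed
  have sub: "norm (?I (S - T)) \<le> measure lebesgue (S - T)"
    if "continuous_on S E" "S \<in> sets borel" "T \<in> sets borel" "emeasure lborel S < \<infinity>" for S T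
  proof -
    have "emeasure lborel (S - T) \<le> emeasure lborel S" using that by (intro emeasure_mono) auto
    then have "norm (?I (S - T)) \<le> 1 * measure lborel (S - T)"
      using that E1 by (intro set_integral_bounded) (auto intro: continuous_on_subset order.strict_trans1)
    then show ?thesis using that by (simp add: measure_completion)
  qed
  \<comment> \<open>The part of \<open>K\<close> missed by the shift is a translate of the excess of
    the opposite shift, so one smallness statement covers both difference sets.\<close>
  have tr: "measure lebesgue (K - ?H) = measure lebesgue ((+) (- h) ` K - K)"
  proof -
    have "K - ?H = (+) h ` ((+) (- h) ` K - K)"
    proof (intro set_eqI iffI)
      fix x assume "x \<in> K - ?H"
      then have "- h + x \<in> (+) (- h) ` K - K" by force
      then show "x \<in> (+) h ` ((+) (- h) ` K - K)" by (intro image_eqI[of _ _ "- h + x"]) auto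
    qed auto
    then show ?thesis by (simp add: measure_translation)
  qed
  have "norm (\<integral>x\<in>K. (E x + E (h + x)) \<partial>lborel) \<le> (2 * \<tau>) * measure lborel K"
    using shift by (intro set_integral_bounded borel fin continuous_intros E cont)
  moreover have "(\<integral>x\<in>K. (E x + E (h + x)) \<partial>lborel) = ?I K + ?I ?H"
    using set_integral_add(2)[OF iK iKh] set_integral_translation[OF borel(2) E(2)] by simp
  ultimately have "norm (?I K + ?I ?H) \<le> 2 * \<tau> * measure lebesgue K"
    using borel by (simp add: measure_completion)
  \<comment> \<open>The overlap of \<open>K\<close> and its translate contributes equally to both
    integrals, so passing from their sum to twice the first costs only the two difference
    sets.\<close>
  moreover have "2 * ?I K = (?I K + ?I ?H) + (?I (K - ?H) - ?I (?H - K))"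
    unfolding split by simp
  then have "norm (2 * ?I K) \<le> norm (?I K + ?I ?H) + norm (?I (K - ?H) - ?I (?H - K))"
    by (metis norm_triangle_ineq)
  moreover have "norm (?I (K - ?H) - ?I (?H - K)) \<le> norm (?I (K - ?H)) + norm (?I (?H - K))"
    by (rule norm_triangle_ineq4)
  moreover have "norm (?I (K - ?H)) \<le> measure lebesgue ((+) (- h) ` K - K)"
    using sub[OF E(1) borel fin(1)] tr by simp
  moreover have "norm (?I (?H - K)) \<le> measure lebesgue (?H - K)"
    using sub[OF E(2) borel(2,1) fin(2)] by simp
  ultimately have "2 * norm (?I K) \<le> 2 * \<tau> * measure lebesgue K + measure lebesgue ((+) (- h) ` K - K)
      + measure lebesgue (?H - K)"
    by (simp add: norm_mult)
  moreover have "measure lebesgue ((+) (- h) ` K - K) \<ge> 0" "measure lebesgue (?H - K) \<ge> 0"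
    by simp_all
  ultimately show ?thesis by linarith
qed


section \<open>Half-period shifts and decay at infinity\<close>

lemma half_turn_shift:
  assumes "\<bar>Y - X - s / 2\<bar> \<le> \<theta>" "\<bar>s\<bar> = 1"
  shows "norm (cis (2 * pi * X) + cis (2 * pi * Y)) \<le> 2 * pi * \<theta>"
proof -
  define r where "r = Y - X - s / 2"
  have "2 * pi * Y = 2 * pi * X + pi * s + 2 * pi * r" by (simp add: r_def algebra_simps)
  moreover have "cis (pi * s) = -1" using assms(2) by (auto simp: abs_if complex_eq_iff split: if_splits)
  ultimately have "cis (2 * pi * Y) = - (cis (2 * pi * X) * cis (2 * pi * r))"
    by (simp add: cis_mult[symmetric])
  then have "norm (cis (2 * pi * X) + cis (2 * pi * Y)) = norm (- (cis (2 * pi * X) * (cis (2 * pi * r) - 1)))"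
    by (simp add: algebra_simps)
  also have "\<dots> \<le> \<bar>2 * pi * r\<bar>" using norm_cis_minus_1_le by (simp add: norm_mult)
  also have "\<dots> \<le> 2 * pi * \<theta>" using assms(1) by (simp add: r_def abs_mult)
  finally show ?thesis .
qed

text \<open>Pairing with \<open>a\<close> reduces a vector-valued map to a scalar one on a segment,
  where the mean value theorem holds.\<close>

lemma directional_mvt:
  fixes f :: "'a::real_normed_vector \<Rightarrow> 'b::real_inner"
  assumes "h > 0"
    and deriv: "\<And>t. 0 \<le> t \<Longrightarrow> t \<le> h \<Longrightarrow>
      ((\<lambda>r. f (x + t *\<^sub>R e + r *\<^sub>R e)) has_vector_derivative D (x + t *\<^sub>R e)) (at 0)"
  obtains t where "0 < t" "t < h" "a \<bullet> f (x + h *\<^sub>R e) - a \<bullet> f x = h * (a \<bullet> D (x + t *\<^sub>R e))"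
proof -
  have "((\<lambda>t. a \<bullet> f (x + t *\<^sub>R e)) has_real_derivative a \<bullet> D (x + t *\<^sub>R e)) (at t)"
    if "0 \<le> t" "t \<le> h" for t
  proof -
    have "((\<lambda>r. f (x + t *\<^sub>R e + r *\<^sub>R e)) has_derivative (\<lambda>r. r *\<^sub>R D (x + t *\<^sub>R e))) (at (t - t))"
      using deriv[OF that] by (simp add: has_vector_derivative_def)
    moreover have "((\<lambda>r::real. r - t) has_derivative (\<lambda>r. r)) (at t)"
      by (auto intro!: derivative_eq_intros)
    ultimately have "((\<lambda>r. f (x + t *\<^sub>R e + (r - t) *\<^sub>R e)) has_derivative (\<lambda>r. r *\<^sub>R D (x + t *\<^sub>R e))) (at t)"
      using has_derivative_compose[of "\<lambda>r. r - t" "\<lambda>r. r" t UNIV] by fastforce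
    then have "((\<lambda>r. f (x + r *\<^sub>R e)) has_derivative (\<lambda>r. r *\<^sub>R D (x + t *\<^sub>R e))) (at t)"
      by (simp add: scaleR_diff_left)
    then have "((\<lambda>r. a \<bullet> f (x + r *\<^sub>R e)) has_derivative (\<lambda>r. a \<bullet> (r *\<^sub>R D (x + t *\<^sub>R e)))) (at t)"
      by (rule has_derivative_inner_right)
    then show ?thesis by (simp add: has_field_derivative_def mult_commute_abs)
  qed
  from MVT2[OF \<open>h > 0\<close> this] show thesis using that by force
qed

text \<open>With \<open>\<rho> = v \<bullet> D x0\<close>, a shift along \<open>e\<close> of length
  \<open>1 / (2 * norm (a k) * \<bar>\<rho>\<bar>)\<close> changes \<open>a k \<bullet> f\<close> by
  nearly 1/2 or -1/2, because \<open>a k\<close> points nearly along \<open>v\<close> and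
  \<open>D\<close> is nearly constant close to \<open>x0\<close>. The length tends to 0, so a
  compact set is asymptotically unchanged by the shift.\<close>

lemma oscillatory_integral_near_noncritical_point:
  fixes f :: "'a::euclidean_space \<Rightarrow> 'b::euclidean_space" and a :: "nat \<Rightarrow> 'b"
  assumes U: "open U" and f: "continuous_on U f" and D: "continuous_on U D"
    and deriv: "\<And>x. x \<in> U \<Longrightarrow> ((\<lambda>t. f (x + t *\<^sub>R e)) has_vector_derivative D x) (at 0)"
    and e: "norm e = 1" and x0: "x0 \<in> U" "v \<bullet> D x0 \<noteq> 0"
    and a: "filterlim (\<lambda>k. norm (a k)) at_top sequentially" "(\<lambda>k. a k /\<^sub>R norm (a k)) \<longlonglongrightarrow> v"
    and \<tau>: "\<tau> > 0"
  obtains s where "s > 0" "ball x0 s \<subseteq> U"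
    "\<And>K \<epsilon>. compact K \<Longrightarrow> K \<subseteq> ball x0 s \<Longrightarrow> \<epsilon> > 0 \<Longrightarrow>
       \<forall>\<^sub>F k in sequentially. norm (LINT x:K|lborel. cis (2 * pi * (a k \<bullet> f x))) \<le> \<tau> * measure lebesgue K + \<epsilon>"
proof -
  define \<rho> where "\<rho> = v \<bullet> D x0"
  define \<theta> where "\<theta> = \<tau> / pi"
  have \<rho>: "\<bar>\<rho>\<bar> > 0" using x0 by (simp add: \<rho>_def)
  have \<theta>: "\<theta> > 0" using \<tau> by (simp add: \<theta>_def)
  \<comment> \<open>Together with \<open>ev3\<close> this leaves two errors of at most
    \<open>\<theta> * \<bar>\<rho>\<bar>\<close> in \<open>w \<bullet> y\<close>, and division by
    \<open>2 * \<bar>\<rho>\<bar>\<close> turns them into a phase error \<open>\<theta>\<close>,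
    where \<open>2 * pi * \<theta> = 2 * \<tau>\<close>. The minimum with 1 bounds
    \<open>norm y\<close>.\<close>
  define g where "g = min 1 (\<theta> * \<bar>\<rho>\<bar> / (norm v + 1))"
  have g: "g > 0" using \<theta> \<rho> by (simp add: g_def add_nonneg_pos)
  have "isCont D x0" using D U x0(1) by (simp add: continuous_on_eq_continuous_at)
  then obtain r1 where r1: "r1 > 0" "\<And>y. dist y x0 < r1 \<Longrightarrow> norm (D y - D x0) < g"
    using g unfolding continuous_at_eps_delta dist_norm by blast
  obtain r2 where r2: "r2 > 0" "ball x0 r2 \<subseteq> U" using U x0(1) open_contains_ball by blast
  \<comment> \<open>Half the radius, so that a point of \<open>K\<close> moved by less than
    \<open>s\<close> stays where \<open>D\<close> is controlled.\<close>
  define s where "s = min r1 r2 / 2"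
  have s: "s > 0" "2 * s \<le> r1" "2 * s \<le> r2" using r1 r2 by (auto simp: s_def)
  show thesis
  proof (rule that[of s])
    show "s > 0" "ball x0 s \<subseteq> U" using s r2 by auto
    fix K and \<epsilon> :: real assume K: "compact K" "K \<subseteq> ball x0 s" and \<epsilon>: "\<epsilon> > 0"
    define h where "h k = (1 / (2 * norm (a k) * \<bar>\<rho>\<bar>)) *\<^sub>R e" for k
    have h0: "(\<lambda>k. 1 / (2 * norm (a k) * \<bar>\<rho>\<bar>)) \<longlonglongrightarrow> 0"
      by (rule real_tendsto_divide_at_top[OF tendsto_const])
        (use \<rho> a(1) in \<open>intro filterlim_at_top_mult_tendsto_pos[OF tendsto_const]
           filterlim_tendsto_pos_mult_at_top[OF tendsto_const], auto\<close>)
    then have h: "h \<longlonglongrightarrow> 0" unfolding h_def using tendsto_scaleR[OF h0 tendsto_const[of e]] by simp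
    have "(\<lambda>k. measure lebesgue ((+) (h k) ` K - K)) \<longlonglongrightarrow> 0"
      using filterlim_compose[OF compact_translation_diff_small[OF K(1)] h] .
    then have ev1: "\<forall>\<^sub>F k in sequentially. measure lebesgue ((+) (h k) ` K - K) < \<epsilon> / 2"
      using \<epsilon> by (intro order_tendstoD) auto
    have "(\<lambda>k. - h k) \<longlonglongrightarrow> 0" using tendsto_minus[OF h] by simp
    then have "(\<lambda>k. measure lebesgue ((+) (- h k) ` K - K)) \<longlonglongrightarrow> 0"
      by (rule filterlim_compose[OF compact_translation_diff_small[OF K(1)]])
    then have ev2: "\<forall>\<^sub>F k in sequentially. measure lebesgue ((+) (- h k) ` K - K) < \<epsilon> / 2"
      using \<epsilon> by (intro order_tendstoD) auto
    have ev3: "\<forall>\<^sub>F k in sequentially. norm (a k /\<^sub>R norm (a k) - v) < \<theta> * \<bar>\<rho>\<bar> / (norm (D x0) + 1)"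
      using a(2) \<theta> \<rho> tendstoD[OF a(2), of "\<theta> * \<bar>\<rho>\<bar> / (norm (D x0) + 1)"]
      by (simp add: dist_norm add_nonneg_pos)
    have ev4: "\<forall>\<^sub>F k in sequentially. 1 / (2 * norm (a k) * \<bar>\<rho>\<bar>) < s"
      using h0 s by (intro order_tendstoD) auto
    have ev5: "\<forall>\<^sub>F k in sequentially. norm (a k) > 0"
      using a(1)[unfolded filterlim_at_top_dense] by blast
    show "\<forall>\<^sub>F k in sequentially. norm (LINT x:K|lborel. cis (2 * pi * (a k \<bullet> f x))) \<le> \<tau> * measure lebesgue K + \<epsilon>"
      using ev1 ev2 ev3 ev4 ev5
    proof eventually_elim
      case (elim k)
      define \<eta> where "\<eta> = 1 / (2 * norm (a k) * \<bar>\<rho>\<bar>)"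
      have \<eta>: "0 < \<eta>" "\<eta> < s" using elim \<rho> by (auto simp: \<eta>_def)
      have hk: "h k = \<eta> *\<^sub>R e" by (simp add: h_def \<eta>_def)
      have inball: "x + t *\<^sub>R e \<in> ball x0 (2 * s)" if "x \<in> K" "0 \<le> t" "t \<le> \<eta>" for x t
      proof -
        have "dist x0 x < s" using K(2) that by auto
        moreover have "dist x (x + t *\<^sub>R e) < s" using that \<eta> e by (simp add: dist_norm)
        ultimately show ?thesis using dist_triangle[of x0 "x + t *\<^sub>R e" x] by simp
      qed
      then have inU: "x + t *\<^sub>R e \<in> U" if "x \<in> K" "0 \<le> t" "t \<le> \<eta>" for x t
        using that r2(2) s(3) by force
      have KU: "K \<subseteq> U" using inU[of _ 0] \<eta> by auto
      have hKU: "(+) (h k) ` K \<subseteq> U" using inU[of _ \<eta>] \<eta> by (auto simp: hk add.commute)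
      let ?E = "\<lambda>x. cis (2 * pi * (a k \<bullet> f x))"
      have contE: "continuous_on S ?E" if "S \<subseteq> U" for S
        by (intro continuous_intros continuous_on_subset[OF f that])
      have "norm (?E x + ?E (h k + x)) \<le> 2 * \<tau>" if x: "x \<in> K" for x
      proof -
        obtain t where t: "0 < t" "t < \<eta>"
          "a k \<bullet> f (x + \<eta> *\<^sub>R e) - a k \<bullet> f x = \<eta> * (a k \<bullet> D (x + t *\<^sub>R e))"
          using directional_mvt[OF \<eta>(1), of f x e D "a k"] deriv inU[OF x] by metis
        define w where "w = a k /\<^sub>R norm (a k)"
        define y where "y = D (x + t *\<^sub>R e)"
        have y: "norm (y - D x0) < g"
          unfolding y_def using r1(2) inball[OF x, of t] t s(2) by (auto simp: dist_commute)
        have w: "norm (w - v) * (norm (D x0) + 1) \<le> \<theta> * \<bar>\<rho>\<bar>"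
        proof -
          have "0 < norm (D x0) + 1" by (simp add: add_nonneg_pos)
          then show ?thesis using elim(3)[folded w_def] by (simp only: pos_less_divide_eq less_imp_le)
        qed
        have "\<bar>w \<bullet> y - \<rho>\<bar> = \<bar>(w - v) \<bullet> y + v \<bullet> (y - D x0)\<bar>"
          by (simp add: \<rho>_def algebra_simps inner_diff_left inner_diff_right)
        also have "\<dots> \<le> norm (w - v) * norm y + norm v * norm (y - D x0)"
          using Cauchy_Schwarz_ineq2[of "w - v" y] Cauchy_Schwarz_ineq2[of v "y - D x0"] by linarith
        also have "norm y \<le> norm (D x0) + 1"
        proof -
          have "norm y \<le> norm (y - D x0) + norm (D x0)" using norm_triangle_ineq[of "y - D x0" "D x0"] by simp
          then show ?thesis using y by (simp add: g_def)
        qed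
        then have "norm (w - v) * norm y \<le> norm (w - v) * (norm (D x0) + 1)" by (intro mult_left_mono) auto
        also have "norm v * norm (y - D x0) \<le> (norm v + 1) * g" using y by (intro mult_mono) auto
        also have "(norm v + 1) * g \<le> (norm v + 1) * (\<theta> * \<bar>\<rho>\<bar> / (norm v + 1))"
          by (intro mult_left_mono) (auto simp: g_def)
        also have "\<dots> = \<theta> * \<bar>\<rho>\<bar>" by (simp add: add_nonneg_eq_0_iff)
        finally have wy: "\<bar>w \<bullet> y - \<rho>\<bar> \<le> 2 * \<theta> * \<bar>\<rho>\<bar>" using w by linarith
        have "a k \<bullet> y = norm (a k) * (w \<bullet> y)" using elim(5) by (simp add: w_def)
        then have "a k \<bullet> f (h k + x) - a k \<bullet> f x = (w \<bullet> y) / (2 * \<bar>\<rho>\<bar>)"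
          using t(3) elim(5) by (simp add: hk \<eta>_def y_def add.commute)
        moreover have "sgn \<rho> / 2 = \<rho> / (2 * \<bar>\<rho>\<bar>)" using \<rho> by (simp add: sgn_if)
        ultimately have "a k \<bullet> f (h k + x) - a k \<bullet> f x - sgn \<rho> / 2 = (w \<bullet> y - \<rho>) / (2 * \<bar>\<rho>\<bar>)"
          by (simp only: diff_divide_distrib)
        then have "\<bar>a k \<bullet> f (h k + x) - a k \<bullet> f x - sgn \<rho> / 2\<bar> \<le> \<theta>"
          using wy \<rho> by (simp add: abs_divide divide_le_eq)
        then have "norm (?E x + ?E (h k + x)) \<le> 2 * pi * \<theta>"
          using \<rho> by (intro half_turn_shift[of _ _ "sgn \<rho>"]) (auto simp: abs_sgn_eq)
        then show ?thesis by (simp add: \<theta>_def)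
      qed
      then have "norm (LINT x:K|lborel. ?E x) \<le> \<tau> * measure lebesgue K +
          measure lebesgue ((+) (h k) ` K - K) + measure lebesgue ((+) (- h k) ` K - K)"
        using K(1) by (intro oscillatory_integral_shift contE KU hKU) auto
      then show ?case using elim(1,2) by linarith
    qed
  qed
qed


lemma bounded_borel_inner_compact:
  fixes Z :: "'a::euclidean_space set"
  assumes "Z \<in> sets borel" "bounded Z" "\<epsilon> > 0"
  obtains K where "compact K" "K \<subseteq> Z" "measure lebesgue (Z - K) < \<epsilon>"
proof -
  obtain T where T: "closed T" "T \<subseteq> Z" "Z - T \<in> lmeasurable" "emeasure lebesgue (Z - T) < ennreal \<epsilon>"
    using sets_lebesgue_inner_closed[of Z \<epsilon>] assms by auto
  have "measure lebesgue (Z - T) < \<epsilon>"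
    using T(3,4) by (simp add: emeasure_eq_measure2 ennreal_less_iff)
  moreover have "compact T" using T(1,2) assms(2) bounded_subset compact_eq_bounded_closed by blast
  ultimately show thesis using T(2) by (intro that)
qed

lemma set_integral_split_bounded:
  fixes E :: "'a::euclidean_space \<Rightarrow> complex"
  assumes "Z \<in> sets borel" "bounded Z" "A \<in> sets borel" "continuous_on Z E" "\<And>x. norm (E x) \<le> 1"
  shows "(LINT x:Z|lborel. E x) = (LINT x:Z \<inter> A|lborel. E x) + (LINT x:Z - A|lborel. E x)"
    "norm (LINT x:Z - A|lborel. E x) \<le> measure lebesgue (Z - A)"
proof -
  have fin: "emeasure lborel S < \<infinity>" if "S \<subseteq> Z" "S \<in> sets borel" for S
    using emeasure_bounded_finite[of S] bounded_subset[OF assms(2) that(1)] by simp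
  have "set_integrable lborel Z E" using assms fin[of Z] by (intro set_integral_bounded) auto
  then have "(LINT x:(Z \<inter> A) \<union> (Z - A)|lborel. E x) =
      (LINT x:Z \<inter> A|lborel. E x) + (LINT x:Z - A|lborel. E x)"
    using assms by (intro set_integral_Un) (auto elim!: set_integrable_subset)
  then show "(LINT x:Z|lborel. E x) = (LINT x:Z \<inter> A|lborel. E x) + (LINT x:Z - A|lborel. E x)"
    by (simp add: Int_Diff_Un)
  have "norm (LINT x:Z - A|lborel. E x) \<le> 1 * measure lborel (Z - A)"
    using assms fin[of "Z - A"] continuous_on_subset[OF assms(4), of "Z - A"]
    by (intro set_integral_bounded) auto
  then show "norm (LINT x:Z - A|lborel. E x) \<le> measure lebesgue (Z - A)"
    using assms by (simp add: measure_completion)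
qed

text \<open>Near a noncritical point the integral over a Borel piece is eventually at most
  \<open>\<tau>\<close> times its measure plus an arbitrarily small error. Such bounds add up over
  disjoint pieces, so finitely many balls treat a compact set of noncritical points; the remainder
  of \<open>Z\<close> is small up to the null set of critical points.\<close>

lemma oscillatory_integral_tendsto_0:
  fixes f :: "'a::euclidean_space \<Rightarrow> 'b::euclidean_space" and D :: "'a \<Rightarrow> 'a \<Rightarrow> 'b"
    and a :: "nat \<Rightarrow> 'b"
  assumes U: "open U" and f: "continuous_on U f" and D: "\<And>i. i \<in> Basis \<Longrightarrow> continuous_on U (D i)"
    and deriv: "\<And>i x. i \<in> Basis \<Longrightarrow> x \<in> U \<Longrightarrow>
      ((\<lambda>t. f (x + t *\<^sub>R i)) has_vector_derivative D i x) (at 0)"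
    and a: "filterlim (\<lambda>k. norm (a k)) at_top sequentially" "(\<lambda>k. a k /\<^sub>R norm (a k)) \<longlonglongrightarrow> v"
    and crit: "negligible {x\<in>U. \<forall>i\<in>Basis. v \<bullet> D i x = 0}"
    and Z: "Z \<in> sets borel" "bounded Z" "Z \<subseteq> U"
  shows "(\<lambda>k. LINT x:Z|lborel. cis (2 * pi * (a k \<bullet> f x))) \<longlonglongrightarrow> 0"
proof (rule tendstoI)
  fix \<epsilon> :: real assume \<epsilon>: "\<epsilon> > 0"
  define I where "I k S = (LINT x:S|lborel. cis (2 * pi * (a k \<bullet> f x)))" for k S
  have cont: "continuous_on S (\<lambda>x. cis (2 * pi * (a k \<bullet> f x)))" if "S \<subseteq> U" for S k
    by (intro continuous_intros continuous_on_subset[OF f that])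
  \<comment> \<open>Gives \<open>\<tau> * measure lebesgue K \<le> \<epsilon> / 4\<close>; the added
    1 covers null sets \<open>Z\<close>.\<close>
  define \<tau> where "\<tau> = \<epsilon> / (4 * (measure lebesgue Z + 1))"
  have \<tau>: "\<tau> > 0" using \<epsilon> by (simp add: \<tau>_def add_nonneg_pos)
  \<comment> \<open>Ranging over all Borel subsets \<open>S\<close> allows a union to be split along
    \<open>V\<close>, and the slack \<open>\<gamma>\<close> absorbs the inner approximation by
    compact sets.\<close>
  define good where "good V \<longleftrightarrow> (\<forall>S \<gamma>. S \<in> sets borel \<longrightarrow> bounded S \<longrightarrow> S \<subseteq> V \<longrightarrow> S \<subseteq> U \<longrightarrow> \<gamma> > 0 \<longrightarrow>
      (\<forall>\<^sub>F k in sequentially. norm (I k S) \<le> \<tau> * measure lebesgue S + \<gamma>))" for V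
  have meas: "S \<in> lmeasurable" if "S \<in> sets borel" "bounded S" for S :: "'a set"
    using that by (intro bounded_set_imp_lmeasurable) auto
  have local_good: "\<exists>s>0. good (ball x s)" if x: "x \<in> U" "i \<in> Basis" "v \<bullet> D i x \<noteq> 0" for x i
  proof -
    obtain s where s: "s > 0" "ball x s \<subseteq> U"
      "\<And>K \<epsilon>. compact K \<Longrightarrow> K \<subseteq> ball x s \<Longrightarrow> \<epsilon> > 0 \<Longrightarrow>
         \<forall>\<^sub>F k in sequentially. norm (I k K) \<le> \<tau> * measure lebesgue K + \<epsilon>"
      unfolding I_def
      using oscillatory_integral_near_noncritical_point[OF U f D[OF x(2)] deriv[OF x(2)] _ x(1,3) a \<tau>] x(2)
      by (metis norm_Basis)
    have "good (ball x s)" unfolding good_def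
    proof (intro allI impI)
      fix S \<gamma> assume S: "S \<in> sets borel" "bounded S" "S \<subseteq> ball x s" "S \<subseteq> U" and \<gamma>: "\<gamma> > (0::real)"
      obtain K where K: "compact K" "K \<subseteq> S" "measure lebesgue (S - K) < \<gamma> / 2"
        using bounded_borel_inner_compact[OF S(1,2), of "\<gamma>/2"] \<gamma> by auto
      have "\<forall>\<^sub>F k in sequentially. norm (I k K) \<le> \<tau> * measure lebesgue K + \<gamma> / 2"
        using s(3)[of K "\<gamma>/2"] K S \<gamma> by auto
      then show "\<forall>\<^sub>F k in sequentially. norm (I k S) \<le> \<tau> * measure lebesgue S + \<gamma>"
      proof eventually_elim
        case (elim k)
        have SK: "S \<inter> K = K" using K by auto
        have "I k S = I k K + I k (S - K)" "norm (I k (S - K)) \<le> measure lebesgue (S - K)"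
          using set_integral_split_bounded[OF S(1,2) borel_compact[OF K(1)] cont[OF S(4), of k]]
          unfolding I_def SK by simp_all
        then have "norm (I k S) \<le> norm (I k K) + \<gamma> / 2"
          using norm_triangle_ineq[of "I k K" "I k (S - K)"] K(3) by simp
        moreover have "\<tau> * measure lebesgue K \<le> \<tau> * measure lebesgue S"
          using \<tau> K meas[OF S(1,2)] by (intro mult_left_mono measure_mono_fmeasurable) (auto simp: lmeasurable_compact fmeasurableD)
        ultimately show ?case using elim by linarith
      qed
    qed
    with s(1) show ?thesis by blast
  qed
  have good_Un: "good (V \<union> W)" if "good V" "good W" "open V" for V W
    unfolding good_def
  proof (intro allI impI)
    fix S \<gamma> assume S: "S \<in> sets borel" "bounded S" "S \<subseteq> V \<union> W" "S \<subseteq> U" and \<gamma>: "\<gamma> > (0::real)"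
    have V: "V \<in> sets borel" using that(3) by simp
    have SV: "S \<inter> V \<in> sets borel" "bounded (S \<inter> V)" "S - V \<in> sets borel" "bounded (S - V)"
      using S V by (auto intro: bounded_subset)
    have "\<forall>\<^sub>F k in sequentially. norm (I k (S \<inter> V)) \<le> \<tau> * measure lebesgue (S \<inter> V) + \<gamma> / 2"
      using that(1) SV S \<gamma> unfolding good_def by (meson Int_lower1 Int_lower2 half_gt_zero order.trans)
    moreover have "\<forall>\<^sub>F k in sequentially. norm (I k (S - V)) \<le> \<tau> * measure lebesgue (S - V) + \<gamma> / 2"
      using that(2)[unfolded good_def, rule_format, of "S - V" "\<gamma>/2"] SV S \<gamma> by auto
    ultimately show "\<forall>\<^sub>F k in sequentially. norm (I k S) \<le> \<tau> * measure lebesgue S + \<gamma>"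
    proof eventually_elim
      case (elim k)
      have "I k S = I k (S \<inter> V) + I k (S - V)"
        using set_integral_split_bounded(1)[OF S(1,2) V cont[OF S(4), of k]] unfolding I_def by simp
      then have "norm (I k S) \<le> norm (I k (S \<inter> V)) + norm (I k (S - V))"
        by (simp add: norm_triangle_ineq)
      moreover have "measure lebesgue S = measure lebesgue (S \<inter> V) + measure lebesgue (S - V)"
      proof -
        have "S \<inter> V \<inter> (S - V) = {}" by blast
        then show ?thesis
          using measure_Un3[of "S \<inter> V" lebesgue "S - V"] meas[OF SV(1,2)] meas[OF SV(3,4)]
          by (simp add: Int_Diff_Un)
      qed
      ultimately show ?case using elim by (simp add: distrib_left)
    qed
  qed
  have good_empty: "good {}" unfolding good_def I_def by (simp add: set_lebesgue_integral_def)
  define W where "W = {x\<in>U. \<exists>i\<in>Basis. v \<bullet> D i x \<noteq> 0}"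
  have "open W"
  proof -
    have "open {x\<in>U. v \<bullet> D i x \<noteq> 0}" if "i \<in> Basis" for i
    proof -
      have "continuous_on U (\<lambda>x. v \<bullet> D i x)" using D[OF that] by (intro continuous_intros)
      from continuous_open_preimage[OF this U, of "- {0}"] show ?thesis
        by (simp add: vimage_def Int_def open_Compl)
    qed
    then have "open (\<Union>i\<in>Basis. {x\<in>U. v \<bullet> D i x \<noteq> 0})" by blast
    moreover have "(\<Union>i\<in>Basis. {x\<in>U. v \<bullet> D i x \<noteq> 0}) = W" by (auto simp: W_def)
    ultimately show ?thesis by simp
  qed
  then have WZ: "Z \<inter> W \<in> sets borel" "bounded (Z \<inter> W)" using Z by (auto intro: bounded_subset)
  obtain K where K: "compact K" "K \<subseteq> Z \<inter> W" "measure lebesgue (Z \<inter> W - K) < \<epsilon> / 4"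
    using bounded_borel_inner_compact[OF WZ, of "\<epsilon>/4"] \<epsilon> by auto
  have "\<forall>x\<in>K. \<exists>s>0. good (ball x s)" using local_good K(2) by (force simp: W_def)
  then obtain s where s: "\<And>x. x \<in> K \<Longrightarrow> s x > 0 \<and> good (ball x (s x))"
    using bchoice[of K "\<lambda>x s. s > 0 \<and> good (ball x s)"] by blast
  obtain F where F: "F \<subseteq> K" "finite F" "K \<subseteq> (\<Union>x\<in>F. ball x (s x))"
  proof (rule compactE_image[OF K(1), of K "\<lambda>x. ball x (s x)"])
    show "K \<subseteq> (\<Union>x\<in>K. ball x (s x))" using s by force
  qed auto
  have "good (\<Union>x\<in>F. ball x (s x))"
    using F(2,1)
  proof (induction F rule: finite_induct)
    case (insert x F)
    then show ?case using good_Un[of "ball x (s x)" "\<Union>x\<in>F. ball x (s x)"] s by simp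
  qed (simp add: good_empty)
  moreover have "K \<subseteq> U" "bounded K" "K \<in> sets borel"
    using K Z by (auto simp: compact_imp_bounded borel_compact)
  ultimately have "\<forall>\<^sub>F k in sequentially. norm (I k K) \<le> \<tau> * measure lebesgue K + \<epsilon> / 4"
    using F(3) \<epsilon> unfolding good_def by simp
  then show "\<forall>\<^sub>F k in sequentially. dist (LINT x:Z|lborel. cis (2 * pi * (a k \<bullet> f x))) 0 < \<epsilon>"
  proof eventually_elim
    case (elim k)
    have ZK: "Z \<inter> K = K" using K by auto
    have "I k Z = I k K + I k (Z - K)" and le: "norm (I k (Z - K)) \<le> measure lebesgue (Z - K)"
      using set_integral_split_bounded[OF Z(1,2) borel_compact[OF K(1)] cont[OF Z(3), of k]]
      unfolding I_def ZK by simp_all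
    then have "norm (I k Z) \<le> norm (I k K) + measure lebesgue (Z - K)"
      using norm_triangle_ineq[of "I k K" "I k (Z - K)"] by simp
    moreover have "measure lebesgue (Z - K) = measure lebesgue (Z \<inter> W - K)"
    proof (rule measure_negligible_symdiff)
      show "Z \<inter> W - K \<in> lmeasurable"
        using WZ K(1) by (intro meas) (auto simp: borel_compact intro: bounded_subset)
      show "negligible ((Z \<inter> W - K) - (Z - K) \<union> ((Z - K) - (Z \<inter> W - K)))"
        by (rule negligible_subset[OF crit]) (use Z(3) in \<open>auto simp: W_def\<close>)
    qed
    moreover have "\<tau> * measure lebesgue K \<le> \<epsilon> / 4"
    proof -
      have "measure lebesgue K \<le> measure lebesgue Z + 1"
        using K meas[OF Z(1,2)] measure_mono_fmeasurable[of K Z lebesgue] by (auto simp: lmeasurable_compact fmeasurableD)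
      then have "\<tau> * measure lebesgue K \<le> \<tau> * (measure lebesgue Z + 1)" using \<tau> by (intro mult_left_mono) auto
      also have "\<dots> = \<epsilon> / 4"
      proof -
        have "\<epsilon> / (4 * M) * M = \<epsilon> / 4" if "M > 0" for M :: real using that by simp
        then show ?thesis unfolding \<tau>_def by (simp only: add_nonneg_pos measure_nonneg zero_less_one)
      qed
      finally show ?thesis .
    qed
    ultimately have "norm (I k Z) < \<epsilon>" using elim K(3) \<epsilon> by linarith
    then show ?case by (simp add: I_def)
  qed
qed


text \<open>The directions of a sequence of counterexamples subconverge on the unit sphere, so decay
  along sequences with a limiting direction is already uniform. Compactness yields a threshold but
  no rate.\<close>

lemma oscillatory_integral_uniform_decay:
  fixes f :: "'a::euclidean_space \<Rightarrow> 'b::euclidean_space" and D :: "'a \<Rightarrow> 'a \<Rightarrow> 'b"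
  assumes U: "open U" and f: "continuous_on U f" and D: "\<And>i. i \<in> Basis \<Longrightarrow> continuous_on U (D i)"
    and deriv: "\<And>i x. i \<in> Basis \<Longrightarrow> x \<in> U \<Longrightarrow>
      ((\<lambda>t. f (x + t *\<^sub>R i)) has_vector_derivative D i x) (at 0)"
    and crit: "\<And>v. v \<noteq> 0 \<Longrightarrow> negligible {x\<in>U. \<forall>i\<in>Basis. v \<bullet> D i x = 0}"
    and Z: "Z \<in> sets borel" "bounded Z" "Z \<subseteq> U" and \<tau>: "\<tau> > 0"
  obtains R :: nat where
    "\<And>a. norm a > real R \<Longrightarrow> norm (LINT x:Z|lborel. cis (2 * pi * (a \<bullet> f x))) \<le> \<tau>"
proof (rule ccontr)
  assume "\<not> thesis"
  then have "\<forall>k::nat. \<exists>a. norm a > real k \<and> \<not> norm (LINT x:Z|lborel. cis (2 * pi * (a \<bullet> f x))) \<le> \<tau>"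
    using that by blast
  then obtain a where a: "\<And>k. norm (a k) > real k"
    "\<And>k. norm (LINT x:Z|lborel. cis (2 * pi * (a k \<bullet> f x))) > \<tau>" by (metis not_le)
  have "norm (a k) > 0" for k using a(1)[of k] by (meson le_less_trans of_nat_0_le_iff)
  then have "a k /\<^sub>R norm (a k) \<in> sphere 0 1" for k by simp
  then obtain v r where v: "v \<in> sphere 0 1" and r: "strict_mono r"
    and lim: "((\<lambda>k. a k /\<^sub>R norm (a k)) \<circ> r) \<longlonglongrightarrow> v"
    using compact_sphere[of "0::'b" 1] unfolding compact_def by meson
  have "filterlim (\<lambda>k. norm (a k)) at_top sequentially"
    by (rule filterlim_at_top_mono[OF filterlim_real_sequentially])
      (simp add: a(1) less_imp_le)
  then have "filterlim (\<lambda>k. norm (a (r k))) at_top sequentially"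
    using filterlim_compose filterlim_subseq[OF r] by fastforce
  moreover have "v \<noteq> 0" using v by auto
  ultimately have "(\<lambda>k. LINT x:Z|lborel. cis (2 * pi * (a (r k) \<bullet> f x))) \<longlonglongrightarrow> 0"
    using lim by (intro oscillatory_integral_tendsto_0[OF U f D deriv _ _ crit Z]) (auto simp: o_def)
  then have "\<forall>\<^sub>F k in sequentially. norm (LINT x:Z|lborel. cis (2 * pi * (a (r k) \<bullet> f x))) < \<tau>"
    using \<tau> by (auto dest!: tendstoD)
  then show False using a(2) by (auto simp: eventually_sequentially not_less less_imp_le dest: less_asym)
qed

section \<open>Zero sets of real analytic functions\<close>

definition monomial_at :: "('d::finite \<Rightarrow> nat) \<Rightarrow> real ^ 'd \<Rightarrow> real" where
  "monomial_at k y = (\<Prod>i\<in>UNIV. (y $ i) ^ k i)"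

text \<open>Multi-indices carry no natural order; \<open>has_sum\<close> is unordered summation,
  which for real terms is absolute.\<close>

definition power_series_at ::
    "(real ^ 'd \<Rightarrow> real) \<Rightarrow> real ^ 'd \<Rightarrow> real \<Rightarrow> (('d::finite \<Rightarrow> nat) \<Rightarrow> real) \<Rightarrow> bool" where
  "power_series_at g a r c \<longleftrightarrow> (\<forall>x\<in>ball a r. ((\<lambda>k. c k * monomial_at k (x - a)) has_sum g x) UNIV)"

definition pderiv_at :: "'d::finite \<Rightarrow> (real ^ 'd \<Rightarrow> real) \<Rightarrow> real ^ 'd \<Rightarrow> real" where
  "pderiv_at i g x = deriv (\<lambda>t. g (x + t *\<^sub>R axis i 1)) 0"

text \<open>The coefficients of the series differentiated term by term in the variable
  \<open>i\<close>.\<close>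

definition shift_coeff :: "'d \<Rightarrow> (('d \<Rightarrow> nat) \<Rightarrow> real) \<Rightarrow> ('d \<Rightarrow> nat) \<Rightarrow> real" where
  "shift_coeff i c k = real (Suc (k i)) * c (k(i := Suc (k i)))"

lemma has_sum_diff_real:
  fixes f g :: "'a \<Rightarrow> real"
  assumes "(f has_sum a) A" "(g has_sum b) A"
  shows "((\<lambda>x. f x - g x) has_sum (a - b)) A"
  using has_sum_add[OF assms(1) has_sum_uminusI[OF assms(2)]] by simp

text \<open>Evaluate at the corner of a cube inside the ball: unordered summability of reals is
  absolute, and the resulting series is a majorant on the whole cube.\<close>

lemma power_series_at_abs_summable:
  fixes g :: "real ^ 'd \<Rightarrow> real"
  assumes "power_series_at g a r c" "r > 0"
  obtains \<rho> where "\<rho> > 0" "(\<lambda>k. \<bar>c k\<bar> * \<rho> ^ (\<Sum>i\<in>UNIV. k i)) summable_on UNIV"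
    "\<And>y :: real ^ 'd. (\<And>i. \<bar>y $ i\<bar> \<le> \<rho>) \<Longrightarrow> a + y \<in> ball a r"
proof -
  define \<rho> where "\<rho> = r / (2 * real CARD('d))"
  have \<rho>: "\<rho> > 0" using assms(2) by (simp add: \<rho>_def)
  have inball: "a + y \<in> ball a r" if "\<And>i. \<bar>y $ i\<bar> \<le> \<rho>" for y :: "real ^ 'd"
  proof -
    have "norm y \<le> (\<Sum>i\<in>UNIV. \<bar>y $ i\<bar>)" by (rule norm_le_l1_cart)
    also have "\<dots> \<le> (\<Sum>i\<in>(UNIV::'d set). \<rho>)" using that by (intro sum_mono)
    also have "\<dots> = r / 2" by (simp add: \<rho>_def)
    finally show ?thesis using assms(2) by (simp add: dist_norm)
  qed
  let ?y = "(\<chi> i. \<rho>) :: real ^ 'd"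
  have "((\<lambda>k. c k * monomial_at k ?y) has_sum g (a + ?y)) UNIV"
    using assms(1) inball[of ?y] \<rho> unfolding power_series_at_def by force
  then have "(\<lambda>k. c k * monomial_at k ?y) summable_on UNIV" by (rule has_sum_imp_summable)
  then have "(\<lambda>k. norm (c k * monomial_at k ?y)) summable_on UNIV"
    by (subst (asm) summable_on_iff_abs_summable_on_real)
  moreover have "norm (c k * monomial_at k ?y) = \<bar>c k\<bar> * \<rho> ^ (\<Sum>i\<in>UNIV. k i)" for k
    using \<rho> by (simp add: monomial_at_def abs_mult power_sum abs_prod)
  ultimately show thesis using \<rho> inball by (intro that) auto
qed

lemma abs_monomial_at_le:
  assumes "\<And>i. \<bar>y $ i\<bar> \<le> M"
  shows "\<bar>monomial_at k y\<bar> \<le> M ^ (\<Sum>i\<in>UNIV. k i)"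
  unfolding monomial_at_def abs_prod power_sum power_abs
  using assms by (intro prod_mono) (auto intro: power_mono)

text \<open>Every binomial term of order two or more carries a factor
  \<open>(t / \<sigma>)\<^sup>2\<close>, and what is left sums to at most
  \<open>(2 * \<sigma>) ^ j\<close>. With \<open>2 * \<sigma> = \<rho>\<close> the majorant series
  dominates the remainders.\<close>

lemma power_taylor_bound:
  fixes s t \<sigma> :: real
  assumes "\<bar>s\<bar> \<le> \<sigma>" "\<bar>t\<bar> \<le> \<sigma>" "\<sigma> > 0"
  shows "\<bar>(s + t) ^ j - s ^ j - t * (real j * s ^ (j - 1))\<bar> \<le> (t / \<sigma>)\<^sup>2 * (2 * \<sigma>) ^ j"
proof (cases "j \<le> 1")
  case True
  then have "j = 0 \<or> j = 1" by auto
  then show ?thesis using assms(3) by auto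
next
  case False
  have expand: "(s + t) ^ j = (\<Sum>b\<le>j. real (j choose b) * t ^ b * s ^ (j - b))"
    by (subst add.commute) (rule binomial_ring)
  have split: "{..j} = insert 0 (insert 1 {2..j})" using False by auto
  have "(s + t) ^ j - s ^ j - t * (real j * s ^ (j - 1)) = (\<Sum>b\<in>{2..j}. real (j choose b) * t ^ b * s ^ (j - b))"
    unfolding expand split by simp
  also have "\<bar>\<dots>\<bar> \<le> (\<Sum>b\<in>{2..j}. \<bar>real (j choose b) * t ^ b * s ^ (j - b)\<bar>)"
    by (rule sum_abs)
  also have "\<dots> \<le> (\<Sum>b\<in>{2..j}. (t / \<sigma>)\<^sup>2 * (real (j choose b) * \<sigma> ^ b * \<sigma> ^ (j - b)))"
  proof (rule sum_mono)
    fix b assume b: "b \<in> {2..j}"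
    have "b = 2 + (b - 2)" using b by auto
    then have "\<bar>t\<bar> ^ b = \<bar>t\<bar> ^ (2 + (b - 2))" by (rule arg_cong)
    also have "\<dots> = \<bar>t\<bar>\<^sup>2 * \<bar>t\<bar> ^ (b - 2)" by (rule power_add)
    also have "\<dots> \<le> \<bar>t\<bar>\<^sup>2 * \<sigma> ^ (b - 2)" using assms by (intro mult_left_mono power_mono) auto
    also have "\<dots> = (t / \<sigma>)\<^sup>2 * \<sigma> ^ b"
      using b assms(3) by (simp add: power_divide power_diff)
    finally have "\<bar>t ^ b\<bar> \<le> (t / \<sigma>)\<^sup>2 * \<sigma> ^ b" by (simp add: power_abs)
    moreover have "\<bar>s ^ (j - b)\<bar> \<le> \<sigma> ^ (j - b)" using assms by (simp add: power_abs power_mono)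
    ultimately have "\<bar>t ^ b\<bar> * \<bar>s ^ (j - b)\<bar> \<le> ((t / \<sigma>)\<^sup>2 * \<sigma> ^ b) * \<sigma> ^ (j - b)"
      using assms by (intro mult_mono) auto
    then have "real (j choose b) * (\<bar>t ^ b\<bar> * \<bar>s ^ (j - b)\<bar>) \<le>
        real (j choose b) * (((t / \<sigma>)\<^sup>2 * \<sigma> ^ b) * \<sigma> ^ (j - b))"
      by (intro mult_left_mono) auto
    then show "\<bar>real (j choose b) * t ^ b * s ^ (j - b)\<bar> \<le>
        (t / \<sigma>)\<^sup>2 * (real (j choose b) * \<sigma> ^ b * \<sigma> ^ (j - b))"
      by (simp add: abs_mult mult_ac)
  qed
  also have "\<dots> = (t / \<sigma>)\<^sup>2 * (\<Sum>b\<in>{2..j}. real (j choose b) * \<sigma> ^ b * \<sigma> ^ (j - b))"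
    by (simp add: sum_distrib_left)
  also have "\<dots> \<le> (t / \<sigma>)\<^sup>2 * (\<Sum>b\<le>j. real (j choose b) * \<sigma> ^ b * \<sigma> ^ (j - b))"
    using assms by (intro mult_left_mono sum_mono2) auto
  also have "(\<Sum>b\<le>j. real (j choose b) * \<sigma> ^ b * \<sigma> ^ (j - b)) = (2 * \<sigma>) ^ j"
    using binomial_ring[of \<sigma> \<sigma> j] by simp
  finally show ?thesis .
qed

text \<open>The factor \<open>j\<close> is absorbed by \<open>2 ^ j\<close>; this is why the
  differentiated series is treated on a cube of half the size.\<close>

lemma power_deriv_bound:
  fixes s \<sigma> :: real
  assumes "\<bar>s\<bar> \<le> \<sigma>" "\<sigma> > 0"
  shows "\<bar>real j * s ^ (j - 1)\<bar> \<le> (2 * \<sigma>) ^ j / \<sigma>"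
proof (cases j)
  case (Suc n)
  have "real j * \<bar>s\<bar> ^ n \<le> 2 ^ j * \<sigma> ^ n"
    using assms of_nat_less_two_power[of j, where 'a = real] by (intro mult_mono power_mono) auto
  then show ?thesis using Suc assms(2) by (simp add: abs_mult power_abs power_mult_distrib)
qed (use assms in auto)

lemma monomial_at_split:
  "monomial_at k y = (y $ i) ^ k i * (\<Prod>l\<in>UNIV - {i}. (y $ l) ^ k l)"
  by (simp add: monomial_at_def prod.remove[of UNIV i])

text \<open>The second-order bound holds term by term with a summable majorant, so the difference
  quotient is within a multiple of \<open>\<bar>t\<bar>\<close> of the termwise derivative. This
  takes the place of an interchange of limits.\<close>

lemma power_series_at_pderiv:
  fixes g :: "real ^ 'd \<Rightarrow> real"
  assumes ps: "power_series_at g a r c" "r > 0"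
  obtains r' where "r' > 0" "power_series_at (pderiv_at i g) a r' (shift_coeff i c)"
    "\<And>x. x \<in> ball a r' \<Longrightarrow> ((\<lambda>t. g (x + t *\<^sub>R axis i 1)) has_real_derivative pderiv_at i g x) (at 0)"
proof -
  obtain \<rho> where \<rho>: "\<rho> > 0" "(\<lambda>k. \<bar>c k\<bar> * \<rho> ^ (\<Sum>i\<in>UNIV. k i)) summable_on UNIV"
    "\<And>y :: real ^ 'd. (\<And>i. \<bar>y $ i\<bar> \<le> \<rho>) \<Longrightarrow> a + y \<in> ball a r"
    using power_series_at_abs_summable[OF ps] by blast
  define \<sigma> where "\<sigma> = \<rho> / 2"
  have \<sigma>: "\<sigma> > 0" "2 * \<sigma> = \<rho>" using \<rho> by (auto simp: \<sigma>_def)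
  define S where "S = infsum (\<lambda>k. \<bar>c k\<bar> * \<rho> ^ (\<Sum>i\<in>UNIV. k i)) UNIV"
  let ?rest = "\<lambda>k y. \<Prod>l\<in>UNIV - {i}. (y $ l) ^ k l"
  define d where "d k y = c k * (real (k i) * (y $ i) ^ (k i - 1)) * ?rest k y" for k and y :: "real ^ 'd"
  have rest_le: "\<bar>?rest k y\<bar> * \<rho> ^ k i \<le> \<rho> ^ (\<Sum>i\<in>UNIV. k i)" if "\<And>l. \<bar>y $ l\<bar> \<le> \<rho>" for k y
  proof -
    have "\<bar>?rest k y\<bar> \<le> (\<Prod>l\<in>UNIV - {i}. \<rho> ^ k l)"
      unfolding abs_prod power_abs using that by (intro prod_mono) (auto intro: power_mono)
    then have "\<bar>?rest k y\<bar> * \<rho> ^ k i \<le> (\<Prod>l\<in>UNIV - {i}. \<rho> ^ k l) * \<rho> ^ k i"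
      using \<rho> by (intro mult_right_mono) auto
    then show ?thesis by (simp add: power_sum prod.remove[of UNIV i] mult.commute)
  qed
  have d_le: "\<bar>d k y\<bar> \<le> (\<bar>c k\<bar> * \<rho> ^ (\<Sum>i\<in>UNIV. k i)) / \<sigma>" if y: "\<And>l. \<bar>y $ l\<bar> \<le> \<sigma>" for k y
  proof -
    have "\<bar>d k y\<bar> = \<bar>c k\<bar> * (\<bar>?rest k y\<bar> * \<bar>real (k i) * (y $ i) ^ (k i - 1)\<bar>)"
      by (simp only: d_def abs_mult mult_ac)
    also have "\<dots> \<le> \<bar>c k\<bar> * (\<bar>?rest k y\<bar> * (\<rho> ^ k i / \<sigma>))"
      using power_deriv_bound[OF y[of i] \<sigma>(1), of "k i"] \<sigma>(2) by (intro mult_left_mono) auto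
    also have "\<dots> = \<bar>c k\<bar> * (\<bar>?rest k y\<bar> * \<rho> ^ k i) / \<sigma>" by simp
    also have "\<dots> \<le> \<bar>c k\<bar> * \<rho> ^ (\<Sum>i\<in>UNIV. k i) / \<sigma>"
    proof -
      have "\<bar>y $ l\<bar> \<le> \<rho>" for l using y[of l] \<sigma> by linarith
      then show ?thesis using rest_le[of y k] \<sigma> by (intro divide_right_mono mult_left_mono) auto
    qed
    finally show ?thesis .
  qed
  have d_sum: "(\<lambda>k. d k y) summable_on UNIV" if y: "\<And>l. \<bar>y $ l\<bar> \<le> \<sigma>" for y
  proof (subst summable_on_iff_abs_summable_on_real, rule Infinite_Sum.abs_summable_on_comparison_test')
    show "(\<lambda>k. (\<bar>c k\<bar> * \<rho> ^ (\<Sum>i\<in>UNIV. k i)) * (1 / \<sigma>)) summable_on UNIV"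
      by (rule summable_on_cmult_left[OF \<rho>(2)])
    show "norm (d k y) \<le> (\<bar>c k\<bar> * \<rho> ^ (\<Sum>i\<in>UNIV. k i)) * (1 / \<sigma>)" for k
      using d_le[OF y] by simp
  qed
  define D where "D y = infsum (\<lambda>k. d k y) UNIV" for y
  have g_sum: "((\<lambda>k. c k * monomial_at k y) has_sum g (a + y)) UNIV" if "\<And>l. \<bar>y $ l\<bar> \<le> \<rho>" for y
    using ps(1) \<rho>(3)[OF that] by (force simp: power_series_at_def)
  have taylor: "\<bar>g (a + y + t *\<^sub>R axis i 1) - g (a + y) - t * D y\<bar> \<le> (t / \<sigma>)\<^sup>2 * S"
    if y: "\<And>l. \<bar>y $ l\<bar> \<le> \<sigma>" and t: "\<bar>t\<bar> \<le> \<sigma>" for y t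
  proof -
    let ?y = "y + t *\<^sub>R axis i 1"
    have y\<rho>: "\<bar>y $ l\<bar> \<le> \<rho>" "\<bar>?y $ l\<bar> \<le> \<rho>" for l
      using y[of l] t \<sigma> by (auto simp: axis_def)
    have "((\<lambda>k. c k * monomial_at k ?y - c k * monomial_at k y - t * d k y) has_sum
        (g (a + ?y) - g (a + y) - t * D y)) UNIV"
      by (intro has_sum_diff_real has_sum_cmult_right g_sum y\<rho>)
        (simp add: D_def d_sum[OF y] has_sum_infsum)
    then have hs: "((\<lambda>k. c k * monomial_at k ?y - c k * monomial_at k y - t * d k y) has_sum
        (g (a + y + t *\<^sub>R axis i 1) - g (a + y) - t * D y)) UNIV" by (simp add: add.assoc)
    have bound: "norm (c k * monomial_at k ?y - c k * monomial_at k y - t * d k y) \<le>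
        (t / \<sigma>)\<^sup>2 * (\<bar>c k\<bar> * \<rho> ^ (\<Sum>i\<in>UNIV. k i))" for k
    proof -
      have "?rest k ?y = ?rest k y" by (intro prod.cong) (auto simp: axis_def)
      then have "c k * monomial_at k ?y - c k * monomial_at k y - t * d k y =
          c k * ((y $ i + t) ^ k i - (y $ i) ^ k i - t * (real (k i) * (y $ i) ^ (k i - 1))) * ?rest k y"
        by (simp add: monomial_at_split[of k _ i] d_def algebra_simps)
      then have "norm (c k * monomial_at k ?y - c k * monomial_at k y - t * d k y) =
          \<bar>c k\<bar> * (\<bar>?rest k y\<bar> * \<bar>(y $ i + t) ^ k i - (y $ i) ^ k i - t * (real (k i) * (y $ i) ^ (k i - 1))\<bar>)"
        by (simp only: real_norm_def abs_mult mult_ac)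
      also have "\<dots> \<le> \<bar>c k\<bar> * (\<bar>?rest k y\<bar> * ((t / \<sigma>)\<^sup>2 * \<rho> ^ k i))"
        using power_taylor_bound[OF y[of i] t \<sigma>(1), of "k i"] \<sigma>(2) by (intro mult_left_mono) auto
      also have "\<dots> = (t / \<sigma>)\<^sup>2 * (\<bar>c k\<bar> * (\<bar>?rest k y\<bar> * \<rho> ^ k i))" by (simp only: mult_ac)
      also have "\<dots> \<le> (t / \<sigma>)\<^sup>2 * (\<bar>c k\<bar> * \<rho> ^ (\<Sum>i\<in>UNIV. k i))"
        using rest_le[OF y\<rho>(1), of k] by (intro mult_left_mono) auto
      finally show ?thesis .
    qed
    have "((\<lambda>k. (t / \<sigma>)\<^sup>2 * (\<bar>c k\<bar> * \<rho> ^ (\<Sum>i\<in>UNIV. k i))) has_sum ((t / \<sigma>)\<^sup>2 * S)) UNIV"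
      unfolding S_def by (intro has_sum_cmult_right has_sum_infsum \<rho>(2))
    from norm_infsum_le[OF hs this bound] show ?thesis by simp
  qed
  have deriv: "((\<lambda>t. g (a + y + t *\<^sub>R axis i 1)) has_real_derivative D y) (at 0)"
    if y: "\<And>l. \<bar>y $ l\<bar> \<le> \<sigma>" for y
  proof -
    have "((\<lambda>t. (g (a + y + t *\<^sub>R axis i 1) - g (a + y)) / t - D y) \<longlongrightarrow> 0) (at 0)"
    proof (rule Lim_null_comparison)
      have "\<forall>\<^sub>F t in at 0. \<bar>t\<bar> < \<sigma> \<and> t \<noteq> (0::real)"
        unfolding eventually_at using \<sigma> by (intro exI[of _ \<sigma>]) (auto simp: dist_real_def)
      then show "\<forall>\<^sub>F t in at 0. norm ((g (a + y + t *\<^sub>R axis i 1) - g (a + y)) / t - D y) \<le> \<bar>t\<bar> * (S / \<sigma>\<^sup>2)"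
      proof eventually_elim
        case (elim t)
        have "norm ((g (a + y + t *\<^sub>R axis i 1) - g (a + y)) / t - D y) =
            \<bar>g (a + y + t *\<^sub>R axis i 1) - g (a + y) - t * D y\<bar> / \<bar>t\<bar>"
          using elim by (simp add: abs_divide[symmetric] diff_divide_distrib)
        also have "\<dots> \<le> ((t / \<sigma>)\<^sup>2 * S) / \<bar>t\<bar>"
          using elim by (intro divide_right_mono taylor y) auto
        also have "\<dots> = \<bar>t\<bar> * (S / \<sigma>\<^sup>2)"
          using elim by (simp add: power_divide power2_eq_square field_simps abs_if)
        finally show ?case .
      qed
      have "((\<lambda>t. \<bar>t\<bar> * (S / \<sigma>\<^sup>2)) \<longlongrightarrow> \<bar>0\<bar> * (S / \<sigma>\<^sup>2)) (at 0)" by (intro tendsto_intros)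
      then show "((\<lambda>t. \<bar>t\<bar> * (S / \<sigma>\<^sup>2)) \<longlongrightarrow> 0) (at 0)" by simp
    qed
    then have "((\<lambda>t. (g (a + y + t *\<^sub>R axis i 1) - g (a + y)) / t) \<longlongrightarrow> D y) (at 0)"
      by (simp add: LIM_zero_iff)
    then show ?thesis by (simp add: has_field_derivative_iff)
  qed
  have small: "\<bar>(x - a) $ l\<bar> \<le> \<sigma>" if "x \<in> ball a \<sigma>" for x l
    using component_le_norm_cart[of "x - a" l] that by (simp add: dist_norm norm_minus_commute)
  have deriv': "((\<lambda>t. g (x + t *\<^sub>R axis i 1)) has_real_derivative D (x - a)) (at 0)" if "x \<in> ball a \<sigma>" for x
    using deriv[of "x - a"] small[OF that] by simp
  then have pd: "pderiv_at i g x = D (x - a)" if "x \<in> ball a \<sigma>" for x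
    unfolding pderiv_at_def using that by (intro DERIV_imp_deriv)
  show thesis
  proof (rule that[of \<sigma>])
    show "((\<lambda>t. g (x + t *\<^sub>R axis i 1)) has_real_derivative pderiv_at i g x) (at 0)" if "x \<in> ball a \<sigma>" for x
      using deriv'[OF that] pd[OF that] by simp
    show "power_series_at (pderiv_at i g) a \<sigma> (shift_coeff i c)"
      unfolding power_series_at_def
    proof
      fix x assume x: "x \<in> ball a \<sigma>"
      let ?h = "\<lambda>k::'d \<Rightarrow> nat. k(i := Suc (k i))"
      have inj: "inj ?h"
      proof (rule injI, rule ext)
        fix k k' j assume "?h k = ?h k'"
        then show "k j = k' j" by (cases "j = i") (metis fun_upd_same nat.inject, metis fun_upd_other)
      qed
      have "((\<lambda>k. d k (x - a)) has_sum D (x - a)) UNIV"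
        unfolding D_def by (intro has_sum_infsum d_sum small[OF x])
      moreover have "d k (x - a) = 0" if "k \<notin> range ?h" for k
      proof -
        have "k i = 0"
        proof (rule ccontr)
          assume "k i \<noteq> 0"
          then have "k = ?h (k(i := k i - 1))" by auto
          then show False using that by blast
        qed
        then show ?thesis by (simp add: d_def)
      qed
      \<comment> \<open>Only multi-indices with \<open>k i > 0\<close> contribute, and these form
        the range of the injection \<open>?h\<close>, which permits reindexing.\<close>
      then have "((\<lambda>k. d k (x - a)) has_sum D (x - a)) UNIV \<longleftrightarrow>
          ((\<lambda>k. d k (x - a)) has_sum D (x - a)) (range ?h)"
        by (intro has_sum_cong_neutral) auto
      ultimately have "((\<lambda>k. d k (x - a)) has_sum D (x - a)) (range ?h)" by blast
      then have "((\<lambda>k. d (?h k) (x - a)) has_sum D (x - a)) UNIV"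
        by (subst (asm) has_sum_reindex[OF inj]) (simp add: o_def)
      moreover have "d (?h k) (x - a) = shift_coeff i c k * monomial_at k (x - a)" for k
      proof -
        have "(\<Prod>l\<in>UNIV - {i}. ((x - a) $ l) ^ ?h k l) = (\<Prod>l\<in>UNIV - {i}. ((x - a) $ l) ^ k l)"
          by (intro prod.cong) auto
        then show ?thesis
          by (simp only: d_def shift_coeff_def monomial_at_split[of k _ i] fun_upd_same diff_Suc_1 mult_ac)
      qed
      ultimately show "((\<lambda>k. shift_coeff i c k * monomial_at k (x - a)) has_sum pderiv_at i g x) UNIV"
        using pd[OF x] by simp
    qed
  qed (rule \<sigma>)
qed


text \<open>The indices in \<open>F\<close>, of degree at most one, give the value and the linear
  part. Every other monomial has degree at least two and is at most
  \<open>(norm y / \<rho>)\<^sup>2\<close> times the corresponding power in the majorant.\<close>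

lemma power_series_at_differentiable:
  fixes g :: "real ^ 'd \<Rightarrow> real"
  assumes ps: "power_series_at g a r c" "r > 0"
  shows "g differentiable (at a)" and power_series_at_center: "g a = c (\<lambda>_. 0)"
proof -
  obtain \<rho> where \<rho>: "\<rho> > 0" "(\<lambda>k. \<bar>c k\<bar> * \<rho> ^ (\<Sum>i\<in>UNIV. k i)) summable_on UNIV"
    "\<And>y :: real ^ 'd. (\<And>i. \<bar>y $ i\<bar> \<le> \<rho>) \<Longrightarrow> a + y \<in> ball a r"
    using power_series_at_abs_summable[OF ps] by blast
  define S where "S = infsum (\<lambda>k. \<bar>c k\<bar> * \<rho> ^ (\<Sum>i\<in>UNIV. k i)) UNIV"
  define u :: "'d \<Rightarrow> 'd \<Rightarrow> nat" where "u i j = (if j = i then 1 else 0)" for i j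
  define L where "L y = (\<Sum>i\<in>UNIV. c (u i) * y $ i)" for y
  have L: "bounded_linear L" unfolding L_def
    by (intro bounded_linear_sum bounded_linear_const_mult bounded_linear_vec_nth)
  define F where "F = insert (\<lambda>_. 0) (range u)"
  have u_inj: "inj u" unfolding u_def by (intro injI) (metis zero_neq_one)
  have u_nz: "(\<lambda>_. 0) \<notin> range u" unfolding u_def by (auto simp: fun_eq_iff) (metis zero_neq_one)
  have mono_u: "monomial_at (u i) y = y $ i" for i y
  proof -
    have "monomial_at (u i) y = (\<Prod>j\<in>UNIV. if j = i then y $ j else 1)"
      unfolding monomial_at_def u_def by (intro prod.cong) auto
    then show ?thesis by simp
  qed
  have F_sum: "(\<Sum>k\<in>F. c k * monomial_at k y) = c (\<lambda>_. 0) + L y" for y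
    unfolding F_def using u_nz
    by (simp add: sum.reindex[OF u_inj] mono_u L_def) (simp add: monomial_at_def)
  have deg: "(\<Sum>i\<in>UNIV. k i) \<ge> 2" if "k \<notin> F" for k
  proof (rule ccontr)
    assume "\<not> ?thesis"
    then consider "(\<Sum>i\<in>UNIV. k i) = 0" | "(\<Sum>i\<in>UNIV. k i) = 1" by linarith
    then show False
    proof cases
      case 1
      then have "k = (\<lambda>_. 0)" by (auto simp: fun_eq_iff)
      then show False using that by (simp add: F_def)
    next
      case 2
      then obtain i where "k i = 1" "\<forall>j. i \<noteq> j \<longrightarrow> k j = 0" using sum_eq_1_iff[of UNIV k] by auto
      then have "k = u i" by (auto simp: u_def fun_eq_iff)
      then show False using that by (simp add: F_def)
    qed
  qed
  have taylor: "\<bar>g (a + y) - c (\<lambda>_. 0) - L y\<bar> \<le> (norm y / \<rho>)\<^sup>2 * S" if y: "norm y \<le> \<rho>" for y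
  proof -
    have yi: "\<bar>y $ i\<bar> \<le> norm y" for i by (rule component_le_norm_cart)
    have "((\<lambda>k. c k * monomial_at k y) has_sum g (a + y)) UNIV"
    proof -
      have "a + y \<in> ball a r" using order.trans[OF yi y] by (rule \<rho>(3))
      then show ?thesis using ps(1) unfolding power_series_at_def by fastforce
    qed
    moreover have "((\<lambda>k. if k \<in> F then c k * monomial_at k y else 0) has_sum (c (\<lambda>_. 0) + L y)) UNIV"
      unfolding F_sum[symmetric] by (intro has_sum_finite_neutralI[of F]) (auto simp: F_def)
    ultimately have hs: "((\<lambda>k. c k * monomial_at k y - (if k \<in> F then c k * monomial_at k y else 0)) has_sum
        (g (a + y) - (c (\<lambda>_. 0) + L y))) UNIV" by (rule has_sum_diff_real)
    have bound: "norm (c k * monomial_at k y - (if k \<in> F then c k * monomial_at k y else 0)) \<le>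
        (norm y / \<rho>)\<^sup>2 * (\<bar>c k\<bar> * \<rho> ^ (\<Sum>i\<in>UNIV. k i))" for k
    proof (cases "k \<in> F")
      case False
      let ?n = "\<Sum>i\<in>UNIV. k i"
      have "\<bar>monomial_at k y\<bar> \<le> norm y ^ ?n" by (rule abs_monomial_at_le) (rule yi)
      also have "\<dots> = (norm y / \<rho>) ^ ?n * \<rho> ^ ?n"
        using \<rho>(1) by (simp add: power_divide)
      also have "(norm y / \<rho>) ^ ?n = (norm y / \<rho>) ^ (2 + (?n - 2))"
        using deg[OF False] by (intro arg_cong[of _ _ "(^) (norm y / \<rho>)"]) simp
      also have "\<dots> = (norm y / \<rho>)\<^sup>2 * (norm y / \<rho>) ^ (?n - 2)"
        by (rule power_add)
      finally have "\<bar>monomial_at k y\<bar> \<le> (norm y / \<rho>)\<^sup>2 * (norm y / \<rho>) ^ (?n - 2) * \<rho> ^ ?n" .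
      also have "\<dots> \<le> (norm y / \<rho>)\<^sup>2 * 1 * \<rho> ^ ?n"
        using \<rho>(1) y by (intro mult_right_mono mult_left_mono power_le_one) auto
      finally have "\<bar>monomial_at k y\<bar> \<le> (norm y / \<rho>)\<^sup>2 * \<rho> ^ ?n" by simp
      then have "\<bar>c k\<bar> * \<bar>monomial_at k y\<bar> \<le> \<bar>c k\<bar> * ((norm y / \<rho>)\<^sup>2 * \<rho> ^ ?n)"
        by (intro mult_left_mono) auto
      then show ?thesis using False by (simp add: abs_mult mult_ac)
    qed (use \<rho>(1) in simp)
    have "((\<lambda>k. (norm y / \<rho>)\<^sup>2 * (\<bar>c k\<bar> * \<rho> ^ (\<Sum>i\<in>UNIV. k i))) has_sum ((norm y / \<rho>)\<^sup>2 * S)) UNIV"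
      unfolding S_def by (intro has_sum_cmult_right has_sum_infsum \<rho>(2))
    from norm_infsum_le[OF hs this bound] show ?thesis by (simp add: diff_diff_add)
  qed
  show center: "g a = c (\<lambda>_. 0)" using taylor[of 0] \<rho>(1) by (simp add: L_def)
  have "(g has_derivative L) (at a)"
    unfolding has_derivative_iff_norm
  proof (rule conjI[OF L], rule Lim_null_comparison)
    have "\<forall>\<^sub>F y in at a. dist y a < \<rho> \<and> y \<noteq> a"
      unfolding eventually_at using \<rho>(1) by (intro exI[of _ \<rho>]) auto
    then show "\<forall>\<^sub>F y in at a. norm (norm (g y - g a - L (y - a)) / norm (y - a)) \<le> norm (y - a) * (S / \<rho>\<^sup>2)"
    proof eventually_elim
      case (elim y)
      then have "norm (g y - g a - L (y - a)) \<le> (norm (y - a) / \<rho>)\<^sup>2 * S"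
        using taylor[of "y - a"] by (simp add: dist_norm center)
      then have "norm (g y - g a - L (y - a)) / norm (y - a) \<le> (norm (y - a) / \<rho>)\<^sup>2 * S / norm (y - a)"
        by (intro divide_right_mono) auto
      also have "\<dots> = norm (y - a) * (S / \<rho>\<^sup>2)"
        using elim by (simp add: power_divide power2_eq_square)
      finally show ?case by simp
    qed
    have "((\<lambda>y. norm (y - a) * (S / \<rho>\<^sup>2)) \<longlongrightarrow> norm (a - a) * (S / \<rho>\<^sup>2)) (at a)"
      by (intro tendsto_intros)
    then show "((\<lambda>y. norm (y - a) * (S / \<rho>\<^sup>2)) \<longlongrightarrow> 0) (at a)" by simp
  qed
  then show "g differentiable (at a)" by (rule differentiableI)
qed

section \<open>Vanishing derivatives and null sets of zeros\<close>

text \<open>The head of the list is differentiated first, opposite to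
  \<open>iterated_partial\<close>, so that an induction can replace \<open>g\<close> by its
  derivative.\<close>

primrec iter_pderiv :: "'d::finite list \<Rightarrow> (real ^ 'd \<Rightarrow> real) \<Rightarrow> real ^ 'd \<Rightarrow> real" where
  "iter_pderiv [] g = g"
| "iter_pderiv (i # is) g = iter_pderiv is (pderiv_at i g)"

lemma iter_pderiv_snoc: "iter_pderiv (is @ [i]) g = pderiv_at i (iter_pderiv is g)"
  by (induction "is" arbitrary: g) auto

text \<open>Induction on the degree of \<open>k\<close>: differentiating in a direction with
  \<open>k i > 0\<close> turns the coefficient, up to a positive factor, into one of lower degree in
  the derivative series.\<close>

lemma power_series_coeff_eq_0:
  assumes "power_series_at g a r c" "r > 0" "\<And>is. iter_pderiv is g a = 0"
  shows "c k = 0"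
  using assms
proof (induction "\<Sum>i\<in>UNIV. k i" arbitrary: g c r k)
  case 0
  then have "k = (\<lambda>_. 0)" by (auto simp: fun_eq_iff)
  then show ?case using power_series_at_center[OF 0(2,3)] 0(4)[of "[]"] by simp
next
  case (Suc n)
  have "\<exists>i. k i > 0"
  proof (rule ccontr)
    assume "\<not> ?thesis"
    then have "(\<Sum>i\<in>UNIV. k i) = 0" by simp
    then show False using Suc(2) by simp
  qed
  then obtain i where i: "k i > 0" by blast
  define k' where "k' = k(i := k i - 1)"
  have "(\<Sum>j\<in>UNIV. k j) = k i + (\<Sum>j\<in>UNIV - {i}. k j)" by (rule sum.remove) auto
  moreover have "(\<Sum>j\<in>UNIV. k' j) = k' i + (\<Sum>j\<in>UNIV - {i}. k' j)" by (rule sum.remove) auto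
  moreover have "(\<Sum>j\<in>UNIV - {i}. k' j) = (\<Sum>j\<in>UNIV - {i}. k j)"
    by (intro sum.cong) (auto simp: k'_def)
  ultimately have n: "n = (\<Sum>j\<in>UNIV. k' j)" using Suc(2) i by (simp add: k'_def)
  obtain r' where r': "r' > 0" "power_series_at (pderiv_at i g) a r' (shift_coeff i c)"
    using power_series_at_pderiv[OF Suc(3,4), of i] by blast
  have "shift_coeff i c k' = 0"
    using Suc(5)[of "i # is" for "is"] by (intro Suc(1)[OF n r'(2,1)]) simp
  moreover have "k'(i := Suc (k' i)) = k" using i by (auto simp: k'_def)
  ultimately show ?case by (simp add: shift_coeff_def)
qed

text \<open>Up to a nonzero factor, every nonconstant coefficient belongs to the series of a first
  derivative, all of whose derivatives vanish at \<open>a\<close>. So only the constant term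
  remains, on the whole ball.\<close>

lemma power_series_locally_constant:
  assumes ps: "power_series_at g a r c" "r > 0" and z: "\<And>i is. iter_pderiv (i # is) g a = 0"
    and x: "x \<in> ball a r"
  shows "g x = g a"
proof -
  have "c k = 0" if k: "k \<noteq> (\<lambda>_. 0)" for k
  proof -
    obtain i where i: "k i > 0" using k by (auto simp: fun_eq_iff)
    obtain r' where r': "r' > 0" "power_series_at (pderiv_at i g) a r' (shift_coeff i c)"
      using power_series_at_pderiv[OF ps, of i] by blast
    have "shift_coeff i c (k(i := k i - 1)) = 0"
      using z[of i] by (intro power_series_coeff_eq_0[OF r'(2,1)]) simp
    then show ?thesis using i by (simp add: shift_coeff_def)
  qed
  then have "((\<lambda>k. c k * monomial_at k (x - a)) has_sum c (\<lambda>_. 0)) UNIV"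
    by (intro has_sum_finite_neutralI[of "{\<lambda>_. 0}"]) (auto simp: monomial_at_def)
  moreover have "((\<lambda>k. c k * monomial_at k (x - a)) has_sum g x) UNIV"
    using ps x by (simp add: power_series_at_def)
  ultimately show ?thesis using has_sum_unique power_series_at_center[OF ps] by fastforce
qed

lemma negligible_UNION_countable:
  fixes S :: "'i::countable \<Rightarrow> 'a::euclidean_space set"
  assumes "\<And>i. negligible (S i)"
  shows "negligible (\<Union>i. S i)"
proof -
  have "(\<Union>i. S i) = (\<Union>n::nat. S (from_nat n))" by (metis surj_from_nat image_image)
  then show ?thesis using assms by (simp add: negligible_Union_nat)
qed

text \<open>Near a point where a directional derivative does not vanish, the translates of the zero set
  in that direction are disjoint.\<close>

lemma negligible_zeros_with_nonzero_derivative: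
  fixes h :: "'a::euclidean_space \<Rightarrow> real"
  assumes U: "open U" and h: "continuous_on U h" and D: "continuous_on U D" and e: "norm e = 1"
    and deriv: "\<And>x. x \<in> U \<Longrightarrow> ((\<lambda>t. h (x + t *\<^sub>R e)) has_vector_derivative D x) (at 0)"
  shows "negligible {x\<in>U. h x = 0 \<and> D x \<noteq> 0}"
proof (subst locally_negligible_alt, rule ballI)
  fix x assume x: "x \<in> {x\<in>U. h x = 0 \<and> D x \<noteq> 0}"
  have "open {x\<in>U. D x \<noteq> 0}"
    using continuous_open_preimage[OF D U, of "- {0}"] by (simp add: vimage_def Int_def open_Compl)
  then obtain s where s: "s > 0" "ball x s \<subseteq> {x\<in>U. D x \<noteq> 0}"
    using x open_contains_ball by (metis (mono_tags, lifting) mem_Collect_eq)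
  define Z where "Z = {y\<in>ball x s. h y = 0}"
  have Zs: "Z \<subseteq> ball x s" by (auto simp: Z_def)
  have "closedin (top_of_set (ball x s)) Z" unfolding Z_def
    using continuous_closedin_preimage_constant[of "ball x s" h 0] continuous_on_subset[OF h] s by blast
  then have "Z \<in> sets lebesgue" by (rule lebesgue_closedin) simp
  moreover have "bounded Z" using Zs bounded_subset bounded_ball by blast
  ultimately have Z: "Z \<in> lmeasurable" by (rule bounded_set_imp_lmeasurable[rotated])
  \<comment> \<open>The shifts \<open>1 / Suc n\<close> are distinct and bounded, so infinitely many
    disjoint sets of equal measure fit into one ball.\<close>
  define T where "T n = (+) ((1 / real (Suc n)) *\<^sub>R e) ` Z" for n
  have T: "T n \<in> lmeasurable" "measure lebesgue (T n) = measure lebesgue Z" for n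
    unfolding T_def using Z by (auto simp: measurable_translation measure_translation)
  \<comment> \<open>Two zeros on a line in direction \<open>e\<close> would, by the mean value
    theorem, force a zero of \<open>D\<close> on the segment between them, which lies in the convex
    ball.\<close>
  have no: False if "y \<in> Z" "y' \<in> Z" "y = y' + t *\<^sub>R e" "t > 0" for y y' t
  proof -
    have inball: "y' + r *\<^sub>R e \<in> ball x s" if r: "0 \<le> r" "r \<le> t" for r
    proof -
      have "y' + r *\<^sub>R e = (1 - r / t) *\<^sub>R y' + (r / t) *\<^sub>R y"
        using \<open>t > 0\<close> by (simp add: \<open>y = _\<close> algebra_simps)
      moreover have "(1 - r / t) *\<^sub>R y' + (r / t) *\<^sub>R y \<in> ball x s"
        using that \<open>t > 0\<close> \<open>y \<in> Z\<close> \<open>y' \<in> Z\<close> Zs by (intro convexD[OF convex_ball]) auto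
      ultimately show ?thesis by simp
    qed
    obtain r where r: "0 < r" "r < t" "1 \<bullet> h (y' + t *\<^sub>R e) - 1 \<bullet> h y' = t * (1 \<bullet> D (y' + r *\<^sub>R e))"
      using directional_mvt[OF \<open>t > 0\<close>, of h y' e D 1] deriv inball s(2) by blast
    then have "t * D (y' + r *\<^sub>R e) = 0" using that by (simp add: Z_def)
    then show False using inball[of r] r s(2) \<open>t > 0\<close> by auto
  qed
  have disj: "T m \<inter> T n = {}" if "m < n" for m n
  proof (rule ccontr)
    assume "T m \<inter> T n \<noteq> {}"
    then obtain y y' where y: "y \<in> Z" "y' \<in> Z"
      "(1 / real (Suc m)) *\<^sub>R e + y' = (1 / real (Suc n)) *\<^sub>R e + y" by (auto simp: T_def)
    then have "y = y' + (1 / real (Suc m) - 1 / real (Suc n)) *\<^sub>R e" by (simp add: algebra_simps)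
    moreover have "1 / real (Suc m) - 1 / real (Suc n) > 0"
      using that by (simp add: frac_less2)
    ultimately show False using no y by blast
  qed
  have pw: "pairwise (\<lambda>i j. disjnt (T i) (T j)) {..<N}" for N
    unfolding pairwise_def disjnt_def using disj by (metis Int_commute linorder_neqE_nat)
  have sub: "(\<Union>n<N. T n) \<subseteq> ball x (s + 1)" for N
  proof
    fix z assume "z \<in> (\<Union>n<N. T n)"
    then obtain n y where z: "z = (1 / real (Suc n)) *\<^sub>R e + y" "y \<in> Z" by (auto simp: T_def)
    have "dist x y < s" using z Zs by auto
    moreover have "dist y z \<le> 1" using e by (simp add: z dist_norm)
    ultimately show "z \<in> ball x (s + 1)" using dist_triangle[of x z y] by simp
  qed
  have "real N * measure lebesgue Z \<le> measure lebesgue (ball x (s + 1))" for N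
  proof -
    have "measure lebesgue (\<Union>n\<in>{..<N}. T n) = (\<Sum>n<N. measure lebesgue (T n))"
      using T by (intro measure_UNION' pw) auto
    moreover have "measure lebesgue (\<Union>n<N. T n) \<le> measure lebesgue (ball x (s + 1))"
      using sub T by (intro measure_mono_fmeasurable) (auto simp: fmeasurableD)
    ultimately show ?thesis using T by simp
  qed
  then have "measure lebesgue Z \<le> 0"
    by (metis linorder_not_less reals_Archimedean3)
  then have "negligible Z" using Z by (simp add: negligible_iff_measure measure_le_0_iff)
  then show "\<exists>V. openin (top_of_set {x \<in> U. h x = 0 \<and> D x \<noteq> 0}) V \<and> x \<in> V \<and> negligible V"
  proof (intro exI[of _ "{x \<in> U. h x = 0 \<and> D x \<noteq> 0} \<inter> ball x s"] conjI)
    show "negligible ({x \<in> U. h x = 0 \<and> D x \<noteq> 0} \<inter> ball x s)"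
      using \<open>negligible Z\<close> by (rule negligible_subset) (auto simp: Z_def)
  qed (use x s in \<open>auto simp: openin_open_Int\<close>)
qed

definition analytic_fun :: "(real ^ 'd \<Rightarrow> real) \<Rightarrow> (real ^ 'd::finite) set \<Rightarrow> bool" where
  "analytic_fun g U \<longleftrightarrow> (\<forall>a\<in>U. \<exists>r>0. \<exists>c. power_series_at g a r c)"

lemma analytic_fun_differentiable: "analytic_fun g U \<Longrightarrow> x \<in> U \<Longrightarrow> g differentiable (at x)"
  unfolding analytic_fun_def using power_series_at_differentiable by blast

lemma analytic_fun_continuous: "analytic_fun g U \<Longrightarrow> continuous_on U g"
  by (intro continuous_at_imp_continuous_on ballI differentiable_imp_continuous_within
      analytic_fun_differentiable)

lemma analytic_fun_pderiv: "analytic_fun g U \<Longrightarrow> analytic_fun (pderiv_at i g) U"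
  unfolding analytic_fun_def using power_series_at_pderiv by metis

lemma analytic_fun_iter_pderiv: "analytic_fun g U \<Longrightarrow> analytic_fun (iter_pderiv is g) U"
  by (induction "is" arbitrary: g) (auto intro: analytic_fun_pderiv)

lemma analytic_fun_has_pderiv:
  assumes "analytic_fun g U" "x \<in> U"
  shows "((\<lambda>t. g (x + t *\<^sub>R axis i 1)) has_real_derivative pderiv_at i g x) (at 0)"
proof -
  obtain r c where "r > 0" "power_series_at g x r c" using assms unfolding analytic_fun_def by blast
  then show ?thesis using power_series_at_pderiv[of g x r c i] by (metis centre_in_ball)
qed

text \<open>Along a list of directions leading from \<open>g x = 0\<close> to a nonvanishing
  derivative there is a last derivative that vanishes, and the next one does not. This puts
  \<open>x\<close> into one of countably many null sets, indexed by a list and a direction.\<close>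

lemma negligible_zeros_of_finite_order:
  assumes "open U" "analytic_fun g U"
  shows "negligible {x\<in>U. g x = 0 \<and> (\<exists>is. iter_pderiv is g x \<noteq> 0)}"
proof -
  have "negligible {x\<in>U. iter_pderiv is g x = 0 \<and> pderiv_at i (iter_pderiv is g) x \<noteq> 0}" for "is" i
  proof (rule negligible_zeros_with_nonzero_derivative[OF assms(1)])
    show "((\<lambda>t. iter_pderiv is g (x + t *\<^sub>R axis i 1)) has_vector_derivative
        pderiv_at i (iter_pderiv is g) x) (at 0)" if "x \<in> U" for x
      using analytic_fun_has_pderiv[OF analytic_fun_iter_pderiv[OF assms(2)] that]
      by (simp add: has_real_derivative_iff_has_vector_derivative)
    show "continuous_on U (iter_pderiv is g)" "continuous_on U (pderiv_at i (iter_pderiv is g))"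
      using assms(2) by (intro analytic_fun_continuous analytic_fun_pderiv analytic_fun_iter_pderiv; assumption)+
  qed simp
  then have "negligible (\<Union>p. {x\<in>U. iter_pderiv (fst p) g x = 0 \<and> pderiv_at (snd p) (iter_pderiv (fst p) g) x \<noteq> 0})"
    by (intro negligible_UNION_countable) auto
  then show ?thesis
  proof (rule negligible_subset, safe)
    fix x "is" assume x: "x \<in> U" "g x = 0" and nz: "iter_pderiv is g x \<noteq> 0"
    have "\<exists>js i. iter_pderiv js g x = 0 \<and> pderiv_at i (iter_pderiv js g) x \<noteq> 0"
      using nz
    proof (induction "is" rule: rev_induct)
      case Nil
      then show ?case using x by simp
    next
      case (snoc i js)
      then show ?case by (cases "iter_pderiv js g x = 0") (auto simp: iter_pderiv_snoc)
    qed
    then show "x \<in> (\<Union>p. {x\<in>U. iter_pderiv (fst p) g x = 0 \<and> pderiv_at (snd p) (iter_pderiv (fst p) g) x \<noteq> 0})"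
      using x by auto
  qed
qed

text \<open>If all derivatives of positive order vanish at a point, \<open>g\<close> is constant
  nearby. At every other critical point some first derivative has a zero of finite order.\<close>

lemma negligible_critical_points:
  assumes "open U" "analytic_fun g U"
  shows "negligible {x\<in>U. (\<forall>i. pderiv_at i g x = 0) \<and> \<not> (\<exists>s>0. \<forall>y\<in>ball x s. g y = g x)}"
proof -
  have "negligible (\<Union>i. {x\<in>U. pderiv_at i g x = 0 \<and> (\<exists>is. iter_pderiv is (pderiv_at i g) x \<noteq> 0)})"
    using assms by (intro negligible_UNION_countable negligible_zeros_of_finite_order analytic_fun_pderiv) auto
  then show ?thesis
  proof (rule negligible_subset, safe)
    fix x assume x: "x \<in> U" "\<forall>i. pderiv_at i g x = 0" "\<not> (\<exists>s>0. \<forall>y\<in>ball x s. g y = g x)"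
    obtain r c where r: "r > 0" "power_series_at g x r c" using assms(2) x(1) unfolding analytic_fun_def by blast
    have "\<exists>i is. iter_pderiv (i # is) g x \<noteq> 0"
      using power_series_locally_constant[OF r(2,1)] x(3) r(1) by blast
    then show "x \<in> (\<Union>i. {x\<in>U. pderiv_at i g x = 0 \<and> (\<exists>is. iter_pderiv is (pderiv_at i g) x \<noteq> 0)})"
      using x by auto
  qed
qed

section \<open>Charts of analytic submanifolds\<close>

lemma real_analytic_on_inner:
  assumes "real_analytic_on f U"
  shows "analytic_fun (\<lambda>x. v \<bullet> f x) U"
  unfolding analytic_fun_def
proof
  fix a assume "a \<in> U"
  then obtain r c where r: "r > 0" "\<And>x. x \<in> ball a r \<Longrightarrow>
      ((\<lambda>k. (\<Prod>i\<in>UNIV. (x $ i - a $ i) ^ k i) *\<^sub>R c k) has_sum f x) UNIV"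
    using assms unfolding real_analytic_on_def by meson
  have "power_series_at (\<lambda>x. v \<bullet> f x) a r (\<lambda>k. v \<bullet> c k)"
    unfolding power_series_at_def
  proof
    fix x assume "x \<in> ball a r"
    from has_sum_bounded_linear[OF bounded_linear_inner_right[of v] r(2)[OF this]]
    show "((\<lambda>k. (v \<bullet> c k) * monomial_at k (x - a)) has_sum v \<bullet> f x) UNIV"
      by (simp add: monomial_at_def o_def mult.commute)
  qed
  then show "\<exists>r>0. \<exists>c. power_series_at (\<lambda>x. v \<bullet> f x) a r c" using r(1) by blast
qed

lemma continuous_on_det_entries:
  fixes A :: "'a::topological_space \<Rightarrow> real ^ 'n ^ 'n"
  assumes "\<And>i j. continuous_on S (\<lambda>x. A x $ i $ j)"
  shows "continuous_on S (\<lambda>x. det (A x))"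
  unfolding det_def
  by (intro continuous_on_sum continuous_on_mult continuous_on_const continuous_on_prod assms)

lemma local_param_image_subset: "local_param M U f \<Longrightarrow> f ` U \<subseteq> M"
  by (metis local_param_def openin_imp_subset)

context
  fixes f :: "real ^ 'd \<Rightarrow> real ^ 'm" and U :: "(real ^ 'd) set"
  assumes f: "real_analytic_on f U"
begin

lemma real_analytic_differentiable:
  assumes "x \<in> U"
  shows "f differentiable (at x)"
proof -
  have "(\<lambda>x. f x \<bullet> b) differentiable (at x)" for b
    using analytic_fun_differentiable[OF real_analytic_on_inner[OF f, of b] assms]
    by (simp add: inner_commute)
  then show ?thesis by (subst differentiable_componentwise_within) blast
qed

lemma real_analytic_continuous_on: "continuous_on U f"
  by (intro continuous_at_imp_continuous_on ballI differentiable_imp_continuous_within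
      real_analytic_differentiable)

lemma real_analytic_partial_deriv:
  assumes "x \<in> U"
  shows "((\<lambda>t. f (x + t *\<^sub>R axis i 1)) has_vector_derivative partial_deriv i f x) (at 0)"
    and partial_deriv_eq_frechet: "partial_deriv i f x = frechet_derivative f (at x) (axis i 1)"
    and inner_partial_deriv: "v \<bullet> partial_deriv i f x = pderiv_at i (\<lambda>x. v \<bullet> f x) x"
proof -
  let ?F = "frechet_derivative f (at x)"
  have "(f has_derivative ?F) (at (x + 0 *\<^sub>R axis i 1))"
    using real_analytic_differentiable[OF assms] by (simp add: frechet_derivative_works)
  moreover have "((\<lambda>t. x + t *\<^sub>R axis i 1) has_derivative (\<lambda>t. t *\<^sub>R axis i 1)) (at 0)"
    by (auto intro!: derivative_eq_intros)
  ultimately have "((\<lambda>t. f (x + t *\<^sub>R axis i 1)) has_derivative (\<lambda>t. ?F (t *\<^sub>R axis i 1))) (at 0)"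
    by (rule has_derivative_compose[rotated])
  then have vd: "((\<lambda>t. f (x + t *\<^sub>R axis i 1)) has_vector_derivative ?F (axis i 1)) (at 0)"
    using linear_frechet_derivative[OF real_analytic_differentiable[OF assms]]
    by (simp add: has_vector_derivative_def linear_cmul)
  then show eq: "partial_deriv i f x = ?F (axis i 1)"
    unfolding partial_deriv_def by (rule vector_derivative_at)
  with vd show vd': "((\<lambda>t. f (x + t *\<^sub>R axis i 1)) has_vector_derivative partial_deriv i f x) (at 0)"
    by simp
  have "((\<lambda>t. v \<bullet> f (x + t *\<^sub>R axis i 1)) has_vector_derivative v \<bullet> partial_deriv i f x) (at 0)"
    using bounded_linear.has_vector_derivative[OF bounded_linear_inner_right vd'] .
  then have "((\<lambda>t. v \<bullet> f (x + t *\<^sub>R axis i 1)) has_real_derivative v \<bullet> partial_deriv i f x) (at 0)"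
    by (simp add: has_real_derivative_iff_has_vector_derivative)
  then show "v \<bullet> partial_deriv i f x = pderiv_at i (\<lambda>x. v \<bullet> f x) x"
    unfolding pderiv_at_def by (simp add: DERIV_imp_deriv)
qed

lemma continuous_on_inner_partial_deriv: "continuous_on U (\<lambda>x. v \<bullet> partial_deriv i f x)"
  using analytic_fun_continuous[OF analytic_fun_pderiv[OF real_analytic_on_inner[OF f, of v], of i]]
  by (rule continuous_on_eq) (simp add: inner_partial_deriv)

lemma continuous_on_partial_deriv: "continuous_on U (partial_deriv i f)"
  using continuous_on_inner_partial_deriv
  by (subst continuous_on_componentwise) (simp add: inner_commute)

lemma continuous_on_volume_density: "continuous_on U (volume_density f)"
proof -
  have entry: "continuous_on U (\<lambda>x. matrix (frechet_derivative f (at x)) $ k $ i)" for k i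
    using continuous_on_inner_partial_deriv[of "axis k 1" i]
    by (rule continuous_on_eq) (simp add: partial_deriv_eq_frechet matrix_def inner_axis')
  show ?thesis
    unfolding volume_density_def Let_def
  proof (intro continuous_on_real_sqrt continuous_on_det_entries)
    fix i j
    show "continuous_on U (\<lambda>x. (transpose (matrix (frechet_derivative f (at x))) **
        matrix (frechet_derivative f (at x))) $ i $ j)"
      unfolding matrix_matrix_mult_def transpose_def vec_lambda_beta
      by (intro continuous_on_sum continuous_on_mult entry)
  qed
qed

end

section \<open>Volume density and null sets in charts\<close>

text \<open>The segment from the identity to the Gram matrix consists of positive definite, hence
  invertible, matrices; at the end \<open>t = 1\<close> this is injectivity of \<open>J\<close>. So
  the determinant cannot reach 0 on the way.\<close>

lemma det_gram_pos:
  fixes J :: "real ^ 'd ^ 'm"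
  assumes "inj ((*v) J)"
  shows "det (transpose J ** J) > 0"
proof (rule ccontr)
  assume neg: "\<not> ?thesis"
  define A where "A t = (1 - t) *\<^sub>R mat 1 + t *\<^sub>R (transpose J ** J)" for t :: real
  have "continuous_on {0..1} (\<lambda>t. det (A t))"
    unfolding A_def by (intro continuous_on_det_entries continuous_intros)
  moreover have "det (A 1) \<le> 0" "0 \<le> det (A 0)" using neg by (simp_all add: A_def)
  ultimately obtain t where t: "0 \<le> t" "t \<le> 1" "det (A t) = 0"
    using IVT2'[of "\<lambda>t. det (A t)" 1 0 0] by auto
  then have "\<not> invertible (A t)" by (simp add: invertible_det_nz)
  then obtain x where x: "x \<noteq> 0" "A t *v x = 0"
    using matrix_left_invertible_ker[of "A t"] by (auto simp: invertible_left_inverse)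
  have "x \<bullet> (A t *v x) = (1 - t) * (x \<bullet> x) + t * ((J *v x) \<bullet> (J *v x))"
  proof -
    have "A t *v x = (1 - t) *\<^sub>R x + t *\<^sub>R (transpose J *v (J *v x))"
      by (simp add: A_def matrix_vector_mult_add_rdistrib scaleR_matrix_vector_assoc[symmetric]
          matrix_vector_mul_assoc)
    then show ?thesis
      by (simp add: inner_add_right dot_lmul_matrix[symmetric] inner_commute transpose_matrix_vector)
  qed
  then have sum0: "(1 - t) * (x \<bullet> x) + t * ((J *v x) \<bullet> (J *v x)) = 0" using x by simp
  have Jx: "J *v x \<noteq> 0" using assms x(1) by (metis injD matrix_vector_mult_0_right)
  have "x \<bullet> x > 0" "(J *v x) \<bullet> (J *v x) > 0" using x Jx by simp_all
  then have "(1 - t) * (x \<bullet> x) + t * ((J *v x) \<bullet> (J *v x)) > 0"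
    using t by (cases "t = 1") (auto intro!: add_pos_nonneg mult_pos_pos mult_nonneg_nonneg)
  then show False using sum0 by simp
qed

lemma volume_density_pos:
  assumes "local_param M U f" "x \<in> U"
  shows "volume_density f x > 0"
proof -
  have f: "real_analytic_on f U" and inj: "inj (frechet_derivative f (at x))"
    using assms by (auto simp: local_param_def)
  have "(*v) (matrix (frechet_derivative f (at x))) = frechet_derivative f (at x)"
    using linear_frechet_derivative[OF real_analytic_differentiable[OF f assms(2)]]
    by (intro ext) (simp add: matrix_works)
  then show ?thesis
    unfolding volume_density_def Let_def using inj by (simp add: det_gram_pos)
qed

text \<open>A single chart piece is a lower bound for the supremum defining
  \<open>manifold_volume\<close>, and a positive density with integral 0 forces a null
  domain.\<close>

lemma negligible_chart_preimage:
  assumes "zero_measure_on TYPE('d::finite) M A" and chart: "local_param M U (f :: real ^ 'd \<Rightarrow> real ^ 'm)"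
  shows "negligible (U \<inter> f -` A)"
proof -
  note fM = local_param_image_subset[OF chart]
  define B where "B = U \<inter> f -` (M \<inter> A)"
  have B_eq: "U \<inter> f -` A = B" using fM by (auto simp: B_def)
  have B: "B \<in> sets lebesgue" and vol: "manifold_volume TYPE('d) M (M \<inter> A) = 0"
    using assms unfolding zero_measure_on_def manifold_measurable_def B_def by auto
  have "(\<integral>\<^sup>+x\<in>B. ennreal (volume_density f x) \<partial>lebesgue) \<le> manifold_volume TYPE('d) M (M \<inter> A)"
    unfolding manifold_volume_def
  proof (rule Sup_upper, clarify, intro exI conjI)
    show "(\<integral>\<^sup>+x\<in>B. ennreal (volume_density f x) \<partial>lebesgue) =
        (\<Sum>i<(1::nat). \<integral>\<^sup>+x\<in>B. ennreal (volume_density f x) \<partial>lebesgue)" by simp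
    show "\<forall>i<(1::nat). local_param M U f \<and> B \<in> sets lebesgue \<and> B \<subseteq> U \<and> f ` B \<subseteq> M \<inter> A"
      using chart B by (auto simp: B_def)
    show "disjoint_family_on (\<lambda>i. f ` B) {..<(1::nat)}" by (auto simp: disjoint_family_on_def)
  qed
  then have int0: "(\<integral>\<^sup>+x\<in>B. ennreal (volume_density f x) \<partial>lebesgue) = 0" using vol by simp
  have U: "open U" "real_analytic_on f U" using chart by (auto simp: local_param_def)
  have "(\<lambda>x. indicator U x *\<^sub>R volume_density f x) \<in> borel_measurable borel"
    using U continuous_on_volume_density by (intro borel_measurable_continuous_on_indicator) auto
  then have "(\<lambda>x. indicator U x *\<^sub>R volume_density f x) \<in> borel_measurable lebesgue"
    by (intro measurable_completion) simp
  then have "(\<lambda>x. ennreal (indicator U x *\<^sub>R volume_density f x) * indicator B x) \<in> borel_measurable lebesgue"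
    using B by measurable
  moreover have "ennreal (indicator U x *\<^sub>R volume_density f x) * indicator B x =
      ennreal (volume_density f x) * indicator B x" for x
    by (auto simp: indicator_def B_def)
  ultimately have "(\<lambda>x. ennreal (volume_density f x) * indicator B x) \<in> borel_measurable lebesgue" by simp
  then have "AE x in lebesgue. ennreal (volume_density f x) * indicator B x = 0"
    using int0 by (simp add: nn_integral_0_iff_AE)
  then have "AE x in lebesgue. x \<notin> B"
  proof eventually_elim
    case (elim x)
    show ?case
    proof
      assume "x \<in> B"
      then show False using elim volume_density_pos[OF chart, of x] by (auto simp: B_def)
    qed
  qed
  then show ?thesis unfolding B_eq negligible_iff_null_sets
    using B by (subst (asm) AE_iff_null_sets[symmetric]) auto
qed

text \<open>Converse to \<open>negligible_chart_preimage\<close>: every admissible piece is null in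
  its own chart, so all sums in the supremum vanish. The two lemmas replace the measure on the
  manifold by null sets in charts.\<close>

lemma zero_measure_onI:
  assumes neg: "\<And>U (f :: real ^ 'd::finite \<Rightarrow> real ^ 'm). local_param M U f \<Longrightarrow> negligible (U \<inter> f -` A)"
  shows "zero_measure_on TYPE('d) M A"
  unfolding zero_measure_on_def
proof
  show "manifold_measurable TYPE('d) M (M \<inter> A)"
    unfolding manifold_measurable_def
  proof (intro conjI allI impI)
    fix U and f :: "real ^ 'd \<Rightarrow> real ^ 'm" assume "local_param M U f"
    then have "negligible (U \<inter> f -` (M \<inter> A))"
      by (rule negligible_subset[OF neg]) auto
    then show "U \<inter> f -` (M \<inter> A) \<in> sets lebesgue" by (rule negligible_imp_sets)
  qed simp
  have "manifold_volume TYPE('d) M (M \<inter> A) \<le> 0"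
    unfolding manifold_volume_def
  proof (rule Sup_least, clarify)
    fix k :: nat and U :: "nat \<Rightarrow> (real ^ 'd) set" and f :: "nat \<Rightarrow> real ^ 'd \<Rightarrow> real ^ 'm" and B
    assume *: "\<forall>i<k. local_param M (U i) (f i) \<and> B i \<in> sets lebesgue \<and> B i \<subseteq> U i \<and> f i ` B i \<subseteq> M \<inter> A"
    have "(\<integral>\<^sup>+x\<in>B i. ennreal (volume_density (f i) x) \<partial>lebesgue) = 0" if "i < k" for i
    proof (rule nn_integral_null_set)
      have "negligible (U i \<inter> f i -` A)" using * that by (intro neg) auto
      moreover have "B i \<subseteq> U i \<inter> f i -` A" using * that by blast
      ultimately show "B i \<in> null_sets lebesgue" using negligible_subset negligible_iff_null_sets by blast
    qed
    then show "(\<Sum>i<k. \<integral>\<^sup>+x\<in>B i. ennreal (volume_density (f i) x) \<partial>lebesgue) \<le> 0" by simp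
  qed
  then show "manifold_volume TYPE('d) M (M \<inter> A) = 0" by simp
qed

section \<open>Nondegeneracy excludes local constancy\<close>

lemma iterated_partial_snoc: "iterated_partial (is @ [i]) f = iterated_partial is (partial_deriv i f)"
  by (induction "is") auto

text \<open>The innermost derivative is peeled off: it exists by \<open>C_on\<close>, and
  \<open>v \<bullet> partial_deriv i f\<close> vanishes on the whole open set \<open>V\<close>, so
  the induction continues with the constant 0.\<close>

lemma inner_iterated_partial_eq_0:
  assumes V: "open V" "V \<subseteq> U" and "C_on k f U" and "\<And>x. x \<in> V \<Longrightarrow> v \<bullet> f x = c"
    and "is \<noteq> []" "length is \<le> k" "x \<in> V"
  shows "v \<bullet> iterated_partial is f x = 0"
  using assms(3-)
proof (induction "is" arbitrary: f k c x rule: rev_induct)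
  case (snoc i js)
  then obtain l where k: "k = Suc l" by (cases k) auto
  have zero: "v \<bullet> partial_deriv i f y = 0" if y: "y \<in> V" for y
  proof -
    have "(\<lambda>t. f (y + t *\<^sub>R axis i 1)) differentiable (at (0::real))"
      using snoc.prems(1) y V(2) by (auto simp: k)
    then have "((\<lambda>t. f (y + t *\<^sub>R axis i 1)) has_vector_derivative partial_deriv i f y) (at 0)"
      unfolding partial_deriv_def by (simp add: vector_derivative_works)
    from bounded_linear.has_vector_derivative[OF bounded_linear_inner_right this]
    have d1: "((\<lambda>t. v \<bullet> f (y + t *\<^sub>R axis i 1)) has_vector_derivative v \<bullet> partial_deriv i f y) (at 0)" .
    have "((\<lambda>t. y + t *\<^sub>R axis i 1) \<longlongrightarrow> y + 0 *\<^sub>R axis i 1) (nhds (0::real))"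
      by (intro tendsto_intros filterlim_ident)
    then have "\<forall>\<^sub>F t in nhds 0. y + t *\<^sub>R axis i 1 \<in> V"
      using V(1) y by (auto dest: topological_tendstoD)
    then have ev: "\<forall>\<^sub>F t in nhds 0. v \<bullet> f (y + t *\<^sub>R axis i 1) = c"
      by eventually_elim (rule snoc.prems(2))
    have "((\<lambda>t. v \<bullet> f (y + t *\<^sub>R axis i 1)) has_vector_derivative v \<bullet> partial_deriv i f y) (at 0 within UNIV) =
        ((\<lambda>t. c) has_vector_derivative v \<bullet> partial_deriv i f y) (at 0 within UNIV)"
      by (rule has_vector_derivative_cong_ev)
        (use ev eventually_nhds_x_imp_x[OF ev] in \<open>auto elim: eventually_mono\<close>)
    then have "((\<lambda>t. c) has_vector_derivative v \<bullet> partial_deriv i f y) (at 0)" using d1 by simp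
    then show ?thesis using vector_derivative_unique_at[OF _ has_vector_derivative_const] by blast
  qed
  show ?case
  proof (cases "js = []")
    case True
    then show ?thesis using zero snoc.prems(5) by simp
  next
    case False
    have "C_on l (partial_deriv i f) U" using snoc.prems(1) by (simp add: k)
    from snoc.IH[OF this zero False] show ?thesis
      using snoc.prems by (simp add: iterated_partial_snoc k)
  qed
qed simp

text \<open>Nondegeneracy is witnessed by some chart \<open>f0\<close>, possibly different from
  \<open>f\<close>. The image of a ball under \<open>f\<close> is open in \<open>M\<close>, so
  constancy of \<open>v \<bullet> f\<close> carries over to \<open>v \<bullet> f0\<close> near
  \<open>x0\<close>. The derivatives of \<open>f0\<close> there are then orthogonal to
  \<open>v\<close>, against the spanning condition.\<close>

lemma nondegenerate_not_locally_constant: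
  fixes f :: "real ^ 'd::finite \<Rightarrow> real ^ 'm"
  assumes nd: "nondegenerate_at TYPE('d) M (f x)" and chart: "local_param M U f" and x: "x \<in> U"
    and v: "v \<noteq> 0" and s: "s > 0" and const: "\<And>y. y \<in> ball x s \<Longrightarrow> v \<bullet> f y = v \<bullet> f x"
  shows False
proof -
  obtain U0 and f0 :: "real ^ 'd \<Rightarrow> real ^ 'm" and x0 k where
    chart0: "local_param M U0 f0" and x0: "x0 \<in> U0" "f0 x0 = f x" and k: "C_on k f0 U0"
    and span: "span {iterated_partial is f0 x0 | is. 1 \<le> length is \<and> length is \<le> k} = UNIV"
    using nd unfolding nondegenerate_at_def by blast
  obtain g where hom: "homeomorphism U (f ` U) f g" and opM: "openin (top_of_set M) (f ` U)" and "open U"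
    using chart by (auto simp: local_param_def)
  have "openin (top_of_set U) (U \<inter> ball x s)" by (simp add: openin_open_Int)
  then have "openin (top_of_set (f ` U)) (f ` (U \<inter> ball x s))"
    using homeomorphism_imp_open_map[OF hom] by blast
  then have W: "openin (top_of_set M) (f ` (U \<inter> ball x s))"
    using opM openin_trans by blast
  have f0: "f0 ` U0 \<subseteq> M" "open U0" "continuous_on U0 f0"
    using local_param_image_subset[OF chart0] chart0 real_analytic_continuous_on
    by (auto simp: local_param_def)
  define V where "V = U0 \<inter> f0 -` (f ` (U \<inter> ball x s))"
  have "openin (top_of_set U0) V"
    unfolding V_def using continuous_openin_preimage[OF f0(3) _ W] f0(1) by blast
  then have V: "open V" using f0(2) openin_open_trans open_openin by (metis openin_open_eq)
  have x0V: "x0 \<in> V" unfolding V_def using x0 x s by force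
  have vconst: "v \<bullet> f0 y = v \<bullet> f x" if y: "y \<in> V" for y
  proof -
    obtain z where "z \<in> ball x s" "f0 y = f z" using y by (auto simp: V_def)
    then show ?thesis using const by simp
  qed
  have "v \<bullet> w = 0" if "w \<in> span {iterated_partial is f0 x0 | is. 1 \<le> length is \<and> length is \<le> k}" for w
    using that
  proof (induction rule: span_induct)
    case base
    show ?case by (auto simp: subspace_def inner_add_right)
  next
    case (step w)
    then obtain js where js: "w = iterated_partial js f0 x0" "1 \<le> length js" "length js \<le> k" by blast
    then have "js \<noteq> []" by auto
    then show ?case unfolding js
      using inner_iterated_partial_eq_0[OF V _ k vconst _ js(3) x0V] by (auto simp: V_def)
  qed
  then have "v \<bullet> v = 0" using span by blast
  then show False using v by simp
qed

section \<open>Almost every point of a nondegenerate chart is approximable\<close>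

text \<open>A critical point of \<open>v \<bullet> f\<close> is either degenerate, hence in a null
  set by \<open>nd\<close>, or a point where \<open>v \<bullet> f\<close> is not locally constant,
  hence in a null set by analyticity.\<close>

lemma chart_critical_points_negligible:
  fixes f :: "real ^ 'd::finite \<Rightarrow> real ^ 'm"
  assumes nd: "nondegenerate TYPE('d) M" and chart: "local_param M U f" and v: "v \<noteq> 0"
  shows "negligible {x\<in>U. \<forall>i. v \<bullet> partial_deriv i f x = 0}"
proof -
  let ?g = "\<lambda>x. v \<bullet> f x"
  let ?N = "U \<inter> f -` (M - {y. nondegenerate_at TYPE('d) M y})"
  have U: "open U" "real_analytic_on f U" using chart by (auto simp: local_param_def)
  have "negligible ?N"
    using nd chart unfolding nondegenerate_def full_measure_on_def by (rule negligible_chart_preimage)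
  moreover have "negligible {x\<in>U. (\<forall>i. pderiv_at i ?g x = 0) \<and> \<not> (\<exists>s>0. \<forall>y\<in>ball x s. ?g y = ?g x)}"
    using U by (intro negligible_critical_points real_analytic_on_inner)
  ultimately have "negligible (?N \<union> {x\<in>U. (\<forall>i. pderiv_at i ?g x = 0) \<and> \<not> (\<exists>s>0. \<forall>y\<in>ball x s. ?g y = ?g x)})"
    by (rule negligible_Un)
  then show ?thesis
  proof (rule negligible_subset, intro subsetI)
    fix x assume x: "x \<in> {x\<in>U. \<forall>i. v \<bullet> partial_deriv i f x = 0}"
    have "\<not> (\<exists>s>0. \<forall>y\<in>ball x s. ?g y = ?g x)" if "x \<notin> ?N"
    proof
      assume "\<exists>s>0. \<forall>y\<in>ball x s. ?g y = ?g x"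
      moreover have "nondegenerate_at TYPE('d) M (f x)"
        using that x local_param_image_subset[OF chart] by auto
      ultimately show False
        using nondegenerate_not_locally_constant[OF _ chart _ v] x by blast
    qed
    then show "x \<in> ?N \<union> {x\<in>U. (\<forall>i. pderiv_at i ?g x = 0) \<and> \<not> (\<exists>s>0. \<forall>y\<in>ball x s. ?g y = ?g x)}"
      using x inner_partial_deriv[where x = x and v = v, OF U(2)] by auto
  qed
qed

lemma chart_fourier_decay:
  fixes f :: "real ^ 'd::finite \<Rightarrow> real ^ 'm"
  assumes nd: "nondegenerate TYPE('d) M" and chart: "local_param M U f"
    and Z: "Z \<in> sets borel" "bounded Z" "Z \<subseteq> U" and \<tau>: "\<tau> > 0"
  obtains R :: nat where
    "\<And>a. norm a > real R \<Longrightarrow> norm (LINT x:Z|lborel. cis (2 * pi * (a \<bullet> f x))) \<le> \<tau>"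
proof -
  have U: "open U" "real_analytic_on f U" using chart by (auto simp: local_param_def)
  \<comment> \<open>Translates the \<open>Basis\<close> vectors of the oscillatory estimates into
    coordinate indices.\<close>
  define idx where "idx b = (SOME i. b = axis i (1::real))" for b :: "real ^ 'd"
  have idx: "axis (idx b) 1 = b" if b: "b \<in> Basis" for b :: "real ^ 'd"
  proof -
    have "\<exists>i. b = axis i 1" using b by (auto simp: Basis_vec_def)
    then show ?thesis unfolding idx_def by (metis (mono_tags, lifting) someI_ex)
  qed
  have idx_axis: "idx (axis i 1) = i" for i :: 'd
    unfolding idx_def by (auto simp: axis_eq_axis)
  have ax: "axis i 1 \<in> (Basis :: (real ^ 'd) set)" for i by (auto simp: Basis_vec_def)
  have crit: "negligible {x\<in>U. \<forall>b\<in>Basis. v \<bullet> partial_deriv (idx b) f x = 0}" if "v \<noteq> 0" for v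
    using chart_critical_points_negligible[OF nd chart that]
  proof (rule negligible_subset, safe)
    fix x i assume "\<forall>b\<in>Basis. v \<bullet> partial_deriv (idx b) f x = 0"
    then show "v \<bullet> partial_deriv i f x = 0" using ax[of i] idx_axis[of i] by metis
  qed
  have deriv: "((\<lambda>t. f (x + t *\<^sub>R b)) has_vector_derivative partial_deriv (idx b) f x) (at 0)"
    if "b \<in> Basis" "x \<in> U" for b x
    using real_analytic_partial_deriv[where i = "idx b", OF U(2) that(2)] idx[OF that(1)] by simp
  show thesis
    by (rule oscillatory_integral_uniform_decay[OF U(1) real_analytic_continuous_on[OF U(2)]
        continuous_on_partial_deriv[OF U(2)] deriv crit Z \<tau>]) (use that in auto)
qed

lemma int_inner_eq_inner: "int_inner a y = (\<chi> i. of_int (a i)) \<bullet> y"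
  by (simp add: int_inner_def inner_vec_def)

lemma open_approximable_at: "open {y. approximable_at \<alpha> c Q y}"
proof -
  have "{y. approximable_at \<alpha> c Q y} = (\<Union>p\<in>int_vectors. \<Union>q\<in>int_vectors \<inter> {q. norm q \<le> Q}.
      {y. norm (\<alpha> *v q + y + p) < c * Q powr (- (real CARD('b) / real CARD('a)))})"
    for \<alpha> :: "real ^ 'b ^ 'a"
    by (auto simp: approximable_at_def)
  then show ?thesis
    by (auto intro!: open_UN open_Collect_less continuous_intros)
qed

text \<open>Otherwise the counting function is at most \<open>\<delta>\<close> on all of
  \<open>Z\<close>. In its integral the constant term is at least \<open>\<kappa> * \<mu>\<close>,
  the other frequencies in \<open>int_cube R\<close> give at most
  \<open>J * (\<delta> * \<mu>)\<close>, and those outside at most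
  \<open>2 * \<tau> = \<kappa> * \<mu> / 4\<close>. The choice of \<open>\<delta>\<close> then
  leaves \<open>\<kappa> * \<mu> \<le> \<kappa> * \<mu> / 2\<close>.\<close>

lemma approximable_points_meet:
  fixes \<alpha> :: "real ^ 'n ^ 'm" and f :: "real ^ 'd::finite \<Rightarrow> real ^ 'm"
  assumes ns: "\<not> singular_matrix \<alpha>" and c: "c > 0"
    and nd: "nondegenerate TYPE('d) M" and chart: "local_param M U f"
    and Z: "Z \<in> sets borel" "bounded Z" "Z \<subseteq> U" and pos: "measure lebesgue Z > 0"
  obtains x Q where "x \<in> Z" "Q \<ge> Q\<^sub>0" "approximable_at \<alpha> c Q (f x)"
proof (rule ccontr)
  note meet = that
  assume "\<not> thesis"
  then have far: "\<not> approximable_at \<alpha> c Q (f x)" if xQ: "x \<in> Z" "Q \<ge> Q\<^sub>0" for x Q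
    using meet[OF xQ] by blast
  define \<mu> where "\<mu> = measure lebesgue Z"
  have \<mu>: "\<mu> > 0" "measure lborel Z = \<mu>" using pos Z by (simp_all add: \<mu>_def measure_completion)
  obtain \<kappa> where \<kappa>: "\<kappa> > 0"
    and eq: "\<And>R \<delta> Q\<^sub>0. 0 < \<delta> \<Longrightarrow> \<delta> \<le> 1 \<Longrightarrow> equidistributed_counting \<alpha> c \<kappa> R \<delta> Q\<^sub>0"
    using equidistributed_counting_functions[OF ns c] by blast
  define \<tau> where "\<tau> = \<kappa> * \<mu> / 8"
  have \<tau>: "\<tau> > 0" using \<kappa> \<mu> by (simp add: \<tau>_def)
  obtain R :: nat where R: "\<And>a. norm a > real R \<Longrightarrow>
      norm (LINT x:Z|lborel. cis (2 * pi * (a \<bullet> f x))) \<le> \<tau>"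
    using chart_fourier_decay[OF nd chart Z \<tau>] by blast
  define J where "J = real (card (int_cube R :: ('m \<Rightarrow> int) set))"
  \<comment> \<open>\<open>J\<close> pays for the low frequencies, the added 1 for the integral of
    the counting function itself.\<close>
  define \<delta> where "\<delta> = min 1 (\<kappa> / (4 * (J + 1)))"
  have J: "J \<ge> 0" by (simp add: J_def)
  have \<delta>: "0 < \<delta>" "\<delta> \<le> 1" using \<kappa> J by (auto simp: \<delta>_def)
  have \<delta>J: "\<delta> * (J + 1) \<le> \<kappa> / 4"
  proof -
    have "\<delta> * (J + 1) \<le> \<kappa> / (4 * (J + 1)) * (J + 1)" using J by (intro mult_right_mono) (auto simp: \<delta>_def)
    also have "\<dots> = \<kappa> / 4" using J by (simp add: field_simps)
    finally show ?thesis .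
  qed
  obtain Q N and C :: "('m \<Rightarrow> int) \<Rightarrow> real" where Q: "Q \<ge> Q\<^sub>0" and C: "\<And>a. C a \<ge> 0" "C (\<lambda>_. 0) \<ge> \<kappa>"
    "(\<Sum>a\<in>int_cube N. C a) \<le> 2" "\<And>a. a \<in> int_cube R \<Longrightarrow> a \<noteq> (\<lambda>_. 0) \<Longrightarrow> C a \<le> \<delta>"
    "\<And>y. \<not> approximable_at \<alpha> c Q y \<Longrightarrow>
       norm (\<Sum>a\<in>int_cube N. complex_of_real (C a) * cis (2 * pi * int_inner a y)) \<le> \<delta>"
    using eq[OF \<delta>, of R Q\<^sub>0] unfolding equidistributed_counting_def by blast
  have contf: "continuous_on Z f"
    using chart Z(3) real_analytic_continuous_on continuous_on_subset by (metis local_param_def)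
  have contE: "continuous_on Z (\<lambda>x. cis (2 * pi * int_inner a (f x)))" for a
    unfolding int_inner_eq_inner by (intro continuous_intros contf)
  have fin: "emeasure lborel Z < \<infinity>" using Z(2) by (rule emeasure_bounded_finite)
  define I where "I a = (LINT x:Z|lborel. cis (2 * pi * int_inner a (f x)))" for a
  note integrable = set_integral_bounded(1)[OF Z(1) fin contE, of _ 1]
  have I_le: "norm (I a) \<le> \<mu>" for a
    using set_integral_bounded(2)[OF Z(1) fin contE, of a 1] by (simp add: I_def \<mu>(2))
  have I0: "I (\<lambda>_. 0) = of_real \<mu>"
  proof -
    have "integrable lborel (indicat_real Z)" using Z(1) fin by (intro integrable_real_indicator) auto
    then have "(LINT x|lborel. indicat_real Z x *\<^sub>R (1::complex)) = (LINT x|lborel. indicat_real Z x) *\<^sub>R 1"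
      by (intro integral_scaleR_left)
    then show ?thesis using Z(1)
      by (simp add: I_def int_inner_def set_lebesgue_integral_def \<mu>(2) scaleR_conv_of_real)
  qed
  have I_decay: "norm (I a) \<le> \<tau>" if a: "a \<notin> int_cube R" for a
  proof -
    obtain i where "\<bar>a i\<bar> > int R" using a by (auto simp: mem_int_cube not_le)
    then have "real R < \<bar>(\<chi> i. real_of_int (a i)) $ i\<bar>" by simp
    also have "\<dots> \<le> norm (\<chi> i. real_of_int (a i))" by (rule component_le_norm_cart)
    finally show ?thesis unfolding I_def int_inner_eq_inner by (rule R)
  qed
  let ?F = "\<lambda>x. \<Sum>a\<in>int_cube N. complex_of_real (C a) * cis (2 * pi * int_inner a (f x))"
  have int_F: "(LINT x:Z|lborel. ?F x) = (\<Sum>a\<in>int_cube N. of_real (C a) * I a)"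
  proof -
    have "(LINT x:Z|lborel. ?F x) = (LINT x|lborel. (\<Sum>a\<in>int_cube N.
        of_real (C a) * (indicat_real Z x *\<^sub>R cis (2 * pi * int_inner a (f x)))))"
      unfolding set_lebesgue_integral_def by (simp add: scaleR_sum_right mult_scaleR_right)
    also have "\<dots> = (\<Sum>a\<in>int_cube N. LINT x|lborel.
        of_real (C a) * (indicat_real Z x *\<^sub>R cis (2 * pi * int_inner a (f x))))"
      using integrable unfolding set_integrable_def
      by (intro Bochner_Integration.integral_sum integrable_mult_right) auto
    also have "\<dots> = (\<Sum>a\<in>int_cube N. of_real (C a) * I a)"
      unfolding I_def set_lebesgue_integral_def by (intro sum.cong refl integral_mult_right_zero)
    finally show ?thesis .
  qed
  have F_le: "norm (LINT x:Z|lborel. ?F x) \<le> \<delta> * \<mu>"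
    unfolding \<mu>(2)[symmetric]
  proof (rule set_integral_bounded(2)[OF Z(1) fin])
    show "continuous_on Z ?F" by (intro continuous_intros contE)
    show "norm (?F x) \<le> \<delta>" if "x \<in> Z" for x using C(5) far[OF that Q] by blast
  qed
  have zero_mem: "(\<lambda>_. 0) \<in> int_cube N" by (simp add: mem_int_cube)
  let ?A = "int_cube N - {\<lambda>_. 0} :: ('m \<Rightarrow> int) set"
  have "(\<Sum>a\<in>int_cube N. of_real (C a) * I a) = of_real (C (\<lambda>_. 0) * \<mu>) + (\<Sum>a\<in>?A. of_real (C a) * I a)"
    using sum.remove[OF finite_int_cube zero_mem, of "\<lambda>a. of_real (C a) * I a"] by (simp add: I0)
  then have "complex_of_real (C (\<lambda>_. 0) * \<mu>) = (LINT x:Z|lborel. ?F x) - (\<Sum>a\<in>?A. of_real (C a) * I a)"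
    unfolding int_F by simp
  then have "norm (complex_of_real (C (\<lambda>_. 0) * \<mu>)) \<le>
      norm (LINT x:Z|lborel. ?F x) + norm (\<Sum>a\<in>?A. of_real (C a) * I a)"
    by (simp only: norm_triangle_ineq4)
  moreover have "norm (complex_of_real (C (\<lambda>_. 0) * \<mu>)) = C (\<lambda>_. 0) * \<mu>"
    using C(1) \<mu> by (simp only: norm_of_real) simp
  moreover have "norm (\<Sum>a\<in>?A. of_real (C a) * I a) \<le> J * (\<delta> * \<mu>) + 2 * \<tau>"
  proof -
    have "norm (of_real (C a) * I a) \<le> (if a \<in> int_cube R then \<delta> * \<mu> else 0) + C a * \<tau>"
      if a: "a \<in> ?A" for a
    proof (cases "a \<in> int_cube R")
      case True
      have "C a * norm (I a) \<le> \<delta> * \<mu>" using C(1,4) True a I_le \<delta> by (intro mult_mono) auto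
      then show ?thesis using True C(1)[of a] \<tau> by (simp add: norm_mult add_increasing2)
    next
      case False
      then show ?thesis using I_decay[OF False] C(1)[of a] by (simp add: norm_mult mult_left_mono)
    qed
    then have "norm (\<Sum>a\<in>?A. of_real (C a) * I a) \<le>
        (\<Sum>a\<in>?A. (if a \<in> int_cube R then \<delta> * \<mu> else 0) + C a * \<tau>)" by (rule sum_norm_le)
    also have "\<dots> = (\<Sum>a\<in>?A. if a \<in> int_cube R then \<delta> * \<mu> else 0) + (\<Sum>a\<in>?A. C a) * \<tau>"
      by (simp add: sum.distrib sum_distrib_right)
    also have "(\<Sum>a\<in>?A. if a \<in> int_cube R then \<delta> * \<mu> else 0) = real (card (?A \<inter> int_cube R)) * (\<delta> * \<mu>)"
      by (simp add: sum.If_cases)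
    also have "\<dots> \<le> J * (\<delta> * \<mu>)"
      unfolding J_def using \<delta> \<mu> by (intro mult_right_mono) (auto intro!: card_mono)
    also have "(\<Sum>a\<in>?A. C a) \<le> 2"
    proof -
      have "(\<Sum>a\<in>?A. C a) \<le> (\<Sum>a\<in>int_cube N. C a)" using C(1) by (intro sum_mono2) auto
      then show ?thesis using C(3) by linarith
    qed
    then have "(\<Sum>a\<in>?A. C a) * \<tau> \<le> 2 * \<tau>" using \<tau> by (intro mult_right_mono) auto
    finally show ?thesis by simp
  qed
  ultimately have "C (\<lambda>_. 0) * \<mu> \<le> (\<delta> * (J + 1)) * \<mu> + 2 * \<tau>" using F_le by (simp add: algebra_simps)
  moreover have "(\<delta> * (J + 1)) * \<mu> \<le> \<kappa> / 4 * \<mu>" using \<delta>J \<mu> by (intro mult_right_mono) auto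
  moreover have "\<kappa> * \<mu> \<le> C (\<lambda>_. 0) * \<mu>" using C(2) \<mu> by (intro mult_right_mono) auto
  moreover have "\<kappa> * \<mu> > 0" using \<kappa> \<mu> by simp
  ultimately show False unfolding \<tau>_def by (simp add: field_simps)
qed

text \<open>The exceptional set is itself a legitimate test set: Borel because approximability is an
  open condition, and bounded after intersection with a ball. With positive measure it would contain
  an approximable point.\<close>

lemma negligible_eventually_not_approximable:
  fixes \<alpha> :: "real ^ 'n ^ 'm" and f :: "real ^ 'd::finite \<Rightarrow> real ^ 'm"
  assumes ns: "\<not> singular_matrix \<alpha>" and c: "c > 0"
    and nd: "nondegenerate TYPE('d) M" and chart: "local_param M U f"
  shows "negligible {x\<in>U. \<forall>Q\<ge>Q\<^sub>0. \<not> approximable_at \<alpha> c Q (f x)}" (is "negligible ?S")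
proof -
  have U: "open U" "continuous_on U f"
    using chart real_analytic_continuous_on by (auto simp: local_param_def)
  have "open (\<Union>Q\<in>{Q\<^sub>0..}. U \<inter> f -` {y. approximable_at \<alpha> c Q y})"
    using continuous_open_preimage[OF U(2,1) open_approximable_at] by blast
  moreover have "?S = U - (\<Union>Q\<in>{Q\<^sub>0..}. U \<inter> f -` {y. approximable_at \<alpha> c Q y})" by auto
  ultimately have S: "?S \<in> sets borel" using U(1) by simp
  have "negligible (?S \<inter> cball 0 (real n))" for n
  proof (rule ccontr)
    assume nn: "\<not> negligible (?S \<inter> cball 0 (real n))"
    let ?Z = "?S \<inter> cball 0 (real n)"
    have Z: "?Z \<in> sets borel" "bounded ?Z" "?Z \<subseteq> U" using S by (auto intro: bounded_subset[OF bounded_cball])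
    then have "?Z \<in> lmeasurable" by (intro bounded_set_imp_lmeasurable) auto
    then have "measure lebesgue ?Z > 0"
      using nn by (simp add: negligible_iff_measure zero_less_measure_iff)
    from approximable_points_meet[OF ns c nd chart Z this, of Q\<^sub>0] show False by blast
  qed
  then have "negligible (\<Union>n. ?S \<inter> cball 0 (real n))" by (rule negligible_Union_nat)
  moreover have "(\<Union>n. ?S \<inter> cball 0 (real n)) = ?S"
    using real_arch_simple by (auto simp: dist_norm)
  ultimately show ?thesis by simp
qed

section \<open>From unbounded scales to infinitely many solutions\<close>

lemma finite_bounded_int_vectors: "finite {p \<in> int_vectors. norm (p :: real ^ 'm) \<le> K}"
proof (rule finite_surj)
  show "finite (int_cube (nat \<lceil>K\<rceil>) :: ('m \<Rightarrow> int) set)" by simp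
  show "{p \<in> int_vectors. norm (p :: real ^ 'm) \<le> K} \<subseteq> (\<lambda>a. \<chi> i. real_of_int (a i)) ` int_cube (nat \<lceil>K\<rceil>)"
  proof
    fix p :: "real ^ 'm" assume p: "p \<in> {p \<in> int_vectors. norm p \<le> K}"
    have le: "\<bar>\<lfloor>p $ i\<rfloor>\<bar> \<le> int (nat \<lceil>K\<rceil>)" and eq: "of_int \<lfloor>p $ i\<rfloor> = p $ i" for i
    proof -
      show eq: "of_int \<lfloor>p $ i\<rfloor> = p $ i" using p by (simp add: int_vectors_def)
      have "\<bar>p $ i\<bar> \<le> K" using p component_le_norm_cart[of p i] by simp
      then have "real_of_int \<bar>\<lfloor>p $ i\<rfloor>\<bar> \<le> K" by (simp only: of_int_abs eq)
      then show "\<bar>\<lfloor>p $ i\<rfloor>\<bar> \<le> int (nat \<lceil>K\<rceil>)" by linarith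
    qed
    show "p \<in> (\<lambda>a. \<chi> i. real_of_int (a i)) ` int_cube (nat \<lceil>K\<rceil>)"
    proof
      show "p = (\<chi> i. real_of_int \<lfloor>p $ i\<rfloor>)" by (simp only: vec_eq_iff vec_lambda_beta eq simp_thms)
      show "(\<lambda>i. \<lfloor>p $ i\<rfloor>) \<in> int_cube (nat \<lceil>K\<rceil>)" unfolding mem_int_cube using le by blast
    qed
  qed
qed

text \<open>If there were only finitely many solutions, their distances would have a positive
  minimum, since \<open>exact\<close> excludes exact hits. A large scale gives a solution below this
  minimum, yet \<open>norm q \<le> Q\<close> makes it one of the finitely many.\<close>

lemma T_approx_if_approximable:
  fixes \<alpha> :: "real ^ 'n ^ 'm"
  assumes c: "c > 0" and appr: "\<And>j::nat. \<exists>Q\<ge>real j. approximable_at \<alpha> c Q \<beta>"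
    and exact: "\<And>p q. p \<in> int_vectors \<Longrightarrow> q \<in> int_vectors \<Longrightarrow> \<alpha> *v q + \<beta> + p \<noteq> 0"
  shows "\<beta> \<in> T_approx (\<lambda>q. c * q powr (- (real CARD('n) / real CARD('m)))) \<alpha>"
proof (rule ccontr)
  let ?e = "- (real CARD('n) / real CARD('m))"
  assume notin: "\<not> ?thesis"
  define A where "A = {(p, q). p \<in> int_vectors \<and> q \<in> int_vectors - {0} \<and>
      norm (\<alpha> *v q + \<beta> + p) \<le> c * norm q powr ?e}"
  have "finite A" using notin unfolding T_approx_def A_def by simp
  define B where "B = (\<lambda>p :: real ^ 'm. (p, 0 :: real ^ 'n)) ` {p \<in> int_vectors. norm p \<le> norm \<beta> + c}"
  have "finite B" unfolding B_def by (intro finite_imageI finite_bounded_int_vectors)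
  define D where "D = insert 1 ((\<lambda>(p, q). norm (\<alpha> *v q + \<beta> + p)) ` (A \<union> B))"
  have D: "finite D" "D \<noteq> {}" using \<open>finite A\<close> \<open>finite B\<close> by (auto simp: D_def)
  have "0 \<in> (int_vectors :: (real ^ 'n) set)" by (simp add: int_vectors_def)
  then have "d > 0" if "d \<in> D" for d
    using that exact unfolding D_def A_def B_def by fastforce
  then have Dmin: "Min D > 0" using D by simp
  have "((\<lambda>Q. c * Q powr ?e) \<longlongrightarrow> c * 0) at_top"
    by (intro tendsto_intros tendsto_neg_powr filterlim_ident) auto
  then have "\<forall>\<^sub>F Q in at_top. c * Q powr ?e < Min D" using Dmin by (intro order_tendstoD) auto
  then obtain Q1 where Q1: "\<And>Q. Q \<ge> Q1 \<Longrightarrow> c * Q powr ?e < Min D"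
    by (auto simp: eventually_at_top_linorder)
  obtain j :: nat where j: "real j \<ge> max 1 Q1" using real_arch_simple by blast
  obtain Q where Q: "Q \<ge> real j" "approximable_at \<alpha> c Q \<beta>" using appr by blast
  then obtain p q where pq: "p \<in> int_vectors" "q \<in> int_vectors" "norm q \<le> Q"
    "norm (\<alpha> *v q + \<beta> + p) < c * Q powr ?e" by (auto simp: approximable_at_def)
  have Q2: "Q \<ge> 1" "Q \<ge> Q1" using Q j by auto
  have "(p, q) \<in> A \<union> B"
  proof (cases "q = 0")
    case True
    have "Q powr ?e \<le> 1" using Q2 by (simp add: powr_minus_divide ge_one_powr_ge_zero)
    then have "c * Q powr ?e \<le> c" using c by simp
    then have "norm (\<beta> + p) \<le> c" using pq(4) True by simp
    moreover have "norm p \<le> norm (\<beta> + p) + norm \<beta>"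
      using norm_triangle_ineq4[of "\<beta> + p" \<beta>] by simp
    ultimately show ?thesis using True pq(1) by (simp add: B_def)
  next
    case False
    have "Q powr ?e \<le> norm q powr ?e" using False pq(3) by (intro powr_mono2') auto
    then have "c * Q powr ?e \<le> c * norm q powr ?e" using c by simp
    then show ?thesis using False pq by (auto simp: A_def)
  qed
  then have "Min D \<le> norm (\<alpha> *v q + \<beta> + p)"
    using D(1) by (intro Min_le) (auto simp: D_def)
  then show False using pq(4) Q1[OF Q2(2)] by linarith
qed

lemma countable_int_vectors: "countable (int_vectors :: (real ^ 'm) set)"
proof -
  have "(int_vectors :: (real ^ 'm) set) \<subseteq> (\<Union>n::nat. {p \<in> int_vectors. norm p \<le> real n})"
    by (auto intro: real_arch_simple)
  moreover have "countable (\<Union>n::nat. {p \<in> int_vectors. norm (p :: real ^ 'm) \<le> real n})"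
    by (rule countable_UN) (simp_all add: countable_finite finite_bounded_int_vectors)
  ultimately show ?thesis by (rule countable_subset)
qed

text \<open>Exact hits form a countable set, and a chart is injective, so they are null in the
  chart. Every other exceptional point fails to be approximable from some natural scale on.\<close>

lemma negligible_chart_not_T_approx:
  fixes \<alpha> :: "real ^ 'n ^ 'm" and f :: "real ^ 'd::finite \<Rightarrow> real ^ 'm"
  assumes ns: "\<not> singular_matrix \<alpha>" and c: "c > 0"
    and nd: "nondegenerate TYPE('d) M" and chart: "local_param M U f"
  shows "negligible (U \<inter> f -` (- T_approx (\<lambda>q. c * q powr (- (real CARD('n) / real CARD('m)))) \<alpha>))"
proof -
  define E where "E = (\<lambda>(p, q). - (\<alpha> *v q + p)) ` (int_vectors \<times> int_vectors)"
  have "countable E" unfolding E_def by (intro countable_image countable_SIGMA countable_int_vectors)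
  obtain g where g: "homeomorphism U (f ` U) f g" using chart by (auto simp: local_param_def)
  have "U \<inter> f -` E \<subseteq> g ` E"
  proof
    fix x assume x: "x \<in> U \<inter> f -` E"
    then have "x = g (f x)" using homeomorphism_apply1[OF g] by simp
    moreover have "f x \<in> E" using x by simp
    ultimately show "x \<in> g ` E" by (rule image_eqI)
  qed
  then have "countable (U \<inter> f -` E)" by (rule countable_subset) (intro countable_image \<open>countable E\<close>)
  then have "negligible (U \<inter> f -` E)" 
    by (simp add: countable_imp_null_set_lborel negligible_iff_null_sets null_sets_completionI)
  moreover have "negligible (\<Union>j::nat. {x\<in>U. \<forall>Q\<ge>real j. \<not> approximable_at \<alpha> c Q (f x)})"
    by (intro negligible_Union_nat negligible_eventually_not_approximable[OF ns c nd chart])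
  ultimately have "negligible (U \<inter> f -` E \<union> (\<Union>j::nat. {x\<in>U. \<forall>Q\<ge>real j. \<not> approximable_at \<alpha> c Q (f x)}))"
    by (rule negligible_Un)
  then show ?thesis
  proof (rule negligible_subset, intro subsetI)
    fix x assume x: "x \<in> U \<inter> f -` (- T_approx (\<lambda>q. c * q powr (- (real CARD('n) / real CARD('m)))) \<alpha>)"
    show "x \<in> U \<inter> f -` E \<union> (\<Union>j::nat. {x\<in>U. \<forall>Q\<ge>real j. \<not> approximable_at \<alpha> c Q (f x)})"
    proof (rule ccontr)
      assume no: "\<not> ?thesis"
      have "\<alpha> *v q + f x + p \<noteq> 0" if "p \<in> int_vectors" "q \<in> int_vectors" for p q
      proof
        assume "\<alpha> *v q + f x + p = 0"
        then have "f x + (\<alpha> *v q + p) = 0" by (simp add: add_ac)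
        then have "f x = - (\<alpha> *v q + p)" by (rule eq_neg_iff_add_eq_0[THEN iffD2])
        then have "f x \<in> E" using that by (force simp: E_def)
        then show False using no x by simp
      qed
      moreover have "\<exists>Q\<ge>real j. approximable_at \<alpha> c Q (f x)" for j using no x by auto
      ultimately have "f x \<in> T_approx (\<lambda>q. c * q powr (- (real CARD('n) / real CARD('m)))) \<alpha>"
        by (intro T_approx_if_approximable[OF c]) auto
      then show False using x by simp
    qed
  qed
qed

lemma T_approx_mono:
  assumes "\<And>q. \<psi> q \<le> \<psi>' q"
  shows "T_approx \<psi> \<alpha> \<subseteq> T_approx \<psi>' \<alpha>"
proof
  fix \<beta> assume "\<beta> \<in> T_approx \<psi> \<alpha>"
  then have "infinite {(p, q). p \<in> int_vectors \<and> q \<in> int_vectors - {0} \<and> norm (\<alpha> *v q + \<beta> + p) \<le> \<psi> (norm q)}"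
    by (simp add: T_approx_def)
  then have "infinite {(p, q). p \<in> int_vectors \<and> q \<in> int_vectors - {0} \<and> norm (\<alpha> *v q + \<beta> + p) \<le> \<psi>' (norm q)}"
    by (rule infinite_super[rotated]) (auto intro: order.trans assms)
  then show "\<beta> \<in> T_approx \<psi>' \<alpha>" by (simp add: T_approx_def)
qed

text \<open>\<open>T_approx\<close> shrinks with the constant, so the values
  \<open>inverse (real (Suc j))\<close> suffice and the union becomes countable.\<close>

lemma Tad_subset:
  fixes \<alpha> :: "real ^ 'n ^ 'm"
  shows "Tad \<alpha> \<subseteq> (\<Union>j::nat. - T_approx (\<lambda>q. inverse (real (Suc j)) * q powr (- (real CARD('n) / real CARD('m)))) \<alpha>)"
proof
  fix \<beta> assume "\<beta> \<in> Tad \<alpha>"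
  then obtain c where c: "c > 0" "\<beta> \<notin> T_approx (\<lambda>q. c * q powr (- (real CARD('n) / real CARD('m)))) \<alpha>"
    by (auto simp: Tad_def)
  obtain j where j: "inverse (real (Suc j)) < c" using reals_Archimedean c(1) by blast
  have "T_approx (\<lambda>q. inverse (real (Suc j)) * q powr (- (real CARD('n) / real CARD('m)))) \<alpha>
      \<subseteq> T_approx (\<lambda>q. c * q powr (- (real CARD('n) / real CARD('m)))) \<alpha>"
    using j by (intro T_approx_mono mult_right_mono) auto
  then show "\<beta> \<in> (\<Union>j::nat. - T_approx (\<lambda>q. inverse (real (Suc j)) * q powr (- (real CARD('n) / real CARD('m)))) \<alpha>)"
    using c(2) by blast
qed

theorem theorem1p4:
  fixes \<alpha> :: "real ^ 'n ^ 'm"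
  assumes "CARD('m) \<ge> 2"
    and "\<not> singular_matrix \<alpha>"
  shows "(\<forall>M. analytic_submanifold TYPE('d::finite) M \<and> nondegenerate TYPE('d) M \<longrightarrow>
            zero_measure_on TYPE('d) M (Tad \<alpha>)) \<and>
         (\<forall>c>0. \<forall>M. analytic_submanifold TYPE('d) M \<and> nondegenerate TYPE('d) M \<longrightarrow>
            full_measure_on TYPE('d) M
              (T_approx (\<lambda>q. c * q powr (- (real CARD('n) / real CARD('m)))) \<alpha>))"
proof (intro conjI allI impI; elim conjE)
  fix M :: "(real ^ 'm) set"
  assume nd: "nondegenerate TYPE('d) M"
  show "zero_measure_on TYPE('d) M (Tad \<alpha>)"
  proof (rule zero_measure_onI)
    fix U and f :: "real ^ 'd \<Rightarrow> real ^ 'm" assume chart: "local_param M U f"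
    have "negligible (\<Union>j::nat. U \<inter> f -` (- T_approx (\<lambda>q. inverse (real (Suc j)) * q powr (- (real CARD('n) / real CARD('m)))) \<alpha>))"
      by (intro negligible_Union_nat negligible_chart_not_T_approx[OF assms(2) _ nd chart]) simp
    then show "negligible (U \<inter> f -` Tad \<alpha>)"
      by (rule negligible_subset) (use Tad_subset[of \<alpha>] in blast)
  qed
next
  fix c :: real and M :: "(real ^ 'm) set"
  assume "c > 0" and nd: "nondegenerate TYPE('d) M"
  show "full_measure_on TYPE('d) M (T_approx (\<lambda>q. c * q powr (- (real CARD('n) / real CARD('m)))) \<alpha>)"
    unfolding full_measure_on_def
  proof (rule zero_measure_onI)
    fix U and f :: "real ^ 'd \<Rightarrow> real ^ 'm" assume chart: "local_param M U f"
    show "negligible (U \<inter> f -` (M - T_approx (\<lambda>q. c * q powr (- (real CARD('n) / real CARD('m)))) \<alpha>))"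
      by (rule negligible_subset[OF negligible_chart_not_T_approx[OF assms(2) \<open>c > 0\<close> nd chart]]) auto
  qed
qed

end
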